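(* Let $m\ge 1$ be an integer, and let $q_{KL}$, $q_k$ and $\omega_k$ ($k\ge 1$) be the bases and words associated with the alphabet $\{0,1,\ldots,2m\}$ (defined in the context). Then: (i) If $q_{KL}<q<\infty$, then $\mathcal D_{m,m}(q)$ contains an interval of positive length. (ii) If $q=q_{KL}$, then $\mathcal D_{m,m}(q)$ is formed by (i.e. is exactly the set of) the numbers $$0,\quad \frac{\log (m+1)}{\log q},\quad \frac{\log [m^2(m+1)]}{3\log q},$$ and $$\frac{\log m}{\log q}-\frac{\log \frac{m+1}{m}}{\log q}\sum_{i=1}^j\left(-\frac{1}{2}\right)^i\quad\text{for } 1\le j<\infty.$$ (iii) If $q_k<q\le q_{k+1}$ for some $k\ge 1$, then $\mathcal D_{m,m}(q)$ is formed by the numbers $$0,\quad \frac{\log (m+1)}{\log q},\quad\text{and}\quad \frac{\log m}{\log q}-\frac{\log \frac{m+1}{m}}{\log q}\sum_{i=1}^j\left(-\frac{1}{2}\right)^i\quad\text{for } 1\le j<k \text{ if } k\ge 2.$$ More precisely, if $t\in\mathcal U_{m,m}(q)$ has the unique expansion $(t_i)$ and the sequence $(m+t_i)$ ends with $(\omega_j\overline{\omega_j})^{\infty}$ for some $j\ge1$, then $$\dim_H(\Gamma_{q,m} \cap (\Gamma_{q,m}+t))=\frac{\log m}{\log q}-\frac{\log \frac{m+1}{m}}{\log q}\sum_{i=1}^j\left(-\frac{1}{2}\right)^i.$$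
   Context: For a real number $q>1$ and a finite set $\Omega$ of real numbers, a sequence $(c_i)_{i=1}^\infty\in\Omega^{\mathbb N}$ is an expansion of $x$ in base $q$ over the alphabet $\Omega$ if $\sum_{i=1}^\infty c_iq^{-i}=x$. For a positive integer $m$ put $\Gamma_{q,m}=\{\sum_{i=1}^\infty c_iq^{-i} : c_i\in\{0,1,\ldots,m\}\}$. $\mathcal U_{m,m}(q)$ denotes the set of real numbers $t$ having a unique expansion $(t_i)$ in base $q$ over the alphabet $\{-m,\ldots,-1,0,1,\ldots,m\}$, and $$\mathcal D_{m,m}(q)=\{\dim_H(\Gamma_{q,m}\cap(\Gamma_{q,m}+t)) : t\in\mathcal U_{m,m}(q)\},$$ where $\dim_H$ is Hausdorff dimension. Over the alphabet $\{0,1,\ldots,2m\}$: the reflection of a word $w=b_1\cdots b_n$ is $\overline{w}=(2m-b_1)\cdots(2m-b_n)$, and $w^+=b_1\cdots b_{n-1}(b_n+1)$ if $b_n<2m$. Define words recursively by $\omega_1=m+1$ (a word of length one) and $\omega_{k+1}=(\omega_k\overline{\omega_k})^+$ for $k\ge1$. For each $k\ge 1$, $q_k>1$ is the base in which $\omega_k0^\infty$ is the greedy (i.e. lexicographically largest) expansion of $1$ over $\{0,1,\ldots,2m\}$; in particular $q_1=m+1$. The Komornik--Loreti constant $q_{KL}$ is the smallest base $q>1$ in which $1$ has a unique expansion over $\{0,1,\ldots,2m\}$. It is known that $(q_k)$ is increasing and converges to $q_{KL}$, and that the unique expansion of $1$ in base $q_{KL}$ is $(m+\tau_i-\tau_{i-1})_{i=1}^\infty$,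 where $(\tau_i)_{i=0}^\infty=0110\,1001\,1001\,0110\cdots$ is the Thue--Morse sequence.
   Formalization: All sums of (-1/2)^i run from i=1 to j-1 instead of to j: as printed the formula fails, e.g. for m=1, q_2<q≤q_3, (t_i)=(1,-1)^∞, where (1+t_i)=(ω_1 ω̄_1)^∞ and the intersection is a single point, so its dimension is 0, not log 2/(2 log q). *)

theory Defs
  imports "HOL-Analysis.Analysis"
begin

section \<open>Hausdorff dimension\<close>

definition hausdorff_premeasure :: "real \<Rightarrow> real \<Rightarrow> 'a::metric_space set \<Rightarrow> ennreal" where
  "hausdorff_premeasure s \<delta> A =
     (INF U \<in> {U :: nat \<Rightarrow> 'a set.
                 A \<subseteq> (\<Union>i. U i) \<and> (\<forall>i. bounded (U i) \<and> diameter (U i) \<le> \<delta>)}.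
        (\<Sum>i. ennreal (diameter (U i) powr s)))"

definition hausdorff_outer_measure :: "real \<Rightarrow> 'a::metric_space set \<Rightarrow> ennreal" where
  "hausdorff_outer_measure s A = (SUP \<delta> \<in> {0<..}. hausdorff_premeasure s \<delta> A)"

text \<open>
  Only exponents \<open>s > 0\<close> are used: \<open>0 powr 0 = 0\<close>, so that for \<open>s = 0\<close> the
  definition above is not the counting measure. On the real line every set is null for each
  \<open>s > 1\<close>, hence the infimum is taken over a nonempty set that is bounded below.
\<close>

definition hausdorff_dim :: "real set \<Rightarrow> real" where
  "hausdorff_dim A = Inf {s. s > 0 \<and> hausdorff_outer_measure s A = 0}"


section \<open>Expansions in base \<open>q\<close>\<close>

text \<open>Digit sequences are indexed from \<open>0\<close>: the digit \<open>c\<^sub>i\<close>, \<open>i \<ge> 1\<close>, is \<open>c (i - 1)\<close>.\<close>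

definition is_expansion :: "real \<Rightarrow> int set \<Rightarrow> (nat \<Rightarrow> int) \<Rightarrow> real \<Rightarrow> bool" where
  "is_expansion q \<Omega> c x \<longleftrightarrow>
     (\<forall>i. c i \<in> \<Omega>) \<and> (\<lambda>i. of_int (c i) / q ^ Suc i) sums x"

definition has_unique_expansion :: "real \<Rightarrow> int set \<Rightarrow> real \<Rightarrow> bool" where
  "has_unique_expansion q \<Omega> x \<longleftrightarrow> (\<exists>!c. is_expansion q \<Omega> c x)"

definition lex_less :: "(nat \<Rightarrow> int) \<Rightarrow> (nat \<Rightarrow> int) \<Rightarrow> bool" where
  "lex_less c d \<longleftrightarrow> (\<exists>n. (\<forall>i<n. c i = d i) \<and> c n < d n)"

definition is_greedy_expansion :: "real \<Rightarrow> int set \<Rightarrow> (nat \<Rightarrow> int) \<Rightarrow> real \<Rightarrow> bool" where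
  "is_greedy_expansion q \<Omega> c x \<longleftrightarrow>
     is_expansion q \<Omega> c x \<and> (\<forall>d. is_expansion q \<Omega> d x \<longrightarrow> d = c \<or> lex_less d c)"

definition Gamma_set :: "nat \<Rightarrow> real \<Rightarrow> real set" where
  "Gamma_set m q = {x. \<exists>c. is_expansion q {0..int m} c x}"

definition U_set :: "nat \<Rightarrow> real \<Rightarrow> real set" where
  "U_set m q = {t. has_unique_expansion q {- int m..int m} t}"

definition dim_intersection :: "nat \<Rightarrow> real \<Rightarrow> real \<Rightarrow> real" where
  "dim_intersection m q t = hausdorff_dim (Gamma_set m q \<inter> (\<lambda>x. x + t) ` Gamma_set m q)"

definition D_set :: "nat \<Rightarrow> real \<Rightarrow> real set" where
  "D_set m q = dim_intersection m q ` U_set m q"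


section \<open>The words \<open>\<omega>\<^sub>k\<close> and the bases \<open>q\<^sub>k\<close>, \<open>q\<^sub>K\<^sub>L\<close>\<close>

definition reflect_word :: "nat \<Rightarrow> int list \<Rightarrow> int list" where
  "reflect_word m w = map (\<lambda>b. 2 * int m - b) w"

definition plus_word :: "int list \<Rightarrow> int list" where
  "plus_word w = butlast w @ [last w + 1]"

text \<open>The words are indexed from \<open>1\<close>; the value at \<open>0\<close> is irrelevant.\<close>

fun omega :: "nat \<Rightarrow> nat \<Rightarrow> int list" where
  "omega m 0 = []"
| "omega m (Suc 0) = [int m + 1]"
| "omega m (Suc (Suc k)) =
     plus_word (omega m (Suc k) @ reflect_word m (omega m (Suc k)))"

text \<open>The infinite sequences \<open>w0\<^sup>\<infinity>\<close> and \<open>w\<^sup>\<infinity>\<close> (the latter for nonempty \<open>w\<close>).\<close>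

definition zero_extend :: "int list \<Rightarrow> nat \<Rightarrow> int" where
  "zero_extend w i = (if i < length w then w ! i else 0)"

definition periodic_seq :: "int list \<Rightarrow> nat \<Rightarrow> int" where
  "periodic_seq w i = w ! (i mod length w)"

definition ends_with :: "(nat \<Rightarrow> int) \<Rightarrow> (nat \<Rightarrow> int) \<Rightarrow> bool" where
  "ends_with c d \<longleftrightarrow> (\<exists>n. \<forall>i. c (n + i) = d i)"

definition q_base :: "nat \<Rightarrow> nat \<Rightarrow> real" where
  "q_base m k =
     (THE q. q > 1 \<and> is_greedy_expansion q {0..2 * int m} (zero_extend (omega m k)) 1)"

definition q_KL :: "nat \<Rightarrow> real" where
  "q_KL m = (LEAST q. q > 1 \<and> has_unique_expansion q {0..2 * int m} 1)"


section \<open>The intermediate dimensions\<close>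

text \<open>
  The number attached to \<open>(\<omega>\<^sub>j \<omega>\<^sub>j')\<^sup>\<infinity>\<close>, where \<open>\<omega>\<^sub>j'\<close> is the reflection of \<open>\<omega>\<^sub>j\<close>. The sum
  runs over \<open>1 \<le> i < j\<close>, i.e. up to \<open>j - 1\<close>. This corrects a misprint in the source, where the
  upper limit is \<open>j\<close>: with \<open>\<omega>\<^sub>1 = m + 1\<close>, an expansion \<open>(t\<^sub>i)\<close> for which \<open>(m + t\<^sub>i)\<close> ends with
  \<open>(\<omega>\<^sub>1 \<omega>\<^sub>1')\<^sup>\<infinity> = ((m+1)(m-1))\<^sup>\<infinity>\<close> has \<open>\<bar>t\<^sub>i\<bar> = 1\<close> eventually, which leaves
  \<open>m\<close> choices for each digit and gives dimension \<open>log m / log q\<close>, the value of the empty sum.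
  (For \<open>m = 1\<close> and \<open>(t\<^sub>i) = (1, -1)\<^sup>\<infinity>\<close> the intersection is a single point.)
\<close>

definition dim_value :: "nat \<Rightarrow> real \<Rightarrow> nat \<Rightarrow> real" where
  "dim_value m q j =
     ln (real m) / ln q
       - ln ((real m + 1) / real m) / ln q * (\<Sum>i\<in>{1..<j}. (- 1 / 2) ^ i)"

end

theory Submission
  imports Defs
begin

text \<open>
  For \<open>t\<close> with a unique expansion \<open>(t\<^sub>i)\<close>, the intersection of \<open>\<Gamma>\<close> with its translate consists of the
  sums with \<open>m + 1 - \<bar>t\<^sub>i\<bar>\<close> admissible digits at position \<open>i\<close>; as \<open>q > m + 1\<close>, these are separated and
  the dimension is the mean of \<open>log (m + 1 - \<bar>t\<^sub>i\<bar>) / log q\<close>. Uniqueness means that all relevant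
  tails of \<open>(m + t\<^sub>i)\<close> and of its reflection have value less than \<open>1\<close>, which for
  \<open>q \<le> q\<^sub>K\<^sub>L\<close> becomes a lexicographic bound. It forces the nonzero \<open>t\<^sub>i\<close> to be eventually \<open>1\<close>
  and \<open>-1\<close> in turn, so that \<open>t\<^sub>i = \<tau>\<^sub>i\<^sub>+\<^sub>1 - \<tau>\<^sub>i\<close> with a binary \<open>\<tau>\<close>. Such a \<open>\<tau>\<close> is
  eventually constant or the image of another admissible sequence under the Thue--Morse
  substitution, which turns the frequency \<open>z\<close> of zeros among the \<open>t\<^sub>i\<close> into \<open>(1 - z) / 2\<close>. Starting
  from constant sequences (\<open>z = 1\<close>) this gives the discrete list of dimensions, with the fixed point
  \<open>z = 1/3\<close> for infinitely desubstitutable \<open>\<tau>\<close>. For \<open>q > q\<^sub>K\<^sub>L\<close>, a high iterate of the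
  substitution maps every binary sequence to an admissible one, and \<open>z\<close> fills an interval.
\<close>

section \<open>Digit sequences and their values\<close>

text \<open>The uniqueness criterion is kept in terms of values of tails, since for a fixed digit
  sequence it is then monotone in \<open>q\<close>; a lexicographic bound is available only in a
  base where the bounding sequence has value exactly 1. The bases \<open>q_k\<close> and
  \<open>q_KL\<close> enter only through such an equation. The bounding sequence should have
  positive digits arbitrarily far out, so the finite greedy expansion of 1 in base
  \<open>q_k\<close> is traded for the periodic one, \<open>dig m (period_seq (k - 1))\<close>,
  which has the same value there. Strictness is the delicate point. A strict bound excludes the
  bounding sequence itself, and this ends the list of dimensions at \<open>j < k\<close> even for
  \<open>q = q_(k+1)\<close>. At \<open>q_KL\<close> the Thue-Morse digits are nevertheless a unique
  expansion, because only proper tails are compared with the bound.\<close>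

definition lexlt :: "(nat \<Rightarrow> 'a::linorder) \<Rightarrow> (nat \<Rightarrow> 'a) \<Rightarrow> bool" where
  "lexlt c d \<longleftrightarrow> (\<exists>n. (\<forall>i<n. c i = d i) \<and> c n < d n)"

definition lexle :: "(nat \<Rightarrow> 'a::linorder) \<Rightarrow> (nat \<Rightarrow> 'a) \<Rightarrow> bool" where
  "lexle c d \<longleftrightarrow> c = d \<or> lexlt c d"

definition shift :: "nat \<Rightarrow> (nat \<Rightarrow> 'a) \<Rightarrow> nat \<Rightarrow> 'a" where
  "shift n c = (\<lambda>i. c (n + i))"

definition compl_seq :: "int \<Rightarrow> (nat \<Rightarrow> int) \<Rightarrow> nat \<Rightarrow> int" where
  "compl_seq M c = (\<lambda>i. M - c i)"

definition digits_upto :: "int \<Rightarrow> (nat \<Rightarrow> int) \<Rightarrow> bool" where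
  "digits_upto M c \<longleftrightarrow> (\<forall>i. 0 \<le> c i \<and> c i \<le> M)"

definition val :: "real \<Rightarrow> (nat \<Rightarrow> int) \<Rightarrow> real" where
  "val q c = (\<Sum>i. of_int (c i) / q ^ Suc i)"

text \<open>The order is restated for arbitrary linear orders because binary sequences are compared
  as well, with \<open>False\<close> below \<open>True\<close>.\<close>

lemma lex_less_eq_lexlt: "lex_less = lexlt"
  by (intro ext) (simp add: lex_less_def lexlt_def)

lemma lexltI: "(\<And>i. i < n \<Longrightarrow> c i = d i) \<Longrightarrow> c n < d n \<Longrightarrow> lexlt c d"
  unfolding lexlt_def by blast

lemma lexltE:
  assumes "lexlt c d"
  obtains n where "\<And>i. i < n \<Longrightarrow> c i = d i" "c n < d n"
  using assms unfolding lexlt_def by blast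

lemma first_difference:
  assumes "c \<noteq> (d :: nat \<Rightarrow> 'a)"
  obtains n where "\<And>i. i < n \<Longrightarrow> c i = d i" "c n \<noteq> d n"
proof -
  from assms obtain k where k: "c k \<noteq> d k" by (auto simp: fun_eq_iff)
  have "c (LEAST n. c n \<noteq> d n) \<noteq> d (LEAST n. c n \<noteq> d n)"
    using k by (rule LeastI)
  moreover have "c i = d i" if "i < (LEAST n. c n \<noteq> d n)" for i
    using not_less_Least[OF that] by blast
  ultimately show thesis using that by blast
qed

lemma lexlt_linear: "lexlt c d \<or> c = d \<or> lexlt d c"
proof (cases "c = d")
  case False
  then obtain n where "\<And>i. i < n \<Longrightarrow> c i = d i" "c n \<noteq> d n"
    using first_difference by blast
  then show ?thesis by (metis lexltI neqE)
qed simp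

lemma lexlt_irrefl [simp]: "\<not> lexlt c c"
  by (auto simp: lexlt_def)

lemma lexlt_trans:
  assumes "lexlt c d" "lexlt d e" shows "lexlt c e"
proof -
  obtain n where n: "\<And>i. i < n \<Longrightarrow> c i = d i" "c n < d n" using assms(1) by (rule lexltE) auto
  obtain k where k: "\<And>i. i < k \<Longrightarrow> d i = e i" "d k < e k" using assms(2) by (rule lexltE) auto
  show ?thesis
  proof (rule lexltI[where n = "min n k"])
    show "c i = e i" if "i < min n k" for i using that n k by simp
    show "c (min n k) < e (min n k)"
      using n k by (cases n k rule: linorder_cases) (auto simp: min_def)
  qed
qed

lemma lexle_refl [simp]: "lexle c c"
  by (simp add: lexle_def)

lemma lexlt_imp_lexle: "lexlt c d \<Longrightarrow> lexle c d"
  by (simp add: lexle_def)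

lemma lexlt_lexle_trans: "lexlt c d \<Longrightarrow> lexle d e \<Longrightarrow> lexlt c e"
  using lexlt_trans by (auto simp: lexle_def)

lemma lexle_lexlt_trans: "lexle c d \<Longrightarrow> lexlt d e \<Longrightarrow> lexlt c e"
  using lexlt_trans by (auto simp: lexle_def)

lemma lexle_trans: "lexle c d \<Longrightarrow> lexle d e \<Longrightarrow> lexle c e"
  using lexlt_trans by (auto simp: lexle_def)

lemma lexle_hd: "lexle c d \<Longrightarrow> c 0 \<le> d 0"
  unfolding lexle_def lexlt_def by (metis gr0I less_imp_le order_refl)

lemma lexlt_tl:
  assumes "lexlt c d" "d 0 \<le> c 0"
  shows "lexlt (shift (Suc 0) c) (shift (Suc 0) d)"
proof -
  obtain n where n: "\<And>i. i < n \<Longrightarrow> c i = d i" "c n < d n" using assms(1) by (rule lexltE) auto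
  then obtain k where "n = Suc k" using assms(2) by (cases n) auto
  then show ?thesis using n by (intro lexltI[where n = k]) (auto simp: shift_def)
qed

lemma shift_apply [simp]: "shift n c i = c (n + i)"
  by (simp add: shift_def)

lemma shift_0 [simp]: "shift 0 c = c"
  by (simp add: shift_def)

lemma shift_shift [simp]: "shift n (shift k c) = shift (k + n) c"
  by (simp add: shift_def add.assoc)

lemma compl_seq_apply [simp]: "compl_seq M c i = M - c i"
  by (simp add: compl_seq_def)

lemma compl_compl [simp]: "compl_seq M (compl_seq M c) = c"
  by (simp add: compl_seq_def)

lemma shift_compl: "shift n (compl_seq M c) = compl_seq M (shift n c)"
  by (simp add: shift_def compl_seq_def)

lemma digits_upto_shift [simp]: "digits_upto M c \<Longrightarrow> digits_upto M (shift n c)"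
  by (simp add: digits_upto_def)

lemma digits_upto_compl [simp]: "digits_upto M (compl_seq M c) = digits_upto M c"
  by (auto simp: digits_upto_def)

section \<open>Series values as functions of the digits and of the base\<close>

lemma geometric_sums_base:
  assumes "1 < (q::real)"
  shows "(\<lambda>i. a / q ^ Suc i) sums (a / (q - 1))"
proof -
  have "(\<lambda>i. (a / q) * (1 / q) ^ i) sums ((a / q) * (1 / (1 - 1 / q)))"
    using assms by (intro sums_mult geometric_sums) auto
  moreover have "(a / q) * (1 / (1 - 1 / q)) = a / (q - 1)"
    using assms by (simp add: field_simps)
  moreover have "(\<lambda>i. (a / q) * (1 / q) ^ i) = (\<lambda>i. a / q ^ Suc i)"
    by (simp add: power_divide)
  ultimately show ?thesis by (simp only:)
qed

lemma summable_digits: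
  assumes "1 < q" "digits_upto M c"
  shows "summable (\<lambda>i. of_int (c i) / q ^ Suc i :: real)"
proof (rule summable_comparison_test')
  show "summable (\<lambda>i. of_int M / q ^ Suc i)"
    using geometric_sums_base[OF assms(1)] sums_summable by blast
  show "norm (of_int (c n) / q ^ Suc n :: real) \<le> of_int M / q ^ Suc n" for n
    using assms by (auto simp: digits_upto_def intro!: divide_right_mono)
qed

lemma val_sums:
  assumes "1 < q" "digits_upto M c"
  shows "(\<lambda>i. of_int (c i) / q ^ Suc i) sums val q c"
  unfolding val_def using summable_digits[OF assms] by (rule summable_sums)

lemma is_expansion_iff:
  assumes "1 < q"
  shows "is_expansion q {0..M} c x \<longleftrightarrow> digits_upto M c \<and> val q c = x"
proof
  assume "is_expansion q {0..M} c x"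
  then show "digits_upto M c \<and> val q c = x"
    by (auto simp: is_expansion_def digits_upto_def val_def sums_iff)
next
  assume "digits_upto M c \<and> val q c = x"
  then show "is_expansion q {0..M} c x"
    using val_sums[OF assms] by (auto simp: is_expansion_def digits_upto_def)
qed

lemma val_const: "1 < q \<Longrightarrow> val q (\<lambda>_. a) = a / (q - 1)"
  unfolding val_def using geometric_sums_base sums_unique by metis

lemma val_nonneg:
  assumes "1 < q" "digits_upto M c" shows "0 \<le> val q c"
  unfolding val_def using assms
  by (intro suminf_nonneg summable_digits[OF assms]) (auto simp: digits_upto_def)

lemma val_le:
  assumes "1 < q" "digits_upto M c" shows "val q c \<le> M / (q - 1)"
  by (rule sums_le[OF _ val_sums[OF assms] geometric_sums_base[OF assms(1)]])
     (use assms in \<open>auto simp: digits_upto_def intro!: divide_right_mono\<close>)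

lemma val_pos:
  assumes "1 < q" "digits_upto M c" "0 < c k" shows "0 < val q c"
  unfolding val_def using assms
  by (intro suminf_pos2[where i = k] summable_digits[OF assms(1,2)]) (auto simp: digits_upto_def)

lemma val_compl:
  assumes "1 < q" "digits_upto M c"
  shows "val q (compl_seq M c) = M / (q - 1) - val q c"
proof -
  have "(\<lambda>i. of_int M / q ^ Suc i - of_int (c i) / q ^ Suc i) sums (M / (q - 1) - val q c)"
    by (intro sums_diff geometric_sums_base val_sums[OF assms] assms)
  then show ?thesis
    unfolding val_def[of q "compl_seq M c"] by (simp add: diff_divide_distrib sums_iff)
qed

lemma val_split_initial:
  assumes "1 < q" "digits_upto M c"
  shows "val q c = (\<Sum>i<n. of_int (c i) / q ^ Suc i) + val q (shift n c) / q ^ n"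
proof -
  have "val q c = (\<Sum>i. of_int (c (i + n)) / q ^ Suc (i + n)) + (\<Sum>i<n. of_int (c i) / q ^ Suc i)"
    unfolding val_def by (intro suminf_split_initial_segment summable_digits[OF assms])
  moreover have "(\<Sum>i. of_int (c (i + n)) / q ^ Suc (i + n)) = (\<Sum>i. of_int (shift n c i) / q ^ Suc i / q ^ n)"
    by (intro arg_cong[where f = suminf] ext) (simp add: power_add add.commute)
  moreover have "\<dots> = val q (shift n c) / q ^ n"
    unfolding val_def using summable_digits[OF assms(1) digits_upto_shift[OF assms(2)]]
    by (rule suminf_divide)
  ultimately show ?thesis by simp
qed

lemma val_step:
  assumes "1 < q" "digits_upto M c"
  shows "val q c = (c 0 + val q (shift (Suc 0) c)) / q"
  using val_split_initial[OF assms, of "Suc 0"] by (simp add: add_divide_distrib)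

lemma val_diff:
  assumes "1 < q" "digits_upto M c" "digits_upto M' d" "\<And>i. i < n \<Longrightarrow> c i = d i"
  shows "val q c - val q d =
    (real_of_int (c n - d n) + val q (shift (Suc n) c) - val q (shift (Suc n) d)) / q ^ Suc n"
proof -
  have "(\<Sum>i<n. real_of_int (c i) / q ^ Suc i) = (\<Sum>i<n. of_int (d i) / q ^ Suc i)"
    using assms(4) by simp
  then show ?thesis
    using val_split_initial[OF assms(1,2), of "Suc n"] val_split_initial[OF assms(1,3), of "Suc n"]
    by (simp add: diff_divide_distrib add_divide_distrib)
qed

text \<open>Every term carries at least one factor \<open>q / q'\<close>. Keeping it, instead of
  bounding it by 1, makes \<open>val_base_less\<close> strict even when the value in base
  \<open>q\<close> is exactly 1.\<close>

lemma val_base_antimono: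
  assumes "1 < q" "q \<le> q'" "digits_upto M c"
  shows "val q' c \<le> q / q' * val q c"
proof (rule sums_le)
  show "(\<lambda>i. of_int (c i) / q' ^ Suc i) sums val q' c"
    using assms by (intro val_sums) auto
  show "(\<lambda>i. q / q' * (of_int (c i) / q ^ Suc i)) sums (q / q' * val q c)"
    using assms by (intro sums_mult val_sums) auto
  show "of_int (c i) / q' ^ Suc i \<le> q / q' * (of_int (c i) / q ^ Suc i)" for i
  proof -
    have "of_int (c i) / q' ^ Suc i = of_int (c i) / q' * (1 / q' ^ i)" by simp
    also have "\<dots> \<le> of_int (c i) / q' * (1 / q ^ i)"
      using assms by (intro mult_left_mono divide_left_mono power_mono) (auto simp: digits_upto_def)
    also have "\<dots> = q / q' * (of_int (c i) / q ^ Suc i)" using assms by simp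
    finally show ?thesis .
  qed
qed

lemma val_base_less:
  assumes "1 < q" "q < q'" "digits_upto M c" "val q c \<le> 1"
  shows "val q' c < 1"
proof -
  have "val q' c \<le> q / q' * val q c" using assms by (intro val_base_antimono) auto
  also have "\<dots> \<le> q / q' * 1" using assms by (intro mult_left_mono) auto
  also have "\<dots> < 1" using assms by simp
  finally show ?thesis .
qed

lemma val_base_le:
  assumes "1 < q" "q \<le> q'" "digits_upto M c"
  shows "val q' c \<le> val q c"
proof -
  have "val q' c \<le> q / q' * val q c" using assms by (intro val_base_antimono) auto
  also have "\<dots> \<le> 1 * val q c" using assms val_nonneg by (intro mult_right_mono) auto
  finally show ?thesis by simp
qed

lemma val_continuous:
  assumes "digits_upto M c"
  shows "continuous_on {1<..} (\<lambda>q. val q c)"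
proof -
  have "isCont (\<lambda>x. \<Sum>i. real_of_int (c i) * x ^ i) (1 / q)" if "1 < q" for q :: real
  proof (rule isCont_powser)
    \<comment> \<open>Any point strictly between \<open>1 / q\<close> and 1 would do: the series
      still converges there, and \<open>isCont_powser\<close> asks for convergence at a point of
      larger modulus.\<close>
    define K where "K = (1 + 1 / q) / 2"
    have K: "1 / q < K" "0 < K" "K < 1" using that by (auto simp: K_def field_simps)
    then have "1 < 1 / K" by simp
    from summable_digits[OF this assms] have "summable (\<lambda>i. K * (real_of_int (c i) * K ^ i))"
      using K by (simp add: power_divide mult.commute mult.left_commute)
    then show "summable (\<lambda>i. real_of_int (c i) * K ^ i)" using K by (subst (asm) summable_cmult_iff) simp
    show "norm (1 / q) < norm K" using K that by simp
  qed
  then have cont: "continuous_on {1<..} (\<lambda>q. 1 / q * (\<Sum>i. real_of_int (c i) * (1 / q) ^ i))"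
    by (intro continuous_intros continuous_at_imp_continuous_on ballI
        isCont_o2[where f = "\<lambda>q. 1 / q"]) auto
  have "val q c = 1 / q * (\<Sum>i. real_of_int (c i) * (1 / q) ^ i)" if "q \<in> {1<..}" for q :: real
  proof -
    have q: "1 < q" using that by simp
    have "summable (\<lambda>i. q * (real_of_int (c i) / q ^ Suc i))"
      using summable_digits[OF q assms] by (rule summable_mult)
    then have "summable (\<lambda>i. real_of_int (c i) * (1 / q) ^ i)" using q by (simp add: power_divide)
    from suminf_mult[OF this, of "1 / q"] show ?thesis
      by (simp add: val_def power_divide)
  qed
  then show ?thesis using cont by (subst continuous_on_cong[OF refl])
qed

text \<open>Intermediate values on \<open>[m + 1, 2 m + 1]\<close>: in base \<open>m + 1\<close> the
  leading digit alone is worth 1, and in base \<open>2 m + 1\<close> even the largest digit sequence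
  is worth no more than 1.\<close>

lemma val_eq_1_exists:
  assumes "1 \<le> (m::nat)" "digits_upto (2 * int m) c" "c 0 = int m + 1"
  obtains q where "1 < q" "q \<le> 2 * real m + 1" "val q c = 1"
proof -
  have "\<exists>q\<ge>real m + 1. q \<le> 2 * real m + 1 \<and> val q c = 1"
  proof (rule IVT2')
    have "val (real m + 1) c = (c 0 + val (real m + 1) (shift (Suc 0) c)) / (real m + 1)"
      using assms(1) val_step[OF _ assms(2)] by simp
    moreover have "0 \<le> val (real m + 1) (shift (Suc 0) c)"
      using assms(1) val_nonneg[OF _ digits_upto_shift[OF assms(2)]] by simp
    ultimately show "1 \<le> val (real m + 1) c"
      using assms(3) by (simp add: le_divide_eq_1)
    show "val (2 * real m + 1) c \<le> 1"
      using val_le[of "2 * real m + 1", OF _ assms(2)] assms(1) by simp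
    show "continuous_on {real m + 1..2 * real m + 1} (\<lambda>q. val q c)"
      by (rule continuous_on_subset[OF val_continuous[OF assms(2)]]) (use assms in auto)
  qed simp
  then obtain q where "real m + 1 \<le> q" "q \<le> 2 * real m + 1" "val q c = 1" by blast
  moreover have "1 < real m + 1" using assms(1) by simp
  ultimately show thesis by (intro that[of q]) auto
qed

section \<open>Unique expansions\<close>

text \<open>The two clauses say that no digit can be raised by one and, after reflection, none
  lowered by one with the tail making up for the change.\<close>

definition unique_crit :: "int \<Rightarrow> real \<Rightarrow> (nat \<Rightarrow> int) \<Rightarrow> bool" where
  "unique_crit M q c \<longleftrightarrow> digits_upto M c \<and>
     (\<forall>n. (c n < M \<longrightarrow> val q (shift (Suc n) c) < 1) \<and>
          (0 < c n \<longrightarrow> val q (shift (Suc n) (compl_seq M c)) < 1))"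

lemma unique_crit_digits: "unique_crit M q c \<Longrightarrow> digits_upto M c"
  by (simp add: unique_crit_def)

lemma unique_crit_compl: "unique_crit M q (compl_seq M c) \<longleftrightarrow> unique_crit M q c"
  by (auto simp: unique_crit_def)

lemma unique_crit_mono:
  assumes "unique_crit M q c" "1 < q" "q \<le> q'"
  shows "unique_crit M q' c"
  using assms val_base_le[OF assms(2,3)] unfolding unique_crit_def
  by (metis (no_types, lifting) digits_upto_compl digits_upto_shift order_le_less_trans)

lemma expansion_exists:
  assumes "1 < q" "q \<le> of_int M + 1" "0 \<le> x" "x \<le> of_int M / (q - 1)"
  obtains c where "digits_upto M c" "val q c = x"
proof -
  define f where "f r = min M \<lfloor>q * r\<rfloor>" for r
  define r where "r n = ((\<lambda>r. q * r - f r) ^^ n) x" for n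
  \<comment> \<open>\<open>B\<close> is the largest value of a digit sequence and the fixed point of
    \<open>r \<mapsto> q * r - M\<close>; moreover \<open>q \<le> M + 1\<close> means
    \<open>1 \<le> B\<close>. Hence the remainder stays in \<open>[0, B]\<close> whether the digit
    is the floor or the cap \<open>M\<close>.\<close>
  define B where "B = of_int M / (q - 1)"
  have B1: "1 \<le> B" using assms by (simp add: B_def field_simps)
  have BM: "q * B - M = B" using assms by (simp add: B_def field_simps)
  have rB: "0 \<le> r n \<and> r n \<le> B" for n
  proof (induction n)
    case 0 then show ?case using assms by (simp add: r_def B_def)
  next
    case (Suc n)
    have "r (Suc n) = q * r n - f (r n)" by (simp add: r_def)
    moreover have "q * r n - \<lfloor>q * r n\<rfloor> \<le> B" using B1 by linarith
    moreover have "q * r n - M \<le> B"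
      using Suc assms(1) BM by (smt (verit) mult_left_mono)
    ultimately show ?case unfolding f_def by linarith
  qed
  define c where "c n = f (r n)" for n
  have dc: "digits_upto M c"
  proof -
    have "0 \<le> M" using assms by linarith
    moreover have "0 \<le> \<lfloor>q * r n\<rfloor>" for n using rB[of n] assms by simp
    ultimately show ?thesis by (simp add: digits_upto_def c_def f_def)
  qed
  have part: "(\<Sum>i<n. of_int (c i) / q ^ Suc i) = x - r n / q ^ n" for n
  proof (induction n)
    case (Suc n)
    have "r (Suc n) = q * r n - c n" by (simp add: r_def c_def)
    then have "r n / q ^ n = c n / q ^ Suc n + r (Suc n) / q ^ Suc n"
      using assms(1) by (simp add: field_simps)
    then show ?case using Suc by simp
  qed (simp add: r_def)
  have "(\<lambda>n. r n / q ^ n) \<longlonglongrightarrow> 0"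
  proof (rule real_tendsto_sandwich[OF _ _ tendsto_const])
    have "(\<lambda>n. B * (1 / q) ^ n) \<longlonglongrightarrow> B * 0" using assms(1)
      by (intro tendsto_mult_left LIMSEQ_realpow_zero) auto
    then show "(\<lambda>n. B * (1 / q) ^ n) \<longlonglongrightarrow> 0" by simp
  qed (use rB assms(1) in \<open>auto simp: power_divide divide_simps\<close>)
  then have "(\<lambda>n. x - r n / q ^ n) \<longlonglongrightarrow> x - 0" by (intro tendsto_diff tendsto_const)
  then have "(\<lambda>i. of_int (c i) / q ^ Suc i) sums x" unfolding sums_def part by simp
  then have "val q c = x" unfolding val_def by (simp add: sums_iff)
  with dc that show thesis by blast
qed

text \<open>A tail worth at least 1 can give up one unit to the digit before it, since its value
  minus 1 is again expandable. The condition \<open>q \<le> M + 1\<close> of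
  \<open>expansion_exists\<close> follows: in a larger base no tail could reach 1.\<close>

lemma digit_increment:
  assumes "1 < q" "digits_upto M c" "c n < M" "1 \<le> val q (shift (Suc n) c)"
  obtains d where "digits_upto M d" "val q d = val q c" "d n \<noteq> c n"
proof -
  let ?v = "val q (shift (Suc n) c)"
  have "0 < M" using assms(2,3) unfolding digits_upto_def by (metis order_le_less_trans)
  have vle: "?v \<le> M / (q - 1)" using assms by (intro val_le) auto
  then have "1 \<le> M / (q - 1)" using assms by linarith
  then have "q \<le> of_int M + 1" using assms(1) by (simp add: field_simps)
  then obtain e where e: "digits_upto M e" "val q e = ?v - 1"
    using expansion_exists[OF assms(1), of M "?v - 1"] assms(4) vle by auto
  define d where "d i = (if i < n then c i else if i = n then c n + 1 else e (i - Suc n))" for i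
  have d: "digits_upto M d"
    using assms(2,3) e by (auto simp: digits_upto_def d_def)
  have "shift (Suc n) d = e" by (auto simp: d_def shift_def)
  with val_diff[OF assms(1) d assms(2), of n] e have "val q d = val q c" by (simp add: d_def)
  with d that show thesis by (simp add: d_def)
qed

lemma unique_imp_crit:
  assumes "1 < q" "is_expansion q {0..M} c x" "has_unique_expansion q {0..M} x"
  shows "unique_crit M q c"
proof -
  have c: "digits_upto M c" "val q c = x" using assms is_expansion_iff by auto
  have uniq: "d = c" if "digits_upto M d" "val q d = x" for d
    using that assms is_expansion_iff unfolding has_unique_expansion_def by blast
  have "val q (shift (Suc n) c) < 1" if "c n < M" for n
    using digit_increment[OF assms(1) c(1) that] uniq c(2) by (metis linorder_not_less)
  moreover have "val q (shift (Suc n) (compl_seq M c)) < 1" if "0 < c n" for n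
  proof (rule ccontr)
    assume "\<not> ?thesis"
    with digit_increment[OF assms(1), of M "compl_seq M c" n] c that
    obtain d where d: "digits_upto M d" "val q d = val q (compl_seq M c)" "d n \<noteq> compl_seq M c n"
      by (auto simp: not_less)
    have "compl_seq M d = c"
      using d c assms(1) by (intro uniq) (auto simp: val_compl)
    with d(3) show False by auto
  qed
  ultimately show ?thesis using c by (simp add: unique_crit_def)
qed

text \<open>If \<open>d\<close> has the larger digit at the first difference, it gains at least 1
  there, while the criterion makes the competing tail of \<open>c\<close> worth less than 1. The
  other case is the same after reflection.\<close>

lemma crit_imp_unique:
  assumes "1 < q" "unique_crit M q c" "digits_upto M d" "val q d = val q c"
  shows "d = c"
proof (rule ccontr)
  assume "d \<noteq> c"
  then obtain n where n: "\<And>i. i < n \<Longrightarrow> d i = c i" "d n \<noteq> c n" using first_difference by blast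
  note c = unique_crit_digits[OF assms(2)]
  have less: False if "c n < d n" "unique_crit M q c" "digits_upto M d" "val q d = val q c"
    "\<And>i. i < n \<Longrightarrow> d i = c i" for c d
  proof -
    note c = unique_crit_digits[OF that(2)]
    have "c n < M" using that(1,3) unfolding digits_upto_def by (metis order_less_le_trans)
    with that(2) have "val q (shift (Suc n) c) < 1" by (simp add: unique_crit_def)
    moreover have "0 \<le> val q (shift (Suc n) d)"
      using val_nonneg[OF assms(1) digits_upto_shift[OF that(3)]] .
    moreover have "real_of_int (d n - c n) \<ge> 1" using that(1) by linarith
    ultimately have "0 < (real_of_int (d n - c n) + val q (shift (Suc n) d) - val q (shift (Suc n) c)) / q ^ Suc n"
      using assms(1) by (intro divide_pos_pos) auto
    moreover have "val q d - val q c = (real_of_int (d n - c n) + val q (shift (Suc n) d) - val q (shift (Suc n) c)) / q ^ Suc n"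
      using assms(1) that(3) c that(5) by (rule val_diff)
    ultimately show False using that(4) by linarith
  qed
  show False
  proof (cases "c n < d n")
    case True
    show False by (rule less[OF True assms(2-4) n(1)])
  next
    case False
    show False
      by (rule less[of "compl_seq M c" "compl_seq M d"])
         (use False n assms c in \<open>auto simp: unique_crit_compl val_compl\<close>)
  qed
qed

lemma has_unique_expansion_iff:
  assumes "1 < q"
  shows "has_unique_expansion q {0..M} x \<longleftrightarrow> (\<exists>c. unique_crit M q c \<and> val q c = x)"
proof
  assume u: "has_unique_expansion q {0..M} x"
  then obtain c where c: "is_expansion q {0..M} c x" unfolding has_unique_expansion_def by blast
  then show "\<exists>c. unique_crit M q c \<and> val q c = x"
    using unique_imp_crit[OF assms c u] is_expansion_iff[OF assms] by auto
next
  assume "\<exists>c. unique_crit M q c \<and> val q c = x"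
  then obtain c where c: "unique_crit M q c" "val q c = x" by blast
  show "has_unique_expansion q {0..M} x"
    unfolding has_unique_expansion_def is_expansion_iff[OF assms]
  proof (rule ex1I[of _ c])
    show "digits_upto M c \<and> val q c = x" using c unique_crit_digits by blast
    show "d = c" if "digits_upto M d \<and> val q d = x" for d
      using crit_imp_unique[OF assms c(1)] that c(2) by simp
  qed
qed

section \<open>Passing between the alphabet centred at 0 and the digits from 0 to 2m\<close>

lemma is_expansion_translate:
  assumes "1 < q"
  shows "is_expansion q {- int m..int m} c t \<longleftrightarrow>
    is_expansion q {0..2 * int m} (\<lambda>i. int m + c i) (t + m / (q - 1))"
proof -
  let ?f = "\<lambda>i. of_int (c i) / q ^ Suc i" and ?g = "\<lambda>i. m / q ^ Suc i"
  have g: "?g sums (m / (q - 1))" using geometric_sums_base[OF assms] .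
  have "?f sums t \<longleftrightarrow> (\<lambda>i. ?f i + ?g i) sums (t + m / (q - 1))"
    using sums_add[OF _ g, of ?f t] sums_diff[OF _ g, of "\<lambda>i. ?f i + ?g i" "t + m / (q - 1)"] by auto
  moreover have "?f i + ?g i = of_int (int m + c i) / q ^ Suc i" for i
    by (simp add: add_divide_distrib)
  moreover have "c i \<in> {- int m..int m} \<longleftrightarrow> int m + c i \<in> {0..2 * int m}" for i by auto
  ultimately show ?thesis unfolding is_expansion_def by presburger
qed

lemma U_set_expansion_iff:
  assumes "1 < q"
  shows "t \<in> U_set m q \<and> is_expansion q {- int m..int m} c t \<longleftrightarrow>
    unique_crit (2 * int m) q (\<lambda>i. int m + c i) \<and> t = val q (\<lambda>i. int m + c i) - m / (q - 1)"
proof -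
  have conv: "is_expansion q {- int m..int m} d t \<longleftrightarrow>
      digits_upto (2 * int m) (\<lambda>i. int m + d i) \<and> t = val q (\<lambda>i. int m + d i) - m / (q - 1)" for d
    using is_expansion_translate[OF assms] is_expansion_iff[OF assms] by (auto simp: algebra_simps)
  have "has_unique_expansion q {- int m..int m} t \<longleftrightarrow> has_unique_expansion q {0..2 * int m} (t + m / (q - 1))"
  proof
    assume "has_unique_expansion q {- int m..int m} t"
    then obtain c where c: "is_expansion q {- int m..int m} c t"
      "\<And>d. is_expansion q {- int m..int m} d t \<Longrightarrow> d = c"
      unfolding has_unique_expansion_def by blast
    show "has_unique_expansion q {0..2 * int m} (t + m / (q - 1))"
      unfolding has_unique_expansion_def
    proof (intro ex1I[of _ "\<lambda>i. int m + c i"])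
      show "is_expansion q {0..2 * int m} (\<lambda>i. int m + c i) (t + m / (q - 1))"
        using c(1) is_expansion_translate[OF assms] by simp
      fix d assume "is_expansion q {0..2 * int m} d (t + m / (q - 1))"
      then have "is_expansion q {- int m..int m} (\<lambda>i. d i - int m) t"
        using is_expansion_translate[OF assms] by simp
      then have "(\<lambda>i. d i - int m) = c" by (rule c(2))
      then show "d = (\<lambda>i. int m + c i)" by auto
    qed
  next
    assume "has_unique_expansion q {0..2 * int m} (t + m / (q - 1))"
    then obtain c where c: "is_expansion q {0..2 * int m} c (t + m / (q - 1))"
      "\<And>d. is_expansion q {0..2 * int m} d (t + m / (q - 1)) \<Longrightarrow> d = c"
      unfolding has_unique_expansion_def by blast
    show "has_unique_expansion q {- int m..int m} t"
      unfolding has_unique_expansion_def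
    proof (intro ex1I[of _ "\<lambda>i. c i - int m"])
      show "is_expansion q {- int m..int m} (\<lambda>i. c i - int m) t"
        using c(1) is_expansion_translate[OF assms] by simp
      fix d assume "is_expansion q {- int m..int m} d t"
      then have "(\<lambda>i. int m + d i) = c"
        using is_expansion_translate[OF assms] by (intro c(2)) simp
      then show "d = (\<lambda>i. c i - int m)" by force
    qed
  qed
  then have U: "t \<in> U_set m q \<longleftrightarrow> has_unique_expansion q {0..2 * int m} (t + m / (q - 1))"
    by (simp add: U_set_def)
  show ?thesis
  proof
    assume a: "t \<in> U_set m q \<and> is_expansion q {- int m..int m} c t"
    then have "unique_crit (2 * int m) q (\<lambda>i. int m + c i)"
      using unique_imp_crit[OF assms] U is_expansion_translate[OF assms] by blast
    with a conv show "unique_crit (2 * int m) q (\<lambda>i. int m + c i) \<and> t = val q (\<lambda>i. int m + c i) - m / (q - 1)"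
      by blast
  next
    assume a: "unique_crit (2 * int m) q (\<lambda>i. int m + c i) \<and> t = val q (\<lambda>i. int m + c i) - m / (q - 1)"
    then have "has_unique_expansion q {0..2 * int m} (t + m / (q - 1))"
      unfolding has_unique_expansion_iff[OF assms] by auto
    with a conv U show "t \<in> U_set m q \<and> is_expansion q {- int m..int m} c t"
      using unique_crit_digits by blast
  qed
qed

lemma U_set_altdef:
  assumes "1 < q"
  shows "U_set m q = {val q c - m / (q - 1) | c. unique_crit (2 * int m) q c}"
proof (intro equalityI subsetI)
  fix t assume t: "t \<in> U_set m q"
  then obtain c where "is_expansion q {- int m..int m} c t"
    unfolding U_set_def has_unique_expansion_def by blast
  with t U_set_expansion_iff[OF assms] show "t \<in> {val q c - m / (q - 1) | c. unique_crit (2 * int m) q c}"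
    by blast
next
  fix t assume "t \<in> {val q c - m / (q - 1) | c. unique_crit (2 * int m) q c}"
  then obtain c where "unique_crit (2 * int m) q c" "t = val q c - m / (q - 1)" by blast
  with U_set_expansion_iff[OF assms, of t m "\<lambda>i. c i - int m"] show "t \<in> U_set m q" by simp
qed

section \<open>Values and the lexicographic order\<close>

text \<open>
  If the values of all shifts of \<open>c\<close> are at most \<open>1 + b\<close>, then comparing a shift with \<open>s\<close> at the
  first differing digit improves the bound to \<open>1 + b / q\<close>; iteration gives \<open>1\<close>.
\<close>

lemma val_shift_le_1:
  assumes "1 < q" "digits_upto M c" "digits_upto M s" "val q s \<le> 1"
    and le: "\<And>n. lexle (shift n c) s"
  shows "val q (shift n c) \<le> 1"
proof -
  define B where "B = of_int M / (q - 1)"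
  have B0: "0 \<le> B" using assms(1,2) unfolding B_def digits_upto_def by (force intro!: divide_nonneg_nonneg)
  have "val q (shift n c) \<le> 1 + B * (1 / q) ^ k" for k n
  proof (induction k arbitrary: n)
    case 0
    have "val q (shift n c) \<le> B"
      unfolding B_def using assms(1) digits_upto_shift[OF assms(2)] by (rule val_le)
    then show ?case by (simp del: shift_apply)
  next
    case (Suc k)
    show ?case
    proof (cases "shift n c = s")
      case True
      then have "val q (shift n c) \<le> 1" using assms(4) by simp
      also have "\<dots> \<le> 1 + B * (1 / q) ^ Suc k" using B0 assms(1) by simp
      finally show ?thesis .
    next
      case False
      with le[of n] obtain p where p: "\<And>i. i < p \<Longrightarrow> shift n c i = s i" "shift n c p < s p"
        unfolding lexle_def by (metis lexltE)
      define u where "u = real_of_int (shift n c p - s p) + val q (shift (Suc p) (shift n c)) - val q (shift (Suc p) s)"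
      have "u \<le> B * (1 / q) ^ k"
      proof -
        have "real_of_int (shift n c p - s p) \<le> -1" using p(2) by linarith
        moreover have "0 \<le> val q (shift (Suc p) s)"
      using val_nonneg[OF assms(1) digits_upto_shift[OF assms(3)]] .
        moreover have "val q (shift (Suc p) (shift n c)) \<le> 1 + B * (1 / q) ^ k"
          using Suc[of "n + Suc p"] by (simp del: shift_apply)
        ultimately show ?thesis unfolding u_def by linarith
      qed
      then have "u / q ^ Suc p \<le> B * (1 / q) ^ k / q ^ Suc p"
        using assms(1) by (intro divide_right_mono) auto
      also have "\<dots> \<le> B * (1 / q) ^ k / q ^ 1"
        using assms(1) B0 by (intro divide_left_mono power_increasing) auto
      finally have "u / q ^ Suc p \<le> B * (1 / q) ^ Suc k" by simp
      moreover have "val q (shift n c) - val q s = u / q ^ Suc p"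
        unfolding u_def using p
        by (intro val_diff[OF assms(1) digits_upto_shift[OF assms(2)] assms(3)]) auto
      ultimately show ?thesis using assms(4) by linarith
    qed
  qed
  moreover have "(\<lambda>k. 1 + B * (1 / q) ^ k) \<longlonglongrightarrow> 1 + B * 0" using assms(1)
    by (intro tendsto_intros LIMSEQ_realpow_zero) auto
  ultimately show ?thesis
    by (intro LIMSEQ_le_const[where X = "\<lambda>k. 1 + B * (1 / q) ^ k"]) auto
qed

text \<open>At the first difference the shift loses at least 1 and its tail regains at most 1, so
  the balance is at most minus the value of the corresponding tail of \<open>s\<close>. That is
  negative once \<open>s\<close> has positive digits arbitrarily far out.\<close>

lemma val_shift_le:
  assumes "1 < q" "digits_upto M c" "digits_upto M s" "val q s \<le> 1"
    and le: "\<And>n. lexle (shift n c) s"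
  shows "val q (shift n c) \<le> val q s"
    and "lexlt (shift n c) s \<Longrightarrow> (\<And>k. \<exists>i. 0 < s (k + i)) \<Longrightarrow> val q (shift n c) < val q s"
proof -
  have *: "val q (shift n c) \<le> val q s \<and> ((\<forall>k. \<exists>i. 0 < s (k + i)) \<longrightarrow> val q (shift n c) < val q s)"
    if lt: "lexlt (shift n c) s"
  proof -
    obtain p where p: "\<And>i. i < p \<Longrightarrow> shift n c i = s i" "shift n c p < s p"
      using lt by (rule lexltE) auto
    define u where "u = real_of_int (shift n c p - s p) + val q (shift (Suc p) (shift n c)) - val q (shift (Suc p) s)"
    have "val q (shift n c) - val q s = u / q ^ Suc p"
      unfolding u_def using assms p
      by (intro val_diff[OF assms(1) digits_upto_shift[OF assms(2)] assms(3)]) auto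
    moreover have u: "u \<le> - val q (shift (Suc p) s)"
      using val_shift_le_1[OF assms, of "n + Suc p"] p(2) unfolding u_def by simp
    moreover have "0 \<le> val q (shift (Suc p) s)"
      using val_nonneg[OF assms(1) digits_upto_shift[OF assms(3)]] .
    moreover have "0 < val q (shift (Suc p) s)" if "\<forall>k. \<exists>i. 0 < s (k + i)"
    proof -
      have "\<exists>i. 0 < shift (Suc p) s i" using \<open>\<forall>k. _\<close> unfolding shift_apply by blast
      then show ?thesis using val_pos[OF assms(1) digits_upto_shift[OF assms(3)]] by blast
    qed
    moreover have "0 < q ^ Suc p" using assms(1) by simp
    ultimately show ?thesis
      by (smt (verit) divide_nonpos_pos divide_neg_pos)
  qed
  show "val q (shift n c) \<le> val q s" using le[of n] * unfolding lexle_def by auto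
  show "val q (shift n c) < val q s" if "lexlt (shift n c) s" "\<And>k. \<exists>i. 0 < s (k + i)"
    using * that by blast
qed

text \<open>A first difference in favour of \<open>d\<close> is worth at least 1, and a tail of
  \<open>s\<close>, worth at most 1, cannot outweigh it. Only the tails of \<open>s\<close> have to
  be controlled.\<close>

lemma val_less_imp_lexlt:
  assumes "1 < q" "digits_upto M d" "digits_upto M s" "val q d < val q s"
    and s: "\<And>n. val q (shift (Suc n) s) \<le> 1"
  shows "lexlt d s"
proof (rule ccontr)
  assume "\<not> lexlt d s"
  with assms(4) lexlt_linear[of d s] have "lexlt s d" by auto
  then obtain p where p: "\<And>i. i < p \<Longrightarrow> d i = s i" "s p < d p" by (metis lexltE)
  have "0 \<le> val q (shift (Suc p) d)"
    using val_nonneg[OF assms(1) digits_upto_shift[OF assms(2)]] .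
  moreover have "real_of_int (d p - s p) \<ge> 1" using p(2) by linarith
  ultimately have "0 \<le> (real_of_int (d p - s p) + val q (shift (Suc p) d) - val q (shift (Suc p) s)) / q ^ Suc p"
    using assms(1) s[of p] by (intro divide_nonneg_nonneg) auto
  moreover have "val q d - val q s = (real_of_int (d p - s p) + val q (shift (Suc p) d) - val q (shift (Suc p) s)) / q ^ Suc p"
    using assms(1-3) p(1) by (rule val_diff)
  ultimately show False using assms(4) by linarith
qed

text \<open>The criterion speaks only of tails behind a digit below \<open>M\<close>. Behind a digit
  \<open>M\<close> the bound is inherited: if \<open>M\<close> followed by \<open>x\<close> is below
  \<open>s\<close>, then \<open>x\<close> is below the tail of \<open>s\<close>, hence below
  \<open>s\<close>. One digit below \<open>M\<close> thus settles all later positions.\<close>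

lemma unique_crit_lexlt:
  assumes "1 < q" "unique_crit M q c" "digits_upto M s" "val q s = 1"
    and s: "\<And>n. lexle (shift n s) s" and "c k < M" "k < n"
  shows "lexlt (shift n c) s"
proof -
  note c = unique_crit_digits[OF assms(2)]
  have s1: "val q (shift n s) \<le> 1" for n
    using val_shift_le_1[OF assms(1,3,3) _ s] assms(4) by simp
  have base: "lexlt (shift (Suc n) c) s" if "c n < M" for n
    using that assms s1 c by (intro val_less_imp_lexlt[OF assms(1)]) (auto simp: unique_crit_def)
  have "lexlt (shift (Suc k + j) c) s" for j
  proof (induction j)
    case 0
    show ?case using base[OF \<open>c k < M\<close>] by (simp del: shift_apply)
  next
    case (Suc j)
    show ?case
    proof (cases "c (Suc k + j) < M")
      case True
      then show ?thesis using base by (simp del: shift_apply)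
    next
      case False
      with c have M: "c (Suc k + j) = M" by (simp add: digits_upto_def linorder_not_less order_antisym)
      have "lexlt (shift (Suc 0) (shift (Suc k + j) c)) (shift (Suc 0) s)"
        using Suc M \<open>digits_upto M s\<close> by (intro lexlt_tl) (auto simp: digits_upto_def simp del: shift_apply, simp)
      with s show ?thesis using lexlt_lexle_trans by (metis Suc_eq_plus1 add_Suc_right shift_shift One_nat_def)
    qed
  qed
  from this[of "n - Suc k"] \<open>k < n\<close> show ?thesis by simp
qed

section \<open>Hausdorff dimension of restricted digit sets\<close>

definition digit_set :: "real \<Rightarrow> (nat \<Rightarrow> int) \<Rightarrow> (nat \<Rightarrow> int) \<Rightarrow> real set" where
  "digit_set q l h = {val q c | c. \<forall>i. l i \<le> c i \<and> c i \<le> h i}"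

text \<open>If \<open>x\<close> and \<open>x - t\<close> have digits \<open>a\<close> and
  \<open>b\<close>, then the differences expand \<open>t\<close>. Uniqueness forces
  \<open>a i - b i = t' i\<close> everywhere, so the digits of \<open>x\<close> vary independently
  over intervals.\<close>

lemma Gamma_inter_translate:
  assumes "1 < q" "t \<in> U_set m q" "is_expansion q {- int m..int m} t' t"
  shows "Gamma_set m q \<inter> (\<lambda>x. x + t) ` Gamma_set m q =
    digit_set q (\<lambda>i. max 0 (t' i)) (\<lambda>i. min (int m) (int m + t' i))"
proof (intro equalityI subsetI)
  fix x assume x: "x \<in> Gamma_set m q \<inter> (\<lambda>x. x + t) ` Gamma_set m q"
  then obtain a b where a: "is_expansion q {0..int m} a x" and b: "is_expansion q {0..int m} b (x - t)"
    unfolding Gamma_set_def by force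
  have "(\<lambda>i. of_int (a i) / q ^ Suc i - of_int (b i) / q ^ Suc i) sums (x - (x - t))"
    using a b by (intro sums_diff) (auto simp: is_expansion_def)
  moreover have "a i - b i \<in> {- int m..int m}" for i
    using a b unfolding is_expansion_def atLeastAtMost_iff by (smt (verit))
  ultimately have "is_expansion q {- int m..int m} (\<lambda>i. a i - b i) t"
    by (simp add: is_expansion_def diff_divide_distrib)
  then have "t' = (\<lambda>i. a i - b i)"
    using assms(2,3) unfolding U_set_def has_unique_expansion_def by blast
  then have "\<forall>i. max 0 (t' i) \<le> a i \<and> a i \<le> min (int m) (int m + t' i)"
    using a b by (auto simp: is_expansion_def)
  moreover have "x = val q a" using a is_expansion_iff[OF assms(1)] by simp
  ultimately show "x \<in> digit_set q (\<lambda>i. max 0 (t' i)) (\<lambda>i. min (int m) (int m + t' i))"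
    unfolding digit_set_def by blast
next
  fix x assume "x \<in> digit_set q (\<lambda>i. max 0 (t' i)) (\<lambda>i. min (int m) (int m + t' i))"
  then obtain a where a: "x = val q a" "\<And>i. max 0 (t' i) \<le> a i \<and> a i \<le> min (int m) (int m + t' i)"
    unfolding digit_set_def by blast
  then have "is_expansion q {0..int m} a x"
    using is_expansion_iff[OF assms(1)] by (auto simp: digits_upto_def)
  moreover have "is_expansion q {0..int m} (\<lambda>i. a i - t' i) (x - t)"
  proof -
    have "(\<lambda>i. of_int (a i) / q ^ Suc i - of_int (t' i) / q ^ Suc i) sums (x - t)"
      using \<open>is_expansion q {0..int m} a x\<close> assms(3) by (intro sums_diff) (auto simp: is_expansion_def)
    moreover have "a i - t' i \<in> {0..int m}" for i using a(2)[of i] by auto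
    ultimately show ?thesis by (simp add: is_expansion_def diff_divide_distrib)
  qed
  ultimately show "x \<in> Gamma_set m q \<inter> (\<lambda>x. x + t) ` Gamma_set m q"
    unfolding Gamma_set_def by (auto intro!: image_eqI[of _ _ "x - t"])
qed

section \<open>Bounds for Hausdorff measure and dimension on the line\<close>

lemma hausdorff_outer_measure_eq_0I:
  fixes A :: "real set"
  assumes "\<And>\<delta> \<epsilon>. 0 < \<delta> \<Longrightarrow> 0 < \<epsilon> \<Longrightarrow>
    \<exists>F. finite F \<and> A \<subseteq> \<Union>F \<and> (\<forall>U\<in>F. bounded U \<and> diameter U \<le> \<delta>) \<and> (\<Sum>U\<in>F. diameter U powr s) \<le> \<epsilon>"
  shows "hausdorff_outer_measure s A = 0"
proof -
  have "hausdorff_premeasure s \<delta> A \<le> ennreal \<epsilon>" if "0 < \<delta>" "0 < \<epsilon>" for \<delta> \<epsilon>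
  proof -
    obtain F where F: "finite F" "A \<subseteq> \<Union>F" "\<forall>U\<in>F. bounded U \<and> diameter U \<le> \<delta>"
      "(\<Sum>U\<in>F. diameter U powr s) \<le> \<epsilon>" using assms[OF \<open>0 < \<delta>\<close> \<open>0 < \<epsilon>\<close>] by blast
    obtain f where f: "bij_betw f {..<card F} F"
      using ex_bij_betw_nat_finite[OF F(1)] by (auto simp: lessThan_atLeast0)
    \<comment> \<open>Padding with the empty set costs nothing: its diameter is 0 and
      \<open>0 powr s = 0\<close>.\<close>
    define U where "U i = (if i < card F then f i else {})" for i
    have fF: "f i \<in> F" if "i < card F" for i
      using bij_betw_apply[OF f] that by simp
    have "A \<subseteq> (\<Union>i. U i)"
    proof
      fix x assume "x \<in> A"
      then obtain V where "V \<in> F" "x \<in> V" using F(2) by blast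
      then obtain i where "i < card F" "f i = V" using f unfolding bij_betw_def by (metis imageE lessThan_iff)
      then show "x \<in> (\<Union>i. U i)" using \<open>x \<in> V\<close> by (auto simp: U_def)
    qed
    moreover have "bounded (U i) \<and> diameter (U i) \<le> \<delta>" for i
      using F(3) fF[of i] \<open>0 < \<delta>\<close> by (auto simp: U_def)
    ultimately have "hausdorff_premeasure s \<delta> A \<le> (\<Sum>i. ennreal (diameter (U i) powr s))"
      unfolding hausdorff_premeasure_def by (intro INF_lower) auto
    also have "\<dots> = (\<Sum>i<card F. ennreal (diameter (U i) powr s))"
      by (rule suminf_finite) (auto simp: U_def)
    also have "\<dots> = (\<Sum>i<card F. ennreal (diameter (f i) powr s))" by (simp add: U_def)
    also have "\<dots> = (\<Sum>V\<in>F. ennreal (diameter V powr s))"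
      by (rule sum.reindex_bij_betw[OF f])
    also have "\<dots> = ennreal (\<Sum>V\<in>F. diameter V powr s)" by (rule sum_ennreal) auto
    also have "\<dots> \<le> ennreal \<epsilon>" using F(4) by (rule ennreal_leI)
    finally show ?thesis .
  qed
  then have "hausdorff_premeasure s \<delta> A = 0" if "0 < \<delta>" for \<delta>
    using that by (metis ennreal_le_epsilon add.left_neutral le_zero_eq)
  then show ?thesis unfolding hausdorff_outer_measure_def by simp
qed

lemma hausdorff_dim_le:
  assumes "0 \<le> \<beta>" "\<And>s. \<beta> < s \<Longrightarrow> hausdorff_outer_measure s A = 0"
  shows "hausdorff_dim A \<le> \<beta>"
proof (rule field_le_epsilon)
  fix e :: real assume "0 < e"
  show "hausdorff_dim A \<le> \<beta> + e" unfolding hausdorff_dim_def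
    by (rule cInf_lower) (use assms \<open>0 < e\<close> in \<open>auto intro!: bdd_belowI[of _ 0]\<close>)
qed

text \<open>The exponent \<open>s0\<close> shows that the infimum is taken over a nonempty
  set.\<close>

lemma hausdorff_dim_ge:
  assumes "hausdorff_outer_measure s0 A = 0" "0 < s0"
    and "\<And>s. 0 < s \<Longrightarrow> s < \<beta> \<Longrightarrow> hausdorff_outer_measure s A \<noteq> 0"
  shows "\<beta> \<le> hausdorff_dim A"
  unfolding hausdorff_dim_def
  by (rule cInf_greatest) (use assms in \<open>auto simp: not_less[symmetric]\<close>)

text \<open>
  A family of points \<open>x y\<close>, \<open>y \<in> [0,1)\<close>, whose parametrization has an \<open>s\<close>-Hoelder inverse, cannot
  be covered cheaply: the parameters of the points in a covering set \<open>U\<close> lie in an interval of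
  length \<open>C * diameter U powr s\<close>, and these intervals cover \<open>[0,1)\<close>.
\<close>

lemma hausdorff_outer_measure_pos:
  fixes x :: "real \<Rightarrow> real"
  assumes "0 < C" "0 < s" "\<And>y. y \<in> {0..<1} \<Longrightarrow> x y \<in> A"
    and holder: "\<And>y y'. y \<in> {0..<1} \<Longrightarrow> y' \<in> {0..<1} \<Longrightarrow> \<bar>y - y'\<bar> \<le> C * \<bar>x y - x y'\<bar> powr s"
  shows "hausdorff_outer_measure s A \<noteq> 0"
proof -
  have "ennreal (1 / C) \<le> (\<Sum>i. ennreal (diameter (U i) powr s))"
    if U: "A \<subseteq> (\<Union>i. U i)" "\<And>i. bounded (U i)" for U :: "nat \<Rightarrow> real set"
  proof -
    define P where "P i = {y\<in>{0..<1}. x y \<in> U i}" for i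
    define J where "J i = (if P i = {} then {} else {Inf (P i)..Inf (P i) + C * diameter (U i) powr s})" for i
    have PJ: "P i \<subseteq> J i" for i
    proof
      fix y assume y: "y \<in> P i"
      have bdd: "bdd_below (P i)" by (rule bdd_belowI[of _ 0]) (auto simp: P_def)
      have "y - C * diameter (U i) powr s \<le> Inf (P i)"
      proof (rule cInf_greatest)
        show "P i \<noteq> {}" using y by blast
        fix z assume z: "z \<in> P i"
        have "\<bar>y - z\<bar> \<le> C * \<bar>x y - x z\<bar> powr s" using y z by (intro holder) (auto simp: P_def)
        also have "\<dots> \<le> C * diameter (U i) powr s"
        proof (intro mult_left_mono powr_mono2)
          show "\<bar>x y - x z\<bar> \<le> diameter (U i)"
            using diameter_bounded_bound[OF U(2)[of i], of "x y" "x z"] y z by (auto simp: P_def dist_real_def)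
        qed (use assms in auto)
        finally show "y - C * diameter (U i) powr s \<le> z" by linarith
      qed
      then show "y \<in> J i" using y cInf_lower[OF y bdd] by (auto simp: J_def)
    qed
    have "{0..<1} \<subseteq> (\<Union>i. J i)"
    proof
      fix y :: real assume y: "y \<in> {0..<1}"
      then obtain i where "x y \<in> U i" using assms(3) U(1) by blast
      then have "y \<in> P i" using y by (simp add: P_def)
      then show "y \<in> (\<Union>i. J i)" using PJ by blast
    qed
    then have "emeasure lborel {0..<1::real} \<le> emeasure lborel (\<Union>i. J i)"
      by (rule emeasure_mono) (auto simp: J_def)
    also have "\<dots> \<le> (\<Sum>i. emeasure lborel (J i))"
      by (rule emeasure_subadditive_countably) (auto simp: J_def)
    also have "\<dots> \<le> (\<Sum>i. ennreal C * ennreal (diameter (U i) powr s))"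
      by (intro suminf_le) (use assms in \<open>auto simp: J_def ennreal_mult[symmetric]\<close>)
    also have "\<dots> = ennreal C * (\<Sum>i. ennreal (diameter (U i) powr s))" by (rule ennreal_suminf_cmult)
    finally have "1 \<le> ennreal C * (\<Sum>i. ennreal (diameter (U i) powr s))" by simp
    then have "ennreal (1 / C) * 1 \<le> ennreal (1 / C) * (ennreal C * (\<Sum>i. ennreal (diameter (U i) powr s)))"
      by (rule mult_left_mono) simp
    also have "\<dots> = (\<Sum>i. ennreal (diameter (U i) powr s))"
      using assms(1) by (simp add: mult.assoc[symmetric] ennreal_mult[symmetric])
    finally show ?thesis by simp
  qed
  then have "ennreal (1 / C) \<le> hausdorff_premeasure s 1 A"
    unfolding hausdorff_premeasure_def by (intro INF_greatest) auto
  also have "\<dots> \<le> hausdorff_outer_measure s A"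
    unfolding hausdorff_outer_measure_def by (rule SUP_upper) simp
  finally show ?thesis using assms(1) by auto
qed

text \<open>As \<open>q > M + 1\<close>, a whole tail is worth at most
  \<open>M / (q - 1) < 1\<close> and cannot close a difference of 1 in the deciding digit;
  \<open>1 - M / (q - 1)\<close> is the gap that remains.\<close>

lemma digit_set_separation:
  assumes "of_int M + 1 < q" "0 \<le> M" "digits_upto M c" "digits_upto M d" "\<And>i. i < n \<Longrightarrow> c i = d i" "c n \<noteq> d n"
  shows "(1 - M / (q - 1)) / q ^ Suc n \<le> \<bar>val q c - val q d\<bar>"
proof -
  have q: "1 < q" using assms(1,2) by linarith
  let ?v = "\<lambda>c. val q (shift (Suc n) c)"
  have "0 \<le> ?v c" "0 \<le> ?v d" "?v c \<le> M / (q - 1)" "?v d \<le> M / (q - 1)"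
    using val_nonneg[OF q] val_le[OF q] digits_upto_shift assms(3,4) by blast+
  moreover have "real_of_int \<bar>c n - d n\<bar> \<ge> 1" using assms(6) by linarith
  ultimately have "1 - M / (q - 1) \<le> \<bar>real_of_int (c n - d n) + ?v c - ?v d\<bar>" by linarith
  then have "(1 - M / (q - 1)) / q ^ Suc n \<le> \<bar>real_of_int (c n - d n) + ?v c - ?v d\<bar> / q ^ Suc n"
    using q by (intro divide_right_mono) auto
  also have "\<dots> = \<bar>val q c - val q d\<bar>"
    using val_diff[OF q assms(3-5)] q by (simp add: abs_divide)
  finally show ?thesis .
qed

section \<open>Counting words and computing the dimension of a digit set\<close>

locale restricted_digits =
  fixes q :: real and M :: int and l h :: "nat \<Rightarrow> int"
  assumes q: "of_int M + 1 < q" and l: "\<And>i. 0 \<le> l i" and h: "\<And>i. h i \<le> M" and lh: "\<And>i. l i \<le> h i"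
begin

definition num :: "nat \<Rightarrow> real" where "num i = of_int (h i - l i + 1)"

definition count :: "nat \<Rightarrow> real" where "count n = (\<Prod>i<n. num i)"

lemma q1: "1 < q"
proof -
  have "0 \<le> M" using l[of 0] lh[of 0] h[of 0] by linarith
  then show ?thesis using q by linarith
qed

lemma M0: "0 \<le> M" using l[of 0] lh[of 0] h[of 0] by linarith

lemma num_ge_1: "1 \<le> num i"
  using lh[of i] by (simp add: num_def)

lemma count_ge_1: "1 \<le> count n"
  unfolding count_def using num_ge_1 by (intro prod_ge_1) auto

lemma digits: "\<forall>i. l i \<le> c i \<and> c i \<le> h i \<Longrightarrow> digits_upto M c"
  unfolding digits_upto_def using l h by (meson order_trans)

lemma cover:
  obtains F where "finite F" "digit_set q l h \<subseteq> \<Union>F" "real (card F) \<le> count n"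
    "\<And>U. U \<in> F \<Longrightarrow> bounded U \<and> diameter U \<le> (M / (q - 1)) / q ^ n"
proof -
  define W where "W = PiE {..<n} (\<lambda>i. {l i..h i})"
  define I where "I w = {(\<Sum>i<n. of_int (w i) / q ^ Suc i)..(\<Sum>i<n. of_int (w i) / q ^ Suc i) + (M / (q - 1)) / q ^ n}"
    for w :: "nat \<Rightarrow> int"
  have "finite W" unfolding W_def by (intro finite_PiE) auto
  have "real (card W) = count n"
    using lh unfolding W_def count_def num_def by (simp add: card_PiE)
  have nn: "0 \<le> (M / (q - 1)) / q ^ n" using q1 M0 by simp
  show thesis
  proof
    show "finite (I ` W)" using \<open>finite W\<close> by simp
    show "real (card (I ` W)) \<le> count n"
      using card_image_le[OF \<open>finite W\<close>, of I] \<open>real (card W) = count n\<close> by linarith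
    show "bounded U \<and> diameter U \<le> (M / (q - 1)) / q ^ n" if "U \<in> I ` W" for U
    proof -
      obtain w where U: "U = I w" using \<open>U \<in> I ` W\<close> by blast
      show ?thesis unfolding U I_def using nn by (auto simp: diameter_closed_interval)
    qed
    show "digit_set q l h \<subseteq> \<Union> (I ` W)"
    proof
      fix x assume "x \<in> digit_set q l h"
      then obtain c where c: "x = val q c" "\<forall>i. l i \<le> c i \<and> c i \<le> h i" unfolding digit_set_def by blast
      have "restrict c {..<n} \<in> W" using c(2) by (auto simp: W_def)
      moreover have "x \<in> I (restrict c {..<n})"
      proof -
        have "val q c = (\<Sum>i<n. of_int (c i) / q ^ Suc i) + val q (shift n c) / q ^ n"
          using val_split_initial[OF q1 digits[OF c(2)]] .
        moreover have "0 \<le> val q (shift n c) / q ^ n" "val q (shift n c) / q ^ n \<le> (M / (q - 1)) / q ^ n"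
          using val_nonneg[OF q1 digits_upto_shift[OF digits[OF c(2)]], of n] val_le[OF q1 digits_upto_shift[OF digits[OF c(2)]], of n] q1
          by (auto intro!: divide_nonneg_nonneg divide_right_mono simp del: divide_divide_eq_left)
        ultimately show ?thesis by (simp add: I_def c(1))
      qed
      ultimately show "x \<in> \<Union> (I ` W)" by blast
    qed
  qed
qed

lemma outer_measure_eq_0:
  assumes "0 < s" "(\<lambda>n. count n / q powr (real n * s)) \<longlonglongrightarrow> 0"
  shows "hausdorff_outer_measure s (digit_set q l h) = 0"
proof (rule hausdorff_outer_measure_eq_0I)
  fix \<delta> \<epsilon> :: real assume "0 < \<delta>" "0 < \<epsilon>"
  define B where "B = M / (q - 1)"
  have B: "0 \<le> B" using q1 M0 by (simp add: B_def)
  have "(\<lambda>n. B * (1 / q) ^ n) \<longlonglongrightarrow> B * 0"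
    using q1 by (intro tendsto_mult_left LIMSEQ_realpow_zero) auto
  then have 1: "\<forall>\<^sub>F n in sequentially. B * (1 / q) ^ n < \<delta>"
    using order_tendstoD(2) \<open>0 < \<delta>\<close> by fastforce
  have "(\<lambda>n. B powr s * (count n / q powr (real n * s))) \<longlonglongrightarrow> B powr s * 0"
    by (intro tendsto_mult_left assms)
  then have 2: "\<forall>\<^sub>F n in sequentially. B powr s * (count n / q powr (real n * s)) < \<epsilon>"
    using order_tendstoD(2) \<open>0 < \<epsilon>\<close> by fastforce
  obtain n where n: "B * (1 / q) ^ n < \<delta>" "B powr s * (count n / q powr (real n * s)) < \<epsilon>"
    using eventually_happens[OF eventually_conj[OF 1 2]] by auto
  obtain F where F: "finite F" "digit_set q l h \<subseteq> \<Union>F" "real (card F) \<le> count n"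
    "\<And>U. U \<in> F \<Longrightarrow> bounded U \<and> diameter U \<le> B / q ^ n" using cover[of n] unfolding B_def by blast
  have "(\<Sum>U\<in>F. diameter U powr s) \<le> (\<Sum>U\<in>F. (B / q ^ n) powr s)"
    using F(4) assms(1) by (intro sum_mono powr_mono2) (auto simp: diameter_ge_0)
  also have "\<dots> \<le> count n * (B / q ^ n) powr s"
    using F(3) by (simp add: mult_right_mono)
  also have "\<dots> = B powr s * (count n / q powr (real n * s))"
    using B q1 by (simp add: powr_divide powr_realpow[symmetric] powr_powr)
  finally have "(\<Sum>U\<in>F. diameter U powr s) \<le> \<epsilon>" using n(2) by linarith
  moreover have "\<forall>U\<in>F. bounded U \<and> diameter U \<le> \<delta>"
    using F(4) n(1) by (force simp: power_divide)
  ultimately show "\<exists>F. finite F \<and> digit_set q l h \<subseteq> \<Union>F \<and> (\<forall>U\<in>F. bounded U \<and> diameter U \<le> \<delta>) \<and> (\<Sum>U\<in>F. diameter U powr s) \<le> \<epsilon>"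
    using F by blast
qed

text \<open>
  The mixed radix digits of \<open>y \<in> [0,1)\<close>, with \<open>num n\<close> digits available at position \<open>n\<close>, select a point
  of the digit set; the inverse of this parametrization is Hoelder continuous.
\<close>

primrec rem :: "real \<Rightarrow> nat \<Rightarrow> real" where
  "rem y 0 = y"
| "rem y (Suc n) = frac (num n * rem y n)"

definition dgt :: "real \<Rightarrow> nat \<Rightarrow> int" where
  "dgt y n = l n + \<lfloor>num n * rem y n\<rfloor>"

lemma rem_range: "y \<in> {0..<1} \<Longrightarrow> rem y n \<in> {0..<1}"
  by (cases n) (auto simp: frac_lt_1)

lemma dgt_range:
  assumes "y \<in> {0..<1}" shows "l n \<le> dgt y n \<and> dgt y n \<le> h n"
proof -
  have r: "0 \<le> rem y n" "rem y n < 1" using rem_range[OF assms, of n] by auto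
  have "0 \<le> num n * rem y n" using r num_ge_1[of n] by simp
  moreover have "num n * rem y n < num n * 1"
    using r num_ge_1[of n] by (intro mult_strict_left_mono) auto
  ultimately have "0 \<le> \<lfloor>num n * rem y n\<rfloor>" "\<lfloor>num n * rem y n\<rfloor> < h n - l n + 1"
    unfolding num_def by (simp_all only: floor_less_iff zero_le_floor mult_1_right)
  then show ?thesis unfolding dgt_def by linarith
qed

text \<open>A common digit multiplies the difference of the remainders by the number of digits
  available at that position.\<close>

lemma dgt_agree:
  assumes "\<And>i. i < n \<Longrightarrow> dgt y i = dgt y' i"
  shows "y - y' = (rem y n - rem y' n) / count n"
  using assms
proof (induction n)
  case (Suc n)
  have "y - y' = (rem y n - rem y' n) / count n" using Suc by simp
  moreover have "rem y (Suc n) - rem y' (Suc n) = num n * (rem y n - rem y' n)"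
    using Suc.prems[of n] by (simp add: dgt_def frac_def algebra_simps)
  moreover have "count (Suc n) = count n * num n" by (simp add: count_def)
  ultimately show ?case using num_ge_1[of n] count_ge_1[of n] by simp
qed (simp add: count_def)

lemma dgt_agree_bound:
  assumes "y \<in> {0..<1}" "y' \<in> {0..<1}" "\<And>i. i < n \<Longrightarrow> dgt y i = dgt y' i"
  shows "\<bar>y - y'\<bar> \<le> 1 / count n"
proof -
  have "\<bar>rem y n - rem y' n\<bar> \<le> 1" using rem_range[OF assms(1), of n] rem_range[OF assms(2), of n] by auto
  then show ?thesis using dgt_agree[OF assms(3)] count_ge_1[of n] by (simp add: abs_divide divide_right_mono)
qed

lemma outer_measure_neq_0:
  assumes "0 < s" "(\<lambda>n. q powr (real n * s) / count n) \<longlonglongrightarrow> 0"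
  shows "hausdorff_outer_measure s (digit_set q l h) \<noteq> 0"
proof -
  have "Bseq (\<lambda>n. q powr (real n * s) / count n)" using assms(2) convergentI convergent_imp_Bseq by blast
  then obtain K where K: "0 < K" "\<And>n. norm (q powr (real n * s) / count n) \<le> K" by (auto elim: BseqE)
  have count: "1 / count n \<le> K / q powr (real n * s)" for n
    using K(2)[of n] count_ge_1[of n] q1 by (simp add: field_simps)
  define r where "r = 1 - M / (q - 1)"
  have r: "0 < r" using q q1 by (simp add: r_def field_simps)
  \<comment> \<open>Chosen to make \<open>C * (r / q ^ Suc n) powr s\<close> equal to
    \<open>K / q powr (real n * s)\<close>, the bound for parameters whose digits agree before
    position \<open>n\<close>.\<close>
  define C where "C = K * (q / r) powr s"
  have C: "0 < C" using K q1 r by (simp add: C_def)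
  show ?thesis
  proof (rule hausdorff_outer_measure_pos[OF C assms(1)])
    show "val q (dgt y) \<in> digit_set q l h" if "y \<in> {0..<1}" for y
      using dgt_range[OF that] unfolding digit_set_def by blast
    fix y y' :: real assume y: "y \<in> {0..<1}" "y' \<in> {0..<1}"
    show "\<bar>y - y'\<bar> \<le> C * \<bar>val q (dgt y) - val q (dgt y')\<bar> powr s"
    proof (cases "dgt y = dgt y'")
      case True
      \<comment> \<open>Equal digits throughout force equal parameters, as the bound for agreement
        up to \<open>n\<close> tends to 0.\<close>
      have "\<bar>y - y'\<bar> \<le> K * (q powr (- s)) ^ n" for n
      proof -
        have "\<bar>y - y'\<bar> \<le> 1 / count n" using True y by (intro dgt_agree_bound) auto
        also have "\<dots> \<le> K / q powr (real n * s)" by (rule count)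
        also have "\<dots> = K * (q powr (- s)) ^ n"
          using q1 by (simp add: powr_minus_divide powr_power mult.commute power_divide)
        finally show ?thesis .
      qed
      moreover have "(\<lambda>n. K * (q powr (- s)) ^ n) \<longlonglongrightarrow> K * 0"
        using q1 assms(1) by (intro tendsto_mult_left LIMSEQ_realpow_zero) (auto simp: powr_less_one)
      ultimately have "\<bar>y - y'\<bar> \<le> 0" by (intro LIMSEQ_le_const[of "\<lambda>n. K * (q powr (- s)) ^ n"]) auto
      then show ?thesis using C by simp
    next
      case False
      then obtain n where n: "\<And>i. i < n \<Longrightarrow> dgt y i = dgt y' i" "dgt y n \<noteq> dgt y' n"
        using first_difference by blast
      have "r / q ^ Suc n \<le> \<bar>val q (dgt y) - val q (dgt y')\<bar>"
        unfolding r_def using y dgt_range by (intro digit_set_separation q M0 digits n) auto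
      then have "(r / q ^ Suc n) powr s \<le> \<bar>val q (dgt y) - val q (dgt y')\<bar> powr s"
        using r q1 assms(1) by (intro powr_mono2) auto
      then have "C * (r / q ^ Suc n) powr s \<le> C * \<bar>val q (dgt y) - val q (dgt y')\<bar> powr s"
        using C by simp
      moreover have "C * (r / q ^ Suc n) powr s = K / q powr (real n * s)"
      proof -
        have "(q / r) powr s * (r / q ^ Suc n) powr s = (1 / q ^ n) powr s"
          using r q1 by (subst powr_mult[symmetric]) auto
        also have "\<dots> = 1 / q powr (real n * s)"
          using q1 by (simp add: powr_divide powr_realpow[symmetric] powr_powr)
        finally show ?thesis unfolding C_def by (simp only: mult.assoc) simp
      qed
      moreover have "\<bar>y - y'\<bar> \<le> 1 / count n" using n y by (intro dgt_agree_bound) auto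
      ultimately show ?thesis using count[of n] by linarith
    qed
  qed
qed

text \<open>If \<open>a\<close> is the mean of the first \<open>n\<close> logarithms, then
  \<open>count n / q powr (n * s)\<close> is \<open>exp (n * (a - s * ln q))\<close>, and the sign
  of \<open>L - s * ln q\<close> decides between 0 and infinity. The critical exponent itself does
  not affect the infimum.\<close>

lemma hausdorff_dim_digit_set:
  assumes "(\<lambda>n. (\<Sum>i<n. ln (num i)) / n) \<longlonglongrightarrow> L"
  shows "hausdorff_dim (digit_set q l h) = L / ln q"
proof -
  have lnq: "0 < ln q" using q1 by simp
  have L0: "0 \<le> L"
    using num_ge_1 by (intro LIMSEQ_le_const[OF assms]) (auto intro!: divide_nonneg_nonneg sum_nonneg)
  have cnt: "count n = exp (\<Sum>i<n. ln (num i))" for n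
    unfolding count_def using num_ge_1 by (subst exp_sum) (auto intro!: prod.cong simp: less_le_trans[OF zero_less_one])
  have "(\<lambda>n. (\<Sum>i<n. ln (num i)) / n - s * ln q) \<longlonglongrightarrow> L - s * ln q" for s
    by (intro tendsto_intros assms)
  note lim = this
  have upper: "hausdorff_outer_measure s (digit_set q l h) = 0" if "L / ln q < s" for s
  proof (rule outer_measure_eq_0)
    show "0 < s" using that L0 lnq by (meson divide_nonneg_pos order_le_less_trans)
    have neg: "L - s * ln q < 0" using that lnq by (simp add: field_simps)
    have "filterlim (\<lambda>n. ((\<Sum>i<n. ln (num i)) / n - s * ln q) * real n) at_bot sequentially"
      using filterlim_tendsto_neg_mult_at_bot[OF lim neg filterlim_real_sequentially] .
    then have "(\<lambda>n. exp (((\<Sum>i<n. ln (num i)) / n - s * ln q) * real n)) \<longlonglongrightarrow> 0"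
      using exp_at_bot filterlim_compose by blast
    moreover have "\<forall>\<^sub>F n in sequentially. exp (((\<Sum>i<n. ln (num i)) / n - s * ln q) * real n) = count n / q powr (real n * s)"
      using eventually_gt_at_top[of 0] by eventually_elim
        (use q1 in \<open>simp add: cnt powr_def left_diff_distrib flip: exp_diff\<close>)
    ultimately show "(\<lambda>n. count n / q powr (real n * s)) \<longlonglongrightarrow> 0"
      by (rule Lim_transform_eventually)
  qed
  show ?thesis
  proof (rule antisym)
    show "hausdorff_dim (digit_set q l h) \<le> L / ln q"
      using L0 lnq upper by (intro hausdorff_dim_le) auto
    show "L / ln q \<le> hausdorff_dim (digit_set q l h)"
    proof (rule hausdorff_dim_ge)
      show "hausdorff_outer_measure (L / ln q + 1) (digit_set q l h) = 0" by (rule upper) simp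
      show "0 < L / ln q + 1" using L0 lnq by (simp add: add_nonneg_pos)
      fix s assume s: "0 < s" "s < L / ln q"
      show "hausdorff_outer_measure s (digit_set q l h) \<noteq> 0"
      proof (rule outer_measure_neq_0[OF s(1)])
        have pos: "0 < L - s * ln q" using s lnq by (simp add: field_simps)
        have "filterlim (\<lambda>n. ((\<Sum>i<n. ln (num i)) / n - s * ln q) * real n) at_top sequentially"
          using filterlim_tendsto_pos_mult_at_top[OF lim pos filterlim_real_sequentially] .
        then have "filterlim (\<lambda>n. - (((\<Sum>i<n. ln (num i)) / n - s * ln q) * real n)) at_bot sequentially"
          by (simp add: filterlim_uminus_at_bot)
        then have "(\<lambda>n. exp (- (((\<Sum>i<n. ln (num i)) / n - s * ln q) * real n))) \<longlonglongrightarrow> 0"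
          using exp_at_bot filterlim_compose by blast
        moreover have "\<forall>\<^sub>F n in sequentially. exp (- (((\<Sum>i<n. ln (num i)) / n - s * ln q) * real n)) = q powr (real n * s) / count n"
          using eventually_gt_at_top[of 0] by eventually_elim
            (use q1 in \<open>simp add: cnt powr_def left_diff_distrib flip: exp_diff\<close>)
        ultimately show "(\<lambda>n. q powr (real n * s) / count n) \<longlonglongrightarrow> 0"
          by (rule Lim_transform_eventually)
      qed
    qed
  qed
qed

end

lemma dim_intersection_eq:
  assumes "real m + 1 < q" "t \<in> U_set m q" "is_expansion q {- int m..int m} c t"
    and "(\<lambda>n. (\<Sum>i<n. ln (real_of_int (int m + 1 - \<bar>c i\<bar>))) / n) \<longlonglongrightarrow> L"
  shows "dim_intersection m q t = L / ln q"
proof -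
  let ?l = "\<lambda>i. max 0 (c i)" and ?h = "\<lambda>i. min (int m) (int m + c i)"
  have c: "- int m \<le> c i" "c i \<le> int m" for i using assms(3) by (auto simp: is_expansion_def)
  have q1: "1 < q" using assms(1) by linarith
  interpret restricted_digits q "int m" ?l ?h
  proof unfold_locales
    show "max 0 (c i) \<le> min (int m) (int m + c i)" for i using c[of i] by linarith
  qed (use assms(1) in auto)
  have "num = (\<lambda>i. real_of_int (int m + 1 - \<bar>c i\<bar>))"
    unfolding num_def by (intro ext arg_cong[where f = real_of_int]) linarith
  then show ?thesis
    unfolding dim_intersection_def Gamma_inter_translate[OF q1 assms(2,3)]
    using hausdorff_dim_digit_set assms(4) by simp
qed

section \<open>Thue--Morse type binary sequences\<close>

text \<open>
  A digit sequence whose nonzero differences to \<open>m\<close> are alternately \<open>1\<close> and \<open>-1\<close> is written as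
  \<open>m + (\<tau> (i + 1) - \<tau> i)\<close> with a binary sequence \<open>\<tau>\<close>. The lexicographic order is respected, and
  passing from \<open>\<omega>\<^sub>k\<close> to \<open>\<omega>\<^sub>k\<^sub>+\<^sub>1\<close> becomes the Thue--Morse substitution \<open>0 \<mapsto> 01\<close>, \<open>1 \<mapsto> 10\<close>.
\<close>

definition dig :: "nat \<Rightarrow> (nat \<Rightarrow> bool) \<Rightarrow> nat \<Rightarrow> int" where
  "dig m \<tau> i = int m + of_bool (\<tau> (Suc i)) - of_bool (\<tau> i)"

definition tm_subst :: "(nat \<Rightarrow> bool) \<Rightarrow> nat \<Rightarrow> bool" where
  "tm_subst \<tau> i = (\<tau> (i div 2) \<noteq> odd i)"

fun thue_morse :: "nat \<Rightarrow> bool" where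
  "thue_morse n = (if n = 0 then False else thue_morse (n div 2) \<noteq> odd n)"

declare thue_morse.simps [simp del]

text \<open>The first \<open>2 ^ k\<close> Thue-Morse terms repeated with period
  \<open>2 ^ k\<close> (\<open>period_seq_eq\<close>). Its digits are constantly \<open>m\<close>
  for \<open>k = 0\<close>, and otherwise \<open>omega m k\<close> and its reflection in turn
  (\<open>periodic_seq_omega\<close>).\<close>

definition period_seq :: "nat \<Rightarrow> nat \<Rightarrow> bool" where
  "period_seq k = (tm_subst ^^ k) (\<lambda>_. False)"

text \<open>
  Complementing the tails that start with \<open>True\<close> merges the upper and the lower lexicographic
  condition into one.
\<close>

definition ntail :: "(nat \<Rightarrow> bool) \<Rightarrow> nat \<Rightarrow> nat \<Rightarrow> bool" where
  "ntail \<tau> n i = (\<tau> (n + i) \<noteq> \<tau> n)"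

text \<open>The parameters cover all versions that pass through the substitution: strict or weak
  order at all positions, strict order at positive positions when a sequence is its own bound, and
  agreement on a prefix.\<close>

definition admissible ::
  "((nat \<Rightarrow> bool) \<Rightarrow> (nat \<Rightarrow> bool) \<Rightarrow> bool) \<Rightarrow> nat set \<Rightarrow> (nat \<Rightarrow> bool) \<Rightarrow> (nat \<Rightarrow> bool) \<Rightarrow> bool" where
  "admissible R A T \<tau> \<longleftrightarrow> (\<forall>n\<in>A. \<tau> n \<noteq> \<tau> (Suc n) \<longrightarrow> R (ntail \<tau> n) T)"

lemma admissibleI: "(\<And>n. n \<in> A \<Longrightarrow> \<tau> n \<noteq> \<tau> (Suc n) \<Longrightarrow> R (ntail \<tau> n) T) \<Longrightarrow> admissible R A T \<tau>"
  by (auto simp: admissible_def)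

lemma admissibleD: "admissible R A T \<tau> \<Longrightarrow> n \<in> A \<Longrightarrow> \<tau> n \<noteq> \<tau> (Suc n) \<Longrightarrow> R (ntail \<tau> n) T"
  by (auto simp: admissible_def)

section \<open>The substitution, the Thue-Morse sequence and its periodic approximations\<close>

lemma subst_even [simp]: "tm_subst \<tau> (2 * i) = \<tau> i"
  by (simp add: tm_subst_def)

lemma subst_odd [simp]: "tm_subst \<tau> (Suc (2 * i)) = (\<not> \<tau> i)"
  by (simp add: tm_subst_def)

lemma subst_0 [simp]: "tm_subst \<tau> 0 = \<tau> 0"
  by (simp add: tm_subst_def)

lemma subst_eq_iff: "tm_subst \<sigma> = tm_subst \<tau> \<longleftrightarrow> \<sigma> = \<tau>"
proof
  assume "tm_subst \<sigma> = tm_subst \<tau>"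
  then have "tm_subst \<sigma> (2 * i) = tm_subst \<tau> (2 * i)" for i by simp
  then show "\<sigma> = \<tau>" by (intro ext) simp
qed simp

lemma ntail_0 [simp]: "\<not> ntail \<tau> n 0"
  by (simp add: ntail_def)

lemma ntail_eq_self: "\<not> \<tau> 0 \<Longrightarrow> ntail \<tau> 0 = \<tau>"
  by (auto simp: ntail_def)

lemma ntail_shift: "ntail (shift k \<tau>) n = ntail \<tau> (k + n)"
  by (auto simp: ntail_def add.assoc)

lemma ntail_subst: "ntail (tm_subst \<tau>) (2 * n) = tm_subst (ntail \<tau> n)"
  by (auto simp: ntail_def tm_subst_def fun_eq_iff)

lemma shift_subst: "shift (2 * n) (tm_subst \<tau>) = tm_subst (shift n \<tau>)"
  by (auto simp: tm_subst_def fun_eq_iff)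

lemma lexlt_subst:
  assumes "lexlt \<sigma> \<tau>" shows "lexlt (tm_subst \<sigma>) (tm_subst \<tau>)"
proof -
  obtain n where n: "\<And>i. i < n \<Longrightarrow> \<sigma> i = \<tau> i" "\<sigma> n < \<tau> n" using assms by (metis lexltE)
  show ?thesis
    by (rule lexltI[where n = "2 * n"]) (use n in \<open>auto simp: tm_subst_def\<close>)
qed

lemma lexle_subst: "lexle \<sigma> \<tau> \<Longrightarrow> lexle (tm_subst \<sigma>) (tm_subst \<tau>)"
  using lexlt_subst by (auto simp: lexle_def)

lemma lexlt_subst_iff: "lexlt (tm_subst \<sigma>) (tm_subst \<tau>) \<longleftrightarrow> lexlt \<sigma> \<tau>"
  using lexlt_subst lexlt_linear[of \<sigma> \<tau>] lexlt_trans lexlt_irrefl by metis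

lemma lexle_subst_iff: "lexle (tm_subst \<sigma>) (tm_subst \<tau>) \<longleftrightarrow> lexle \<sigma> \<tau>"
  by (simp add: lexle_def lexlt_subst_iff subst_eq_iff)

lemma subst_thue_morse: "tm_subst thue_morse = thue_morse"
proof
  fix i show "tm_subst thue_morse i = thue_morse i"
    using thue_morse.simps[of i] thue_morse.simps[of 0] by (auto simp: tm_subst_def)
qed

lemma thue_morse_0 [simp]: "\<not> thue_morse 0"
  by (simp add: thue_morse.simps)

lemma thue_morse_values:
  "thue_morse (Suc 0)" "thue_morse 2" "\<not> thue_morse 3" "thue_morse 4"
  "\<not> thue_morse 5" "\<not> thue_morse 6" "thue_morse 7"
proof -
  have even: "thue_morse (2 * i) = thue_morse i" and odd: "thue_morse (Suc (2 * i)) = (\<not> thue_morse i)" for i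
    using subst_thue_morse subst_even subst_odd by metis+
  show 1: "thue_morse (Suc 0)" using odd[of 0] by simp
  show 2: "thue_morse 2" using even[of 1] 1 by simp
  show 3: "\<not> thue_morse 3" using odd[of 1] 1 by (simp add: numeral_eq_Suc)
  show "thue_morse 4" using even[of 2] 2 by simp
  show "\<not> thue_morse 5" using odd[of 2] 2 by (simp add: numeral_eq_Suc)
  show "\<not> thue_morse 6" using even[of 3] 3 by simp
  show "thue_morse 7" using odd[of 3] 3 by (simp add: numeral_eq_Suc)
qed

lemma period_seq_0: "period_seq 0 = (\<lambda>_. False)"
  by (simp add: period_seq_def)

lemma period_seq_Suc: "period_seq (Suc k) = tm_subst (period_seq k)"
  by (simp add: period_seq_def)

lemma period_seq_hd [simp]: "\<not> period_seq k 0"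
  by (induction k) (simp_all add: period_seq_0 period_seq_Suc)

lemma period_seq_snd: "0 < k \<Longrightarrow> period_seq k (Suc 0)"
  using subst_odd[of "period_seq (k - 1)" 0] by (cases k) (auto simp: period_seq_Suc)

lemma lexle_all_False: "lexle (\<lambda>_. False) \<tau>"
proof (cases "\<tau> = (\<lambda>_. False)")
  case False
  then obtain n where "\<And>i. i < n \<Longrightarrow> \<tau> i = False" "\<tau> n \<noteq> False"
    using first_difference by blast
  then have "lexlt (\<lambda>_. False) \<tau>" by (intro lexltI[where n = n]) auto
  then show ?thesis by (rule lexlt_imp_lexle)
qed simp

lemma period_seq_mono:
  assumes "j \<le> k" shows "lexle (period_seq j) (period_seq k)"
proof -
  have "lexle (period_seq i) (period_seq (i + d))" for i d
    by (induction i) (auto simp: period_seq_0 period_seq_Suc lexle_all_False intro: lexle_subst)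
  from this[of j "k - j"] assms show ?thesis by simp
qed

lemma period_seq_lexlt_thue_morse: "lexlt (period_seq k) thue_morse"
proof (induction k)
  case 0
  have "thue_morse \<noteq> (\<lambda>_. False)" using thue_morse_values(1) by metis
  then show ?case using lexle_all_False[of thue_morse] by (auto simp: lexle_def period_seq_0)
next
  case (Suc k)
  then show ?case using lexlt_subst[OF Suc] by (simp add: period_seq_Suc subst_thue_morse)
qed

lemma period_seq_eq: "period_seq k i = thue_morse (i mod 2 ^ k)"
proof (induction k arbitrary: i)
  case (Suc k)
  have "i mod 2 ^ Suc k = 2 * (i div 2 mod 2 ^ k) + i mod 2" by (simp add: mod_mult2_eq)
  then have "(i mod 2 ^ Suc k) div 2 = (i div 2) mod 2 ^ k" "odd (i mod 2 ^ Suc k) = odd i"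
    by (auto simp: even_iff_mod_2_eq_zero)
  then have "thue_morse (i mod 2 ^ Suc k) = (thue_morse ((i div 2) mod 2 ^ k) \<noteq> odd i)"
    by (metis tm_subst_def subst_thue_morse)
  then show ?case by (simp add: period_seq_Suc tm_subst_def Suc)
qed (simp add: period_seq_0)

lemma period_seq_period: "period_seq k (2 ^ k + i) = period_seq k i"
  by (simp add: period_seq_eq)

lemma thue_morse_add_exp: "i < 2 ^ k \<Longrightarrow> thue_morse (2 ^ k + i) = (\<not> thue_morse i)"
proof (induction k arbitrary: i)
  case 0
  then show ?case using thue_morse_values by simp
next
  case (Suc k)
  have "thue_morse (2 ^ Suc k + i) = (thue_morse (2 ^ k + i div 2) \<noteq> odd i)"
    using fun_cong[OF subst_thue_morse, of "2 ^ Suc k + i"] by (simp add: tm_subst_def)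
  also have "\<dots> = ((\<not> thue_morse (i div 2)) \<noteq> odd i)" using Suc by simp
  also have "\<dots> = (\<not> tm_subst thue_morse i)" by (simp add: tm_subst_def)
  finally show ?case by (simp add: subst_thue_morse)
qed

lemma thue_morse_exp [simp]: "thue_morse (2 ^ k)"
  using thue_morse_add_exp[of 0 k] by simp

subsection \<open>Admissibility under the substitution\<close>

text \<open>The image of \<open>T\<close> begins with 011. A tail at an even position is the image
  of a tail of \<open>\<tau>\<close>, to which either the hypothesis applies or the fact that it
  begins with 00. A change at an odd position is followed by the change inside the next block, so
  that tail begins with 010.\<close>

lemma admissible_subst:
  assumes "admissible R A T \<tau>" "\<not> T 0" "T (Suc 0)"
    and "\<And>x y. R x y \<Longrightarrow> R' (tm_subst x) (tm_subst y)" "\<And>x y. lexlt x y \<Longrightarrow> R' x y"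
    and "\<And>n. 2 * n \<in> B \<Longrightarrow> n \<in> A"
  shows "admissible R' B (tm_subst T) (tm_subst \<tau>)"
proof (rule admissibleI)
  fix n assume n: "n \<in> B" "tm_subst \<tau> n \<noteq> tm_subst \<tau> (Suc n)"
  have T: "\<not> tm_subst T 0" "tm_subst T (Suc 0)" "tm_subst T 2"
    using assms(2,3) subst_odd[of T 0] subst_even[of T 1] by simp_all
  show "R' (ntail (tm_subst \<tau>) n) (tm_subst T)"
  proof (cases "even n")
    case True
    then obtain k where k: "n = 2 * k" by blast
    show ?thesis
    proof (cases "\<tau> k = \<tau> (Suc k)")
      case True
      have "lexlt (ntail \<tau> k) T"
        by (rule lexltI[where n = 1]) (use True assms(2,3) in \<open>auto simp: ntail_def\<close>)
      then show ?thesis using assms(5) lexlt_subst k by (simp add: ntail_subst)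
    next
      case False
      then have "R (ntail \<tau> k) T" using assms(1,6) n(1) k by (auto dest: admissibleD)
      then show ?thesis using assms(4) k by (simp add: ntail_subst)
    qed
  next
    case False
    then obtain k where k: "n = Suc (2 * k)" using oddE by fastforce
    have v: "tm_subst \<tau> n = (\<not> \<tau> k)" "tm_subst \<tau> (Suc n) = \<tau> (Suc k)" "tm_subst \<tau> (Suc (Suc n)) = (\<not> \<tau> (Suc k))"
      using subst_odd[of \<tau> k] subst_even[of \<tau> "Suc k"] subst_odd[of \<tau> "Suc k"] by (simp_all add: k)
    have "lexlt (ntail (tm_subst \<tau>) n) (tm_subst T)"
    proof (rule lexltI[where n = 2])
      show "ntail (tm_subst \<tau>) n i = tm_subst T i" if "i < 2" for i
        using that n(2) T by (auto simp: less_2_cases_iff ntail_def)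
      show "ntail (tm_subst \<tau>) n 2 < tm_subst T 2" using T n(2) v by (auto simp: ntail_def numeral_2_eq_2)
    qed
    then show ?thesis using assms(5) by blast
  qed
qed

lemma admissible_subst_lexle:
  assumes "admissible lexle UNIV T \<tau>" "\<not> T 0" "T (Suc 0)"
  shows "admissible lexle UNIV (tm_subst T) (tm_subst \<tau>)"
  by (rule admissible_subst[OF assms]) (auto intro: lexle_subst lexlt_imp_lexle)

lemma admissible_subst_lexlt:
  assumes "admissible lexlt {0<..<N} T \<tau>" "\<not> T 0" "T (Suc 0)"
  shows "admissible lexlt {0<..<2 * N} (tm_subst T) (tm_subst \<tau>)"
  by (rule admissible_subst[OF assms]) (auto intro: lexlt_subst)

text \<open>The substitution fixes the sequence and doubles the window of positions, starting from
  an empty window. Position 0 has to stay outside, since there the tail is the bound itself.\<close>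

lemma admissible_thue_morse: "admissible lexlt {0<..} thue_morse thue_morse"
proof -
  have "admissible lexlt {0<..<2 ^ N} thue_morse thue_morse" for N
  proof (induction N)
    case (Suc N)
    from admissible_subst_lexlt[OF this] show ?case
      by (simp add: subst_thue_morse thue_morse_values)
  qed (auto simp: admissible_def)
  then show ?thesis unfolding admissible_def
    by (metis greaterThanLessThan_iff greaterThan_iff less_exp)
qed

lemma period_seq_1: "period_seq (Suc 0) = odd"
  by (auto simp: period_seq_Suc period_seq_0 tm_subst_def)

text \<open>The induction starts at the alternating sequence, because
  \<open>admissible_subst\<close> wants a bound that begins with 01.\<close>

lemma admissible_period_seq: "admissible lexle UNIV (period_seq k) (period_seq k)"
proof (cases k)
  case (Suc j)
  have "admissible lexle UNIV (period_seq (Suc j)) (period_seq (Suc j))"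
  proof (induction j)
    case 0
    have "ntail odd n = odd" for n by (auto simp: ntail_def)
    then show ?case by (simp add: period_seq_1 admissible_def)
  next
    case (Suc j)
    from admissible_subst_lexle[OF this] show ?case
      by (simp add: period_seq_snd flip: period_seq_Suc)
  qed
  with Suc show ?thesis by simp
qed (simp add: admissible_def period_seq_0)

text \<open>The period \<open>2 ^ k\<close> is minimal: an even shift descends to the previous
  sequence, and an odd one is incompatible with the blocks 01 and 10.\<close>

lemma period_seq_shift_neq: "0 < n \<Longrightarrow> n < 2 ^ k \<Longrightarrow> shift n (period_seq k) \<noteq> period_seq k"
proof (induction k arbitrary: n)
  case (Suc k)
  define x where "x = period_seq k"
  show ?case
  proof
    assume "shift n (period_seq (Suc k)) = period_seq (Suc k)"
    then have eq: "tm_subst x (n + i) = tm_subst x i" for i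
      by (metis period_seq_Suc shift_apply x_def)
    show False
    proof (cases "even n")
      case True
      then obtain l where l: "n = 2 * l" by blast
      have "shift l x i = x i" for i
        using eq[of "2 * i"] subst_even[of x "l + i"] by (simp add: l distrib_left)
      then have "shift l x = x" by (rule ext)
      with Suc.IH[of l] Suc.prems l show False unfolding x_def by simp
    next
      case False
      then obtain l where l: "n = Suc (2 * l)" using oddE by fastforce
      have 1: "(\<not> x (l + j)) = x j" for j
        using eq[of "2 * j"] subst_odd[of x "l + j"] by (simp add: l distrib_left)
      have 2: "x (Suc (l + j)) = (\<not> x j)" for j
        using eq[of "Suc (2 * j)"] subst_even[of x "Suc (l + j)"] by (simp add: l distrib_left)
      \<comment> \<open>The two relations give \<open>x (Suc (l + j)) = x (l + j)\<close>, so
        \<open>x\<close> is true from \<open>l\<close> on; the first relation then fails at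
        \<open>l\<close>.\<close>
      have xl: "x (l + j)" for j
      proof (induction j)
        case 0
        show ?case using 1[of 0] period_seq_hd[of k] by (simp add: x_def)
      next
        case (Suc j)
        then show ?case using 1[of j] 2[of j] by simp
      qed
      then show False using 1[of l] xl[of 0] xl[of l] by simp
    qed
  qed
qed simp

subsection \<open>Digits of binary sequences\<close>

lemma digits_upto_dig: "1 \<le> m \<Longrightarrow> digits_upto (2 * int m) (dig m \<tau>)"
  by (auto simp: digits_upto_def dig_def of_bool_def)

lemma shift_dig: "\<not> \<tau> n \<Longrightarrow> shift n (dig m \<tau>) = dig m (ntail \<tau> n)"
  by (auto simp: fun_eq_iff dig_def ntail_def)

lemma shift_dig_compl: "\<tau> n \<Longrightarrow> compl_seq (2 * int m) (shift n (dig m \<tau>)) = dig m (ntail \<tau> n)"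
  by (auto simp: fun_eq_iff dig_def ntail_def)

lemma dig_agree:
  assumes "\<sigma> 0 = \<tau> 0"
  shows "(\<forall>i<n. dig m \<sigma> i = dig m \<tau> i) \<longleftrightarrow> (\<forall>i<Suc n. \<sigma> i = \<tau> i)"
proof (induction n)
  case (Suc n)
  have "dig m \<sigma> n = dig m \<tau> n \<longleftrightarrow> \<sigma> (Suc n) = \<tau> (Suc n)" if "\<sigma> n = \<tau> n"
    using that by (simp add: dig_def)
  with Suc show ?case
    unfolding All_less_Suc[of n "\<lambda>i. dig m \<sigma> i = dig m \<tau> i"]
      All_less_Suc[of "Suc n" "\<lambda>i. \<sigma> i = \<tau> i"] by (meson lessI)
qed (simp add: assms)

lemma dig_lexlt_iff:
  assumes "\<sigma> 0 = \<tau> 0"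
  shows "lexlt (dig m \<sigma>) (dig m \<tau>) \<longleftrightarrow> lexlt \<sigma> \<tau>"
proof
  assume "lexlt (dig m \<sigma>) (dig m \<tau>)"
  then obtain n where n: "\<forall>i<n. dig m \<sigma> i = dig m \<tau> i" "dig m \<sigma> n < dig m \<tau> n"
    unfolding lexlt_def by blast
  then have *: "\<forall>i<Suc n. \<sigma> i = \<tau> i" using dig_agree[where \<sigma> = \<sigma> and \<tau> = \<tau>, OF assms] by blast
  show "lexlt \<sigma> \<tau>"
  proof (rule lexltI[where n = "Suc n"])
    show "\<sigma> i = \<tau> i" if "i < Suc n" for i using * that by blast
    show "\<sigma> (Suc n) < \<tau> (Suc n)"
      using n(2) *[rule_format, of n] by (cases "\<sigma> (Suc n)"; cases "\<tau> (Suc n)") (auto simp: dig_def)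
  qed
next
  assume "lexlt \<sigma> \<tau>"
  then obtain n where n: "\<forall>i<n. \<sigma> i = \<tau> i" "\<sigma> n < \<tau> n" unfolding lexlt_def by blast
  then obtain k where k: "n = Suc k" using assms by (cases n) auto
  show "lexlt (dig m \<sigma>) (dig m \<tau>)"
    by (rule lexltI[where n = k]) (use n k in \<open>auto simp: dig_def\<close>)
qed

lemma dig_eq_iff: "\<sigma> 0 = \<tau> 0 \<Longrightarrow> dig m \<sigma> = dig m \<tau> \<longleftrightarrow> \<sigma> = \<tau>"
  using dig_lexlt_iff lexlt_linear lexlt_irrefl by metis

text \<open>The bound begins with \<open>m + 1\<close>, so only tails beginning with
  \<open>m + 1\<close> need an argument. In the sequence they start at a change from
  \<open>False\<close> to \<open>True\<close>, in its reflection at one from \<open>True\<close> to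
  \<open>False\<close>; in both cases they are the digits of \<open>ntail\<close>.\<close>

lemma dig_tail_lexlt:
  assumes "\<not> T 0" "T (Suc 0)" "\<tau> n \<noteq> \<tau> (Suc n) \<Longrightarrow> lexlt (ntail \<tau> n) T"
  shows "lexlt (shift n (dig m \<tau>)) (dig m T)"
    and "lexlt (compl_seq (2 * int m) (shift n (dig m \<tau>))) (dig m T)"
proof -
  have small: "lexlt c (dig m T)" if "c 0 < int m + 1" for c
    by (rule lexltI[where n = 0]) (use that assms in \<open>auto simp: dig_def\<close>)
  have tail: "lexlt (dig m (ntail \<tau> n)) (dig m T)" if "\<tau> n \<noteq> \<tau> (Suc n)"
    using assms(1) assms(3)[OF that] by (subst dig_lexlt_iff) auto
  show "lexlt (shift n (dig m \<tau>)) (dig m T)"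
  proof (cases "\<not> \<tau> n \<and> \<tau> (Suc n)")
    case True
    then show ?thesis using tail shift_dig[of \<tau> n m] by simp
  next
    case False
    then show ?thesis by (intro small) (auto simp: dig_def)
  qed
  show "lexlt (compl_seq (2 * int m) (shift n (dig m \<tau>))) (dig m T)"
  proof (cases "\<tau> n \<and> \<not> \<tau> (Suc n)")
    case True
    then show ?thesis using tail shift_dig_compl[of \<tau> n m] by simp
  next
    case False
    then show ?thesis by (intro small) (auto simp: dig_def)
  qed
qed

lemma dig_tail_lexle:
  assumes "\<not> T 0" "T (Suc 0)" "\<tau> n \<noteq> \<tau> (Suc n) \<Longrightarrow> lexle (ntail \<tau> n) T"
  shows "lexle (shift n (dig m \<tau>)) (dig m T)"
    and "lexle (compl_seq (2 * int m) (shift n (dig m \<tau>))) (dig m T)"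
proof -
  have small: "lexle c (dig m T)" if "c 0 < int m + 1" for c
    by (rule lexlt_imp_lexle, rule lexltI[where n = 0]) (use that assms in \<open>auto simp: dig_def\<close>)
  have tail: "lexle (dig m (ntail \<tau> n)) (dig m T)" if "\<tau> n \<noteq> \<tau> (Suc n)"
    using assms(1) assms(3)[OF that] dig_lexlt_iff[of "ntail \<tau> n" T] by (auto simp: lexle_def)
  show "lexle (shift n (dig m \<tau>)) (dig m T)"
  proof (cases "\<not> \<tau> n \<and> \<tau> (Suc n)")
    case True
    then show ?thesis using tail shift_dig[of \<tau> n m] by simp
  next
    case False
    then show ?thesis by (intro small) (auto simp: dig_def)
  qed
  show "lexle (compl_seq (2 * int m) (shift n (dig m \<tau>))) (dig m T)"
  proof (cases "\<tau> n \<and> \<not> \<tau> (Suc n)")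
    case True
    then show ?thesis using tail shift_dig_compl[of \<tau> n m] by simp
  next
    case False
    then show ?thesis by (intro small) (auto simp: dig_def)
  qed
qed

lemma lexle_prefix:
  assumes "lexle c d" "\<forall>i<n. c i = d i"
  shows "c n \<le> d n"
proof (cases "c = d")
  case False
  with assms(1) obtain p where p: "\<And>i. i < p \<Longrightarrow> c i = d i" "c p < d p"
    unfolding lexle_def by (metis lexltE)
  then have "n \<le> p" using assms(2)[rule_format, of p] by (cases "n \<le> p") auto
  then show ?thesis using p by (cases "n = p") auto
qed simp

lemma dig_thue_morse_values:
  "dig m thue_morse 0 = int m + 1" "dig m thue_morse (Suc 0) = int m"
  "dig m thue_morse (Suc (Suc 0)) = int m - 1"
  using thue_morse_values(1-3) by (simp_all add: dig_def numeral_eq_Suc)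

text \<open>
  The bound by \<open>(m + 1) m (m - 1) \<dots>\<close> forces the nonzero differences to \<open>m\<close> to alternate in sign,
  with at most one \<open>m\<close> in between. The state \<open>\<tau> i\<close> is \<open>True\<close> iff the next nonzero one is \<open>-1\<close>.
\<close>

lemma bounded_imp_dig:
  assumes 1: "\<And>n. lexle (shift n d) (dig m thue_morse)"
    and 2: "\<And>n. lexle (compl_seq (2 * int m) (shift n d)) (dig m thue_morse)"
    and "d 0 \<noteq> int m"
  obtains \<tau> where "d = dig m \<tau>"
proof -
  have u: "d n \<le> int m + 1" for n using lexle_hd[OF 1[of n]] by (simp add: dig_thue_morse_values)
  have l: "int m - 1 \<le> d n" for n using lexle_hd[OF 2[of n]] by (simp add: dig_thue_morse_values)
  have pos: "d (Suc n) = int m - 1 \<or> (d (Suc n) = int m \<and> d (Suc (Suc n)) = int m - 1)" if "d n = int m + 1" for n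
  proof -
    have "d (Suc n) \<le> int m"
      using lexle_prefix[OF 1[of n], of "Suc 0"] that by (simp add: dig_thue_morse_values)
    moreover have "d (Suc (Suc n)) \<le> int m - 1" if "d (Suc n) = int m"
      using lexle_prefix[OF 1[of n], of "Suc (Suc 0)"] that \<open>d n = int m + 1\<close>
      by (simp add: dig_thue_morse_values All_less_Suc)
    ultimately show ?thesis using l[of "Suc n"] l[of "Suc (Suc n)"] by linarith
  qed
  have neg: "d (Suc n) = int m + 1 \<or> (d (Suc n) = int m \<and> d (Suc (Suc n)) = int m + 1)" if "d n = int m - 1" for n
  proof -
    have "d (Suc n) \<ge> int m"
      using lexle_prefix[OF 2[of n], of "Suc 0"] that by (simp add: dig_thue_morse_values)
    moreover have "d (Suc (Suc n)) \<ge> int m + 1" if "d (Suc n) = int m"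
      using lexle_prefix[OF 2[of n], of "Suc (Suc 0)"] that \<open>d n = int m - 1\<close>
      by (simp add: dig_thue_morse_values All_less_Suc)
    ultimately show ?thesis using u[of "Suc n"] u[of "Suc (Suc n)"] by linarith
  qed
  have trichotomy: "d n = int m + 1 \<or> d n = int m \<or> d n = int m - 1" for n using u[of n] l[of n] by linarith
  \<comment> \<open>Behind a digit other than \<open>m\<close> no two digits \<open>m\<close> are
    adjacent; a longer run could occur only at the start, which \<open>d 0 \<noteq> int m\<close>
    rules out. One digit of lookahead therefore suffices in the definition of
    \<open>\<tau>\<close>.\<close>
  have isolated: "d n \<noteq> int m \<or> d (Suc n) \<noteq> int m" for n
  proof (induction n)
    case (Suc n)
    then show ?case using trichotomy[of n] pos[of n] neg[of n] by auto
  qed (use assms(3) in simp)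
  define \<tau> where "\<tau> i \<longleftrightarrow> d i = int m - 1 \<or> (d i = int m \<and> d (Suc i) = int m - 1)" for i
  have "d i = dig m \<tau> i" for i
    using trichotomy[of i] pos[of i] neg[of i] isolated[of i] trichotomy[of "Suc i"]
    by (auto simp: dig_def \<tau>_def)
  then show thesis using that[of \<tau>] by (simp add: fun_eq_iff)
qed

lemma dig_bounded_imp_admissible:
  assumes "\<And>n. lexlt (shift n (dig m \<tau>)) (dig m T)"
    and "\<And>n. lexlt (compl_seq (2 * int m) (shift n (dig m \<tau>))) (dig m T)" and "\<not> T 0"
  shows "admissible lexlt UNIV T \<tau>"
proof (rule admissibleI)
  fix n assume "\<tau> n \<noteq> \<tau> (Suc n)"
  have "lexlt (dig m (ntail \<tau> n)) (dig m T)"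
    using assms(1,2)[of n] shift_dig[of \<tau> n m] shift_dig_compl[of \<tau> n m] by (cases "\<tau> n") auto
  then show "lexlt (ntail \<tau> n) T" using assms(3) by (subst (asm) dig_lexlt_iff) auto
qed

subsection \<open>Desubstitution\<close>

text \<open>
  Between consecutive repetitions the positions differ by 2 or 4, so that cutting in the middle of
  one repetition never leaves a repetition inside a block of length 2.
\<close>

lemma desubst_after_repetition:
  assumes adm: "admissible lexle UNIV thue_morse \<tau>"
    and "\<tau> n \<noteq> \<tau> (Suc n)" "\<tau> (Suc n) = \<tau> (Suc (Suc n))"
  shows "\<tau> (n + 2 + 2 * i) \<noteq> \<tau> (n + 3 + 2 * i)"
  using assms(2,3)
proof (induction i arbitrary: n rule: less_induct)
  case (less i)
  define x where "x = ntail \<tau> n"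
  have lx: "lexle x thue_morse" using adm less.prems by (simp add: admissible_def x_def)
  have x: "\<not> x 0" "x 1" "x 2" using less.prems by (auto simp: x_def ntail_def)
  note tm = thue_morse_values thue_morse_0
  have x3: "\<not> x 3"
    using lexle_prefix[OF lx, of 3] x tm by (auto simp: numeral_eq_Suc All_less_Suc)
  have x5: "\<not> x 5" if "x 4"
    using lexle_prefix[OF lx, of 5] x x3 that tm by (auto simp: numeral_eq_Suc All_less_Suc)
  have x6: "\<not> x 6" if "x 4"
    using lexle_prefix[OF lx, of 6] x x3 x5 that tm by (auto simp: numeral_eq_Suc All_less_Suc)
  have \<tau>: "\<tau> (n + i) = (x i \<noteq> \<tau> n)" for i by (auto simp: x_def ntail_def)
  \<comment> \<open>\<open>x\<close> begins with 0110. If \<open>x 4\<close> fails, a repetition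
    ends there; otherwise \<open>x\<close> begins with 0110100 and one ends at 6. The induction
    restarts two or four places further on.\<close>
  consider "i = 0" | "0 < i" "\<not> x 4" | "i = 1" "x 4" | "1 < i" "x 4" by linarith
  then show ?case
  proof cases
    case 1
    then show ?thesis using \<tau>[of 2] \<tau>[of 3] x x3 by simp
  next
    case 2
    have "\<tau> (n + 2 + 2 + 2 * (i - 1)) \<noteq> \<tau> (n + 2 + 3 + 2 * (i - 1))"
      by (rule less.IH) (use 2 \<tau>[of 2] \<tau>[of 3] \<tau>[of 4] x x3 in \<open>auto simp: numeral_eq_Suc\<close>)
    moreover have "n + 2 + 2 + 2 * (i - 1) = n + 2 + 2 * i" "n + 2 + 3 + 2 * (i - 1) = n + 3 + 2 * i"
      using 2 by auto
    ultimately show ?thesis by metis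
  next
    case 3
    then show ?thesis using \<tau>[of 4] \<tau>[of 5] x5 by (simp add: numeral_eq_Suc)
  next
    case 4
    have "\<tau> (n + 4 + 2 + 2 * (i - 2)) \<noteq> \<tau> (n + 4 + 3 + 2 * (i - 2))"
      by (rule less.IH) (use 4 \<tau>[of 4] \<tau>[of 5] \<tau>[of 6] x5 x6 in \<open>auto simp: numeral_eq_Suc\<close>)
    moreover have "n + 4 + 2 + 2 * (i - 2) = n + 2 + 2 * i" "n + 4 + 3 + 2 * (i - 2) = n + 3 + 2 * i"
      using 4 by auto
    ultimately show ?thesis by metis
  qed
qed

lemma subst_decomp:
  assumes "\<And>i. \<sigma> (2 * i) \<noteq> \<sigma> (Suc (2 * i))"
  shows "\<sigma> = tm_subst (\<lambda>i. \<sigma> (2 * i))"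
proof
  fix i show "\<sigma> i = tm_subst (\<lambda>i. \<sigma> (2 * i)) i"
    using assms[of "i div 2"] by (cases "even i") (auto elim!: evenE oddE simp: tm_subst_def)
qed

lemma admissible_desubst:
  assumes "admissible lexlt UNIV (tm_subst T) (tm_subst \<tau>)"
  shows "admissible lexlt UNIV T \<tau>"
proof (rule admissibleI)
  fix n assume n: "\<tau> n \<noteq> \<tau> (Suc n)"
  have "lexlt (ntail (tm_subst \<tau>) (2 * n)) (tm_subst T)"
    using assms by (rule admissibleD) auto
  then show "lexlt (ntail \<tau> n) T" by (simp add: ntail_subst lexlt_subst_iff)
qed

lemma admissible_shift: "admissible R UNIV T \<tau> \<Longrightarrow> admissible R UNIV T (shift n \<tau>)"
  by (auto simp: admissible_def ntail_shift)

text \<open>Without a change the sequence is constant. From a change on it either alternates for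
  ever, and can be cut at once, or meets a first repetition, in whose middle it is cut.\<close>

lemma admissible_dichotomy:
  assumes "admissible lexlt UNIV (tm_subst T) \<tau>" "lexle (tm_subst T) thue_morse"
  shows "(\<exists>b. \<tau> = (\<lambda>_. b)) \<or> (\<exists>N \<tau>'. shift N \<tau> = tm_subst \<tau>' \<and> admissible lexlt UNIV T \<tau>')"
proof (rule disjCI)
  assume nc: "\<not> (\<exists>N \<tau>'. shift N \<tau> = tm_subst \<tau>' \<and> admissible lexlt UNIV T \<tau>')"
  have adm: "admissible lexle UNIV thue_morse \<tau>"
    using assms by (auto simp: admissible_def intro: lexlt_imp_lexle lexlt_lexle_trans)
  have desub: False if "\<And>i. \<tau> (N + 2 * i) \<noteq> \<tau> (Suc (N + 2 * i))" for N
  proof -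
    define \<tau>' where "\<tau>' i = \<tau> (N + 2 * i)" for i
    have eq: "shift N \<tau> = tm_subst \<tau>'"
      unfolding \<tau>'_def using that subst_decomp[of "shift N \<tau>"] by simp
    moreover have "admissible lexlt UNIV T \<tau>'"
      using admissible_shift[OF assms(1), of N] unfolding eq by (rule admissible_desubst)
    ultimately show False using nc by blast
  qed
  have const: "\<tau> n = \<tau> (Suc n)" for n
  proof (rule ccontr)
    assume n: "\<tau> n \<noteq> \<tau> (Suc n)"
    show False
    proof (cases "\<forall>k. \<tau> (n + k) \<noteq> \<tau> (Suc (n + k))")
      case True
      then show False by (intro desub[of n]) auto
    next
      case False
      \<comment> \<open>Minimality of \<open>k\<close>, which is positive because of the change at
        \<open>n\<close>, puts a change directly before the repetition, as
        \<open>desubst_after_repetition\<close> requires.\<close>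
      define k where "k = (LEAST k. \<tau> (n + k) = \<tau> (Suc (n + k)))"
      have k: "\<tau> (n + k) = \<tau> (Suc (n + k))" unfolding k_def by (rule LeastI_ex) (use False in blast)
      with n obtain j where j: "k = Suc j" by (cases k) auto
      then have "\<tau> (n + j) \<noteq> \<tau> (Suc (n + j))" using not_less_Least[of j "\<lambda>k. \<tau> (n + k) = \<tau> (Suc (n + k))"] unfolding k_def by simp
      then show False
        using desubst_after_repetition[OF adm, of "n + j"] k j by (intro desub[of "n + j + 2"]) (auto simp: eval_nat_numeral)
    qed
  qed
  have "\<tau> n = \<tau> 0" for n using const by (induction n) auto
  then show "\<exists>b. \<tau> = (\<lambda>_. b)" by blast
qed

lemma admissible_False_imp_const:
  assumes "admissible lexlt UNIV (\<lambda>_. False) \<tau>"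
  shows "\<exists>b. \<tau> = (\<lambda>_. b)"
proof -
  have "\<tau> n = \<tau> (Suc n)" for n
  proof (rule ccontr)
    assume "\<tau> n \<noteq> \<tau> (Suc n)"
    with assms have "lexlt (ntail \<tau> n) (\<lambda>_. False)" by (simp add: admissible_def)
    then show False by (auto simp: lexlt_def)
  qed
  then have "\<tau> n = \<tau> 0" for n by (induction n) auto
  then show ?thesis by blast
qed

lemma shift_subst_iter: "shift (2 ^ j * n) ((tm_subst ^^ j) \<tau>) = (tm_subst ^^ j) (shift n \<tau>)"
  by (induction j) (simp_all add: shift_subst mult.assoc del: shift_apply)

text \<open>Each desubstitution lowers the index of the bound by one, so a constant sequence is
  reached after at most \<open>k\<close> of them.\<close>

lemma admissible_period_seq_imp:
  assumes "admissible lexlt UNIV (period_seq (Suc k)) \<tau>"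
  shows "\<exists>N j b. j \<le> k \<and> shift N \<tau> = (tm_subst ^^ j) (\<lambda>_. b)"
  using assms
proof (induction k arbitrary: \<tau>)
  case 0
  have "lexle (tm_subst (period_seq 0)) thue_morse"
    using period_seq_lexlt_thue_morse[of 1] by (simp add: period_seq_Suc lexlt_imp_lexle)
  then consider b where "\<tau> = (\<lambda>_. b)" | N \<tau>' where "shift N \<tau> = tm_subst \<tau>'" "admissible lexlt UNIV (period_seq 0) \<tau>'"
    using admissible_dichotomy[of "period_seq 0" \<tau>] 0 by (auto simp: period_seq_Suc)
  then show ?case
  proof cases
    case 1
    then have "0 \<le> (0::nat) \<and> shift 0 \<tau> = (tm_subst ^^ 0) (\<lambda>_. b)" by simp
    then show ?thesis by blast
  next
    case 2
    then obtain b where b: "\<tau>' = (\<lambda>_. b)"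
      using admissible_False_imp_const unfolding period_seq_0 by blast
    \<comment> \<open>A further desubstitution would make \<open>\<tau>\<close> eventually
      alternating, with a tail equal to the bound; strictness forbids this.\<close>
    have "\<tau> N \<noteq> \<tau> (Suc N)"
      using fun_cong[OF 2(1), of 0] fun_cong[OF 2(1), of "Suc 0"] subst_odd[of \<tau>' 0] by (simp add: b)
    then have "lexlt (ntail \<tau> N) (period_seq (Suc 0))" using 0 by (auto dest: admissibleD)
    moreover have "ntail \<tau> N = ntail (tm_subst (\<lambda>_. b)) 0"
      using ntail_shift[of N \<tau> 0] 2 b by simp
    moreover have "\<dots> = period_seq (Suc 0)" by (auto simp: ntail_def period_seq_1 tm_subst_def)
    ultimately show ?thesis by simp
  qed
next
  case (Suc k)
  have "lexle (tm_subst (period_seq (Suc k))) thue_morse"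
    using period_seq_lexlt_thue_morse[of "Suc (Suc k)"] by (simp add: period_seq_Suc lexlt_imp_lexle)
  then consider b where "\<tau> = (\<lambda>_. b)" | N \<tau>' where "shift N \<tau> = tm_subst \<tau>'" "admissible lexlt UNIV (period_seq (Suc k)) \<tau>'"
    using admissible_dichotomy[of "period_seq (Suc k)" \<tau>] Suc.prems by (auto simp: period_seq_Suc)
  then show ?case
  proof cases
    case 1
    then have "0 \<le> Suc k \<and> shift 0 \<tau> = (tm_subst ^^ 0) (\<lambda>_. b)" by simp
    then show ?thesis by blast
  next
    case 2
    from Suc.IH[OF 2(2)] obtain N' j b where j: "j \<le> k" "shift N' \<tau>' = (tm_subst ^^ j) (\<lambda>_. b)" by blast
    have "shift (N + 2 * N') \<tau> = tm_subst (shift N' \<tau>')" using 2(1) by (metis shift_shift shift_subst)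
    then have "Suc j \<le> Suc k \<and> shift (N + 2 * N') \<tau> = (tm_subst ^^ Suc j) (\<lambda>_. b)" using j by simp
    then show ?thesis by blast
  qed
qed

text \<open>The bound is a fixed point, so it survives every desubstitution. A shift by
  \<open>N'\<close> below \<open>k\<close> substitutions is one by \<open>2 ^ k * N'\<close> above
  them, so the cuts accumulate to a single shift.\<close>

lemma admissible_thue_morse_imp:
  assumes "admissible lexlt UNIV thue_morse \<tau>"
  shows "(\<exists>N \<tau>'. shift N \<tau> = (tm_subst ^^ k) \<tau>' \<and> admissible lexlt UNIV thue_morse \<tau>') \<or>
    (\<exists>N j b. shift N \<tau> = (tm_subst ^^ j) (\<lambda>_. b))"
proof (induction k)
  case 0
  have "shift 0 \<tau> = (tm_subst ^^ 0) \<tau> \<and> admissible lexlt UNIV thue_morse \<tau>" using assms by simp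
  then show ?case by blast
next
  case (Suc k)
  show ?case
  proof (rule disjCI)
    assume np: "\<not> (\<exists>N j b. shift N \<tau> = (tm_subst ^^ j) (\<lambda>_. b))"
    with Suc obtain N \<tau>' where t: "shift N \<tau> = (tm_subst ^^ k) \<tau>'" "admissible lexlt UNIV thue_morse \<tau>'" by blast
    then have "\<tau>' \<noteq> (\<lambda>_. b)" for b using np by blast
    then obtain N' \<tau>'' where "shift N' \<tau>' = tm_subst \<tau>''" "admissible lexlt UNIV thue_morse \<tau>''"
      using admissible_dichotomy[of thue_morse \<tau>'] t(2) by (auto simp: subst_thue_morse)
    moreover have "shift (N + 2 ^ k * N') \<tau> = (tm_subst ^^ k) (shift N' \<tau>')"
      using t(1) by (metis shift_shift shift_subst_iter)
    ultimately have "shift (N + 2 ^ k * N') \<tau> = (tm_subst ^^ Suc k) \<tau>'' \<and> admissible lexlt UNIV thue_morse \<tau>''"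
      by (simp add: funpow_swap1)
    then show "\<exists>N \<tau>'. shift N \<tau> = (tm_subst ^^ Suc k) \<tau>' \<and> admissible lexlt UNIV thue_morse \<tau>'" by blast
  qed
qed

text \<open>Here the blocks must start at position 0, with no tail cut off. This works once
  \<open>\<tau>\<close> is known to begin with 011: the repetition at 1 and 2 puts all later block
  boundaries at even positions.\<close>

lemma self_admissible_desubst:
  assumes "\<not> \<tau> 0" "\<tau> (Suc 0)" "admissible lexlt {0<..} \<tau> \<tau>" "lexle \<tau> thue_morse"
  obtains \<tau>' where "\<tau> = tm_subst \<tau>'" "\<not> \<tau>' 0" "\<tau>' (Suc 0)" "admissible lexlt {0<..} \<tau>' \<tau>'" "lexle \<tau>' thue_morse"
proof -
  have adm: "admissible lexle UNIV thue_morse \<tau>"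
  proof (rule admissibleI)
    fix n assume n: "\<tau> n \<noteq> \<tau> (Suc n)"
    show "lexle (ntail \<tau> n) thue_morse"
    proof (cases "n = 0")
      case True
      then show ?thesis using assms by (simp add: ntail_eq_self)
    next
      case False
      then have "lexlt (ntail \<tau> n) \<tau>" using assms(3) n by (auto dest: admissibleD)
      then show ?thesis using assms(4) by (blast intro: lexlt_imp_lexle lexlt_lexle_trans)
    qed
  qed
  \<comment> \<open>If \<open>\<tau>\<close> began with 010, its own bound would forbid any later
    repetition. It would then alternate for ever and equal its tail at 2, against
    strictness.\<close>
  have \<tau>2: "\<tau> (Suc (Suc 0))"
  proof (rule ccontr)
    assume n2: "\<not> \<tau> (Suc (Suc 0))"
    have alt: "\<tau> n \<noteq> \<tau> (Suc n)" for n
    proof (induction n)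
      case (Suc n)
      show ?case
      proof
        assume r: "\<tau> (Suc n) = \<tau> (Suc (Suc n))"
        with assms n2 have "0 < n" by (cases n) auto
        then have "lexlt (ntail \<tau> n) \<tau>" using assms(3) Suc by (auto dest: admissibleD)
        then have "ntail \<tau> n (Suc (Suc 0)) \<le> \<tau> (Suc (Suc 0))"
        proof (intro lexle_prefix)
          show "lexle (ntail \<tau> n) \<tau>" using \<open>lexlt (ntail \<tau> n) \<tau>\<close> by (rule lexlt_imp_lexle)
          show "\<forall>i<Suc (Suc 0). ntail \<tau> n i = \<tau> i"
            using Suc assms(1,2) by (auto simp: All_less_Suc ntail_def)
        qed
        then show False using n2 r Suc by (auto simp: ntail_def)
      qed
    qed (use assms in simp)
    have "\<tau> i = odd i" for i
    proof (induction i)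
      case (Suc i)
      then show ?case using alt[of i] by simp
    qed (simp add: assms(1))
    then have "\<tau> = odd" by auto
    moreover have "ntail odd 2 = odd" by (auto simp: ntail_def)
    ultimately show False using assms(3) by (auto simp: admissible_def dest: bspec[of _ _ 2])
  qed
  define \<tau>' where "\<tau>' i = \<tau> (2 * i)" for i
  have "\<tau> (2 * i) \<noteq> \<tau> (Suc (2 * i))" for i
  proof (cases i)
    case (Suc k)
    then show ?thesis using desubst_after_repetition[OF adm, of 0 k] assms \<tau>2 by (simp add: eval_nat_numeral)
  qed (use assms in simp)
  then have \<tau>: "\<tau> = tm_subst \<tau>'" unfolding \<tau>'_def by (rule subst_decomp)
  have "lexlt (ntail \<tau>' n) \<tau>'" if "0 < n" "\<tau>' n \<noteq> \<tau>' (Suc n)" for n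
  proof -
    have "lexlt (ntail (tm_subst \<tau>') (2 * n)) (tm_subst \<tau>')"
      using assms(3) that(1) unfolding \<tau> by (auto elim!: admissibleD)
    then show ?thesis by (simp add: ntail_subst lexlt_subst_iff)
  qed
  moreover have "lexle \<tau>' thue_morse"
    using assms(4) lexle_subst_iff[of \<tau>' thue_morse] by (simp add: \<tau> subst_thue_morse)
  ultimately show thesis
    using assms(1) \<tau>2 by (intro that[OF \<tau>]) (auto simp: \<tau>'_def admissible_def eval_nat_numeral)
qed

text \<open>All hypotheses pass to the desubstituted sequence, so \<open>N\<close> desubstitutions
  determine the first \<open>2 ^ N\<close> terms. This yields the minimality of
  \<open>q_KL\<close>.\<close>

lemma self_admissible_eq_thue_morse:
  assumes "\<not> \<tau> 0" "\<tau> (Suc 0)" "admissible lexlt {0<..} \<tau> \<tau>" "lexle \<tau> thue_morse"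
  shows "\<tau> = thue_morse"
proof -
  have "\<tau> i = thue_morse i" if "i < 2 ^ N" for i N
    using assms that
  proof (induction N arbitrary: \<tau> i)
    case (Suc N)
    obtain \<tau>' where t: "\<tau> = tm_subst \<tau>'" "\<not> \<tau>' 0" "\<tau>' (Suc 0)" "admissible lexlt {0<..} \<tau>' \<tau>'" "lexle \<tau>' thue_morse"
      using self_admissible_desubst[OF Suc.prems(1-4)] by blast
    have "\<tau>' (i div 2) = thue_morse (i div 2)" using Suc.IH[OF t(2-5)] Suc.prems(5) by simp
    then have "tm_subst \<tau>' i = tm_subst thue_morse i" by (simp add: tm_subst_def)
    then show ?case by (simp add: t(1) subst_thue_morse)
  qed simp
  then show ?thesis using less_exp by (intro ext) blast
qed

section \<open>Averages\<close>

text \<open>The constant \<open>B\<close> absorbs shifts and incomplete blocks; the linear error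
  \<open>e\<close> is kept because each substitution halves it.\<close>

definition near_avg :: "(nat \<Rightarrow> real) \<Rightarrow> real \<Rightarrow> real \<Rightarrow> bool" where
  "near_avg f z e \<longleftrightarrow> (\<exists>B. \<forall>n. \<bar>(\<Sum>i<n. f i) - z * n\<bar> \<le> e * n + B)"

definition eq_next :: "(nat \<Rightarrow> bool) \<Rightarrow> nat \<Rightarrow> real" where
  "eq_next \<tau> i = of_bool (\<tau> i = \<tau> (Suc i))"

definition swap_freq :: "real \<Rightarrow> real" where
  "swap_freq z = (1 - z) / 2"

lemma near_avg_mono: "near_avg f z e \<Longrightarrow> e \<le> e' \<Longrightarrow> near_avg f z e'"
  unfolding near_avg_def by (meson add_right_mono mult_right_mono of_nat_0_le_iff order_trans)

lemma near_avg_imp_limit: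
  assumes "\<And>e. 0 < e \<Longrightarrow> near_avg f z e"
  shows "(\<lambda>n. (\<Sum>i<n. f i) / n) \<longlonglongrightarrow> z"
proof (rule LIMSEQ_I)
  fix r :: real assume "0 < r"
  then obtain B where B: "\<And>n. \<bar>(\<Sum>i<n. f i) - z * n\<bar> \<le> r / 2 * n + B"
    using assms[of "r / 2"] unfolding near_avg_def by auto
  obtain N where N: "2 * \<bar>B\<bar> / r < real N" using reals_Archimedean2 by blast
  show "\<exists>no. \<forall>n\<ge>no. norm ((\<Sum>i<n. f i) / n - z) < r"
  proof (intro exI[of _ "Suc N"] allI impI)
    fix n assume n: "Suc N \<le> n"
    then have "2 * \<bar>B\<bar> / r < real n" using N by linarith
    then have "\<bar>B\<bar> < r / 2 * n" using \<open>0 < r\<close> by (simp add: field_simps)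
    with B[of n] have "\<bar>(\<Sum>i<n. f i) - z * n\<bar> < r * n" by linarith
    moreover have "(\<Sum>i<n. f i) / n - z = ((\<Sum>i<n. f i) - z * n) / n" using n by (simp add: diff_divide_distrib)
    ultimately show "norm ((\<Sum>i<n. f i) / n - z) < r" using n by (simp add: divide_less_eq)
  qed
qed

lemma near_avg_shift:
  assumes "near_avg (shift N f) z e" "0 \<le> e"
  shows "near_avg f z e"
proof -
  obtain B where B: "\<And>n. \<bar>(\<Sum>i<n. f (N + i)) - z * n\<bar> \<le> e * n + B"
    using assms(1) unfolding near_avg_def shift_apply by auto
  let ?A = "\<Sum>i<N. \<bar>f i\<bar>"
  have "\<bar>(\<Sum>i<n. f i) - z * n\<bar> \<le> e * n + (?A + \<bar>z\<bar> * N + \<bar>B\<bar>)" for n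
  proof (cases "n \<le> N")
    case True
    have "\<bar>\<Sum>i<n. f i\<bar> \<le> (\<Sum>i<n. \<bar>f i\<bar>)" by (rule sum_abs)
    also have "\<dots> \<le> ?A" using True by (intro sum_mono2) auto
    finally have "\<bar>\<Sum>i<n. f i\<bar> \<le> ?A" .
    moreover have "\<bar>z * n\<bar> \<le> \<bar>z\<bar> * N" using True by (simp add: abs_mult mult_left_mono)
    moreover have "0 \<le> e * n" using assms(2) by simp
    ultimately show ?thesis by linarith
  next
    case False
    then obtain k where k: "n = N + k" by (metis le_add_diff_inverse linear)
    have "(\<Sum>i<n. f i) = (\<Sum>i<N. f i) + (\<Sum>i<k. f (N + i))"
      unfolding k by (induction k) simp_all
    moreover have "\<bar>\<Sum>i<N. f i\<bar> \<le> ?A" by (rule sum_abs)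
    moreover have "z * n = z * N + z * k" "e * n = e * N + e * k" by (simp_all add: k distrib_left)
    moreover have "\<bar>z * N\<bar> = \<bar>z\<bar> * N" by (simp add: abs_mult)
    moreover have "0 \<le> e * N" using assms(2) by simp
    ultimately show ?thesis using B[of k] by linarith
  qed
  then show ?thesis unfolding near_avg_def by blast
qed

lemma near_avg_affine:
  assumes "near_avg f z e"
  shows "near_avg (\<lambda>i. a + b * f i) (a + b * z) (\<bar>b\<bar> * e)"
proof -
  obtain B where B: "\<And>n. \<bar>(\<Sum>i<n. f i) - z * n\<bar> \<le> e * n + B"
    using assms unfolding near_avg_def by auto
  have "\<bar>(\<Sum>i<n. a + b * f i) - (a + b * z) * n\<bar> \<le> \<bar>b\<bar> * e * n + \<bar>b\<bar> * B" for n
  proof -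
    have "(\<Sum>i<n. a + b * f i) - (a + b * z) * n = b * ((\<Sum>i<n. f i) - z * n)"
      by (simp add: sum.distrib sum_distrib_left algebra_simps)
    then have "\<bar>(\<Sum>i<n. a + b * f i) - (a + b * z) * n\<bar> = \<bar>b\<bar> * \<bar>(\<Sum>i<n. f i) - z * n\<bar>"
      by (simp add: abs_mult)
    also have "\<dots> \<le> \<bar>b\<bar> * (e * n + B)" using B by (intro mult_left_mono) auto
    finally show ?thesis by (simp add: distrib_left mult.assoc)
  qed
  then show ?thesis unfolding near_avg_def by blast
qed

lemma near_avg_const: "near_avg (\<lambda>_. a) a 0"
  unfolding near_avg_def by (auto simp: mult.commute)

lemma shift_eq_next: "shift N (eq_next \<tau>) = eq_next (shift N \<tau>)"
  by (simp add: eq_next_def fun_eq_iff)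

lemma sum_eq_next_subst: "(\<Sum>i<2 * n. eq_next (tm_subst \<tau>) i) = n - (\<Sum>i<n. eq_next \<tau> i)"
proof (induction n)
  case (Suc n)
  have "eq_next (tm_subst \<tau>) (2 * n) = 0" using subst_odd[of \<tau> n] by (simp add: eq_next_def)
  moreover have "eq_next (tm_subst \<tau>) (Suc (2 * n)) = 1 - eq_next \<tau> n"
    using subst_odd[of \<tau> n] subst_even[of \<tau> "Suc n"] by (auto simp: eq_next_def)
  ultimately show ?case using Suc by simp
qed simp

text \<open>Equal neighbours in \<open>tm_subst \<tau>\<close> occur exactly between blocks coming from distinct neighbours.\<close>

lemma near_avg_subst:
  assumes "near_avg (eq_next \<tau>) z e" "0 \<le> e"
  shows "near_avg (eq_next (tm_subst \<tau>)) (swap_freq z) (e / 2)"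
proof -
  obtain B where B: "\<And>n. \<bar>(\<Sum>i<n. eq_next \<tau> i) - z * n\<bar> \<le> e * n + B"
    using assms unfolding near_avg_def by auto
  define f where "f = eq_next (tm_subst \<tau>)"
  have even: "\<bar>(\<Sum>i<2 * n. f i) - swap_freq z * (2 * n)\<bar> \<le> e * n + B" for n :: nat
  proof -
    have "(\<Sum>i<2 * n. f i) - swap_freq z * (2 * n) = - ((\<Sum>i<n. eq_next \<tau> i) - z * n)"
      unfolding f_def sum_eq_next_subst by (simp add: swap_freq_def field_simps)
    then show ?thesis using B[of n] by simp
  qed
  have "\<bar>(\<Sum>i<k. f i) - swap_freq z * k\<bar> \<le> e / 2 * k + (B + \<bar>swap_freq z\<bar>)" for k
  proof (cases "even k")
    case True
    then obtain n where n: "k = 2 * n" by blast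
    show ?thesis using even[of n] by (simp add: n)
  next
    case False
    then obtain n where n: "k = Suc (2 * n)" using oddE by fastforce
    have "f (2 * n) = 0" using subst_odd[of \<tau> n] by (simp add: f_def eq_next_def)
    then have "(\<Sum>i<k. f i) = (\<Sum>i<2 * n. f i)" by (simp add: n)
    moreover have "swap_freq z * k = swap_freq z * (2 * n) + swap_freq z" by (simp add: n distrib_left)
    moreover have "e / 2 * k = e * n + e / 2" by (simp add: n distrib_left)
    ultimately show ?thesis using even[of n] assms(2) by linarith
  qed
  then show ?thesis unfolding near_avg_def f_def by blast
qed

lemma near_avg_subst_iter:
  assumes "near_avg (eq_next \<tau>) z e" "0 \<le> e"
  shows "near_avg (eq_next ((tm_subst ^^ j) \<tau>)) ((swap_freq ^^ j) z) (e / 2 ^ j)"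
proof (induction j)
  case (Suc j)
  from near_avg_subst[OF this] assms(2) show ?case by (simp add: field_simps)
qed (use assms in simp)

text \<open>\<open>swap_freq\<close> is affine with slope \<open>-1/2\<close> and fixed point
  \<open>1/3\<close>.\<close>

lemma swap_freq_iter: "(swap_freq ^^ j) z = 1 / 3 + (z - 1 / 3) * (- 1 / 2) ^ j"
  by (induction j) (simp_all add: swap_freq_def field_simps)

lemma near_avg_const_iter:
  "near_avg (eq_next ((tm_subst ^^ j) (\<lambda>_. b))) ((swap_freq ^^ j) 1) 0"
proof -
  have "eq_next (\<lambda>_. b) = (\<lambda>_. 1)" by (simp add: eq_next_def fun_eq_iff)
  then have "near_avg (eq_next (\<lambda>_. b)) 1 0" using near_avg_const[of 1] by simp
  from near_avg_subst_iter[OF this] show ?thesis by simp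
qed

text \<open>Nothing is known about the innermost \<open>\<tau>'\<close>, but any 0-1 average is
  within 1 of \<open>1/3\<close>, and \<open>k\<close> substitutions shrink this error to
  \<open>1 / 2 ^ k\<close>.\<close>

lemma near_avg_third:
  assumes "\<And>k. \<exists>N \<tau>'. shift N \<tau> = (tm_subst ^^ k) \<tau>'" "0 < e"
  shows "near_avg (eq_next \<tau>) (1 / 3) e"
proof -
  obtain k where k: "1 / e < 2 ^ k" using real_arch_pow[of 2 "1 / e"] by auto
  obtain N \<tau>' where t: "shift N \<tau> = (tm_subst ^^ k) \<tau>'" using assms(1) by blast
  have "\<bar>(\<Sum>i<n. eq_next \<tau>' i) - 1 / 3 * n\<bar> \<le> 1 * n + 0" for n
  proof -
    have "0 \<le> (\<Sum>i<n. eq_next \<tau>' i)" by (intro sum_nonneg) (simp add: eq_next_def)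
    moreover have "(\<Sum>i<n. eq_next \<tau>' i) \<le> (\<Sum>i<n. 1)" by (intro sum_mono) (simp add: eq_next_def)
    ultimately show ?thesis by simp
  qed
  then have "near_avg (eq_next \<tau>') (1 / 3) 1" unfolding near_avg_def by blast
  from near_avg_subst_iter[OF this, of k]
  have "near_avg (eq_next (shift N \<tau>)) (1 / 3) (1 / 2 ^ k)" by (simp add: t swap_freq_iter)
  then have "near_avg (eq_next (shift N \<tau>)) (1 / 3) e"
    using k assms(2) by (elim near_avg_mono) (simp add: field_simps)
  then have "near_avg (shift N (eq_next \<tau>)) (1 / 3) e" by (simp only: shift_eq_next)
  then show ?thesis by (rule near_avg_shift) (use assms(2) in simp)
qed

text \<open>The increments of the floor of \<open>n * \<theta>\<close> are 0 or 1 and their partial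
  sums stay within 1 of \<open>n * \<theta>\<close>; \<open>\<tau>\<close> is built to have equal
  neighbours exactly where the increment is 1.\<close>

lemma exists_seq_with_freq:
  assumes "0 \<le> \<theta>" "\<theta> \<le> 1"
  obtains \<tau> where "near_avg (eq_next \<tau>) \<theta> 0"
proof -
  define a where "a n = \<lfloor>real n * \<theta>\<rfloor>" for n
  have a: "a (Suc n) = a n \<or> a (Suc n) = a n + 1" for n
  proof -
    have "real (Suc n) * \<theta> = real n * \<theta> + \<theta>" by (simp add: algebra_simps)
    with assms show ?thesis unfolding a_def by linarith
  qed
  define \<tau> where "\<tau> = rec_nat False (\<lambda>n b. b = (a (Suc n) = a n + 1))"
  have "\<tau> (Suc n) = (\<tau> n = (a (Suc n) = a n + 1))" for n by (simp add: \<tau>_def)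
  then have e: "eq_next \<tau> n = of_bool (a (Suc n) = a n + 1)" for n by (auto simp: eq_next_def)
  have e: "eq_next \<tau> n = of_int (a (Suc n)) - of_int (a n)" for n
    unfolding e using a[of n] by (elim disjE) simp_all
  have s: "(\<Sum>i<n. eq_next \<tau> i) = of_int (a n)" for n
    by (induction n) (simp_all add: e a_def)
  have "\<bar>(\<Sum>i<n. eq_next \<tau> i) - \<theta> * n\<bar> \<le> 0 * real n + 1" for n
    unfolding s a_def using floor_correct[of "real n * \<theta>"] by (simp add: mult.commute abs_le_iff) linarith
  then have "near_avg (eq_next \<tau>) \<theta> 0" unfolding near_avg_def by blast
  then show thesis by (rule that)
qed

section \<open>Dimensions of intersections\<close>

text \<open>A difference 0 leaves \<open>m + 1\<close> digits and a difference \<open>1\<close> or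
  \<open>-1\<close> leaves \<open>m\<close>; this is the mean logarithm when the proportion of zeros
  is \<open>z\<close>.\<close>

definition dim_of_freq :: "nat \<Rightarrow> real \<Rightarrow> real \<Rightarrow> real" where
  "dim_of_freq m q z = (ln (real m) + (ln (real m + 1) - ln (real m)) * z) / ln q"

definition translation :: "nat \<Rightarrow> real \<Rightarrow> (nat \<Rightarrow> int) \<Rightarrow> real" where
  "translation m q c = val q c - m / (q - 1)"

lemma dim_translation:
  assumes "1 \<le> m" "real m + 1 < q" "unique_crit (2 * int m) q c"
    and "\<And>e. 0 < e \<Longrightarrow> near_avg (\<lambda>i. ln (real_of_int (int m + 1 - \<bar>c i - int m\<bar>))) z e"
  shows "dim_intersection m q (translation m q c) = z / ln q"
proof (rule dim_intersection_eq[OF assms(2)])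
  have "1 < q" using assms by linarith
  with assms(3) show "translation m q c \<in> U_set m q"
    unfolding U_set_altdef[OF \<open>1 < q\<close>] translation_def by blast
  show "is_expansion q {- int m..int m} (\<lambda>i. c i - int m) (translation m q c)"
    using U_set_expansion_iff[OF \<open>1 < q\<close>, of "translation m q c" m "\<lambda>i. c i - int m"] assms(3)
    by (simp add: translation_def)
qed (rule near_avg_imp_limit[OF assms(4)])

lemma dim_eventually_dig:
  assumes "1 \<le> m" "real m + 1 < q" "unique_crit (2 * int m) q c" "shift N c = dig m \<tau>"
    and "\<And>e. 0 < e \<Longrightarrow> near_avg (eq_next \<tau>) z e"
  shows "dim_intersection m q (translation m q c) = dim_of_freq m q z"
  unfolding dim_of_freq_def
proof (rule dim_translation[OF assms(1-3)])
  fix e :: real assume "0 < e"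
  let ?f = "\<lambda>i. ln (real_of_int (int m + 1 - \<bar>c i - int m\<bar>))" and ?b = "ln (real m + 1) - ln (real m)"
  have b: "0 < ?b" using assms(1) by simp
  have f: "shift N ?f = (\<lambda>i. ln (real m) + ?b * eq_next \<tau> i)"
  proof
    fix i
    have "c (N + i) = dig m \<tau> i" using assms(4) by (metis shift_apply)
    then show "shift N ?f i = ln (real m) + ?b * eq_next \<tau> i"
      by (auto simp: dig_def eq_next_def add.commute)
  qed
  have "near_avg (eq_next \<tau>) z (e / ?b)" using \<open>0 < e\<close> b by (intro assms(5)) simp
  from near_avg_affine[OF this, of "ln (real m)" ?b]
  have "near_avg (shift N ?f) (ln (real m) + ?b * z) e" unfolding f using b by simp
  then show "near_avg ?f (ln (real m) + ?b * z) e"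
    by (rule near_avg_shift) (use \<open>0 < e\<close> in simp)
qed

lemma dim_eventually_extreme:
  assumes "1 \<le> m" "real m + 1 < q" "unique_crit (2 * int m) q c"
    and "shift N c = (\<lambda>_. b)" "b = 0 \<or> b = 2 * int m"
  shows "dim_intersection m q (translation m q c) = 0"
proof -
  have "dim_intersection m q (translation m q c) = 0 / ln q"
  proof (rule dim_translation[OF assms(1-3)])
    fix e :: real assume "0 < e"
    let ?f = "\<lambda>i. ln (real_of_int (int m + 1 - \<bar>c i - int m\<bar>))"
    have "shift N ?f i = 0" for i
    proof -
      have "c (N + i) = b" using assms(4) by (metis shift_apply)
      then show ?thesis using assms(5) by auto
    qed
    then have "near_avg (shift N ?f) 0 0" using near_avg_const[of 0] by (simp add: near_avg_def)
    then have "near_avg ?f 0 0" by (rule near_avg_shift) simp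
    then show "near_avg ?f 0 e" using \<open>0 < e\<close> by (elim near_avg_mono) simp
  qed
  then show ?thesis by simp
qed

text \<open>The geometric sum over \<open>1 \<le> i < j\<close> equals minus the frequency of zeros
  after \<open>j\<close> substitutions; for \<open>j = 1\<close> both are 0.\<close>

lemma dim_value_eq:
  assumes "1 \<le> m" "1 \<le> j"
  shows "dim_value m q j = dim_of_freq m q ((swap_freq ^^ j) 1)"
proof -
  have "(\<Sum>i\<in>{1..<Suc k}. (- 1 / 2) ^ i) = - (1 / 3 + 2 / 3 * (- 1 / 2 :: real) ^ Suc k)" for k
    by (induction k) (simp_all add: field_simps)
  from this[of "j - 1"] have "(\<Sum>i\<in>{1..<j}. (- 1 / 2) ^ i) = - ((swap_freq ^^ j) 1)"
    using assms(2) by (simp add: swap_freq_iter)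
  moreover have "ln ((real m + 1) / real m) = ln (real m + 1) - ln (real m)"
    using assms(1) by (simp add: ln_div)
  ultimately show ?thesis
    by (simp add: dim_value_def dim_of_freq_def add_divide_distrib)
qed

lemma dim_of_freq_1: "dim_of_freq m q 1 = ln (real m + 1) / ln q"
  by (simp add: dim_of_freq_def)

lemma dim_of_freq_third:
  assumes "1 \<le> m"
  shows "dim_of_freq m q (1 / 3) = ln ((real m)\<^sup>2 * (real m + 1)) / (3 * ln q)"
proof -
  have "ln ((real m)\<^sup>2 * (real m + 1)) = 2 * ln (real m) + ln (real m + 1)"
    using assms by (simp add: ln_mult ln_realpow)
  then show ?thesis by (simp add: dim_of_freq_def field_simps)
qed

lemma D_set_altdef:
  assumes "1 < q"
  shows "D_set m q = {dim_intersection m q (translation m q c) | c. unique_crit (2 * int m) q c}"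
  unfolding D_set_def U_set_altdef[OF assms] translation_def by blast

section \<open>The words and the bases\<close>

text \<open>Complementing the binary terms reflects the digits, so the second half is the reflected
  first half except at the end: there the next Thue-Morse term, at a power of 2, is
  \<open>True\<close> instead of \<open>False\<close>. This is the effect of
  \<open>plus_word\<close>.\<close>

lemma omega_eq:
  "omega m (Suc k) = map (dig m thue_morse) [0..<2 ^ k]"
proof (induction k)
  case 0
  show ?case using thue_morse_values(1) by (simp add: dig_def)
next
  case (Suc k)
  define L :: nat where "L = 2 ^ k"
  have L: "0 < L" by (simp add: L_def)
  show ?case
  proof (rule nth_equalityI)
    show len: "length (omega m (Suc (Suc k))) = length (map (dig m thue_morse) [0..<2 ^ Suc k])"
      by (simp add: Suc plus_word_def reflect_word_def)
    fix i assume "i < length (omega m (Suc (Suc k)))"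
    then have i: "i < 2 * L" using len by (simp add: L_def)
    let ?u = "map (dig m thue_morse) [0..<L]"
    let ?w = "?u @ reflect_word m ?u"
    have w: "omega m (Suc (Suc k)) = plus_word ?w" using Suc by (simp add: L_def)
    have lw: "length ?w = 2 * L" by (simp add: reflect_word_def)
    have wi: "?w ! i = (if i < L then dig m thue_morse i else 2 * int m - dig m thue_morse (i - L))"
      using i by (auto simp: nth_append reflect_word_def)
    have pw: "plus_word ?w ! i = ?w ! i + of_bool (i = 2 * L - 1)"
    proof (cases "i = 2 * L - 1")
      case True
      have "last ?w = ?w ! (2 * L - 1)" using L lw by (subst last_conv_nth) (auto simp del: length_append)
      then show ?thesis using True lw unfolding plus_word_def
        by (simp only: nth_append length_butlast) simp
    next
      case False
      then have "i < length (butlast ?w)" using i lw by simp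
      then have "plus_word ?w ! i = ?w ! i"
        unfolding plus_word_def using nth_append[of "butlast ?w"] nth_butlast by metis
      then show ?thesis using False by simp
    qed
    have tm: "thue_morse (L + j) = (\<not> thue_morse j)" if "j < L" for j
      using thue_morse_add_exp[of j k] that by (simp add: L_def)
    have tm2: "thue_morse (L + L)" using thue_morse_exp[of "Suc k"] by (simp add: L_def mult_2)
    have tmL: "thue_morse L" by (simp add: L_def)
    have "?w ! i + of_bool (i = 2 * L - 1) = dig m thue_morse i"
    proof (cases "i < L")
      case True
      then show ?thesis using wi L by auto
    next
      case False
      then obtain j where j: "i = L + j" "j < L" using i by (metis le_add_diff_inverse linorder_not_less mult_2 nat_add_left_cancel_less)
      show ?thesis
      proof (cases "Suc j = L")
        case True
        then have "thue_morse (Suc i)" "thue_morse (Suc j)" using tm2 tmL j by (metis add_Suc_right, simp)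
        then show ?thesis using wi tm[of j] j True by (auto simp: dig_def)
      next
        case False
        then have "thue_morse (Suc (L + j)) = (\<not> thue_morse (Suc j))" using tm[of "Suc j"] j by simp
        then show ?thesis using wi tm[of j] j False by (auto simp: dig_def)
      qed
    qed
    then show "omega m (Suc (Suc k)) ! i = map (dig m thue_morse) [0..<2 ^ Suc k] ! i"
      using w pw i by (simp add: L_def)
  qed
qed

lemma dig_period_seq_thue_morse:
  assumes "i < 2 ^ k"
  shows "dig m (period_seq k) i = dig m thue_morse i - of_bool (Suc i = 2 ^ k)"
proof (cases "Suc i = 2 ^ k")
  case True
  then have "\<not> period_seq k (Suc i)" "thue_morse (Suc i)" by (simp_all add: period_seq_eq)
  then show ?thesis using True assms by (simp add: dig_def period_seq_eq)
next
  case False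
  with assms have "Suc i < 2 ^ k" by simp
  then show ?thesis using False assms by (simp add: dig_def period_seq_eq)
qed

lemma shift_dig_period_seq: "shift (2 ^ k) (dig m (period_seq k)) = dig m (period_seq k)"
  using period_seq_period[of k] by (auto simp: dig_def fun_eq_iff simp flip: add_Suc_right)

text \<open>The period is the next word \<open>omega\<close> with its last digit lowered again,
  because the periodic binary sequence returns to \<open>False\<close> where Thue-Morse has
  \<open>True\<close>.\<close>

lemma periodic_seq_omega:
  "periodic_seq (omega m (Suc k) @ reflect_word m (omega m (Suc k))) = dig m (period_seq (Suc k))"
proof
  fix i
  define w where "w = omega m (Suc k) @ reflect_word m (omega m (Suc k))"
  define L :: nat where "L = 2 ^ Suc k"
  have lw: "length w = L" by (simp add: w_def L_def omega_eq reflect_word_def)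
  have p: "plus_word w = map (dig m thue_morse) [0..<L]"
    using omega_eq[of m "Suc k"] by (simp add: w_def L_def)
  have "w ! j = dig m (period_seq (Suc k)) j" if "j < L" for j
  proof (cases "Suc j = L")
    case True
    have "w \<noteq> []" using lw True by auto
    then have "last w = w ! (L - 1)" using lw by (simp add: last_conv_nth)
    also have "L - 1 = j" using True by simp
    finally have "last w = w ! j" .
    moreover have "plus_word w ! j = last w + 1"
      using lw True unfolding plus_word_def by (auto simp: nth_append)
    ultimately show ?thesis using p that dig_period_seq_thue_morse[of j "Suc k" m] True by (simp add: L_def)
  next
    case False
    then have "plus_word w ! j = w ! j"
      using lw that unfolding plus_word_def by (auto simp: nth_append nth_butlast)
    then show ?thesis using p that dig_period_seq_thue_morse[of j "Suc k" m] False by (simp add: L_def)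
  qed
  moreover have "0 < L" by (simp add: L_def)
  ultimately have "periodic_seq w i = dig m (period_seq (Suc k)) (i mod L)"
    by (simp add: periodic_seq_def lw)
  also have "\<dots> = dig m (period_seq (Suc k)) i"
    by (simp add: dig_def period_seq_eq L_def mod_Suc_eq)
  finally show "periodic_seq (omega m (Suc k) @ reflect_word m (omega m (Suc k))) i = dig m (period_seq (Suc k)) i"
    by (simp add: w_def)
qed

lemma dig_pos_infinitely: "1 \<le> m \<Longrightarrow> \<exists>i. 0 < dig m \<tau> (k + i)"
proof -
  assume "1 \<le> m"
  then have "0 < dig m \<tau> (k + 0) \<or> 0 < dig m \<tau> (k + 1)" by (auto simp: dig_def)
  then show ?thesis by blast
qed

lemma period_seq_tails:
  assumes "j \<le> k"
  shows "lexle (shift n (dig m (period_seq j))) (dig m (period_seq k))"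
    and "lexle (compl_seq (2 * int m) (shift n (dig m (period_seq j)))) (dig m (period_seq k))"
proof -
  have "lexle (shift n (dig m (period_seq j))) (dig m (period_seq k)) \<and>
    lexle (compl_seq (2 * int m) (shift n (dig m (period_seq j)))) (dig m (period_seq k))"
  proof (cases "k = 0")
    case True
    then have "shift n (dig m (period_seq j)) = dig m (period_seq k)"
      "compl_seq (2 * int m) (shift n (dig m (period_seq j))) = dig m (period_seq k)"
      using assms by (auto simp: period_seq_0 dig_def fun_eq_iff)
    then show ?thesis by simp
  next
    case False
    have "lexle (ntail (period_seq j) n) (period_seq k)" if "period_seq j n \<noteq> period_seq j (Suc n)"
      using admissibleD[OF admissible_period_seq UNIV_I that] period_seq_mono[OF assms] by (rule lexle_trans)
    then show ?thesis using False period_seq_snd[of k] dig_tail_lexle[of "period_seq k" "period_seq j" n] by auto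
  qed
  then show "lexle (shift n (dig m (period_seq j))) (dig m (period_seq k))"
    and "lexle (compl_seq (2 * int m) (shift n (dig m (period_seq j)))) (dig m (period_seq k))" by auto
qed

section \<open>From lexicographic bounds to uniqueness\<close>

lemma unique_critI:
  assumes "1 < q" "digits_upto M c"
    and "\<And>n. c n < M \<Longrightarrow> val q (shift (Suc n) c) < 1"
    and "\<And>n. 0 < c n \<Longrightarrow> val q (compl_seq M (shift (Suc n) c)) < 1"
  shows "unique_crit M q c"
  using assms by (simp add: unique_crit_def shift_compl)

lemma unique_crit_of_lexle:
  assumes "1 < q" "digits_upto M c" "digits_upto M s" "val q s < 1"
    and "\<And>n. lexle (shift n c) s" "\<And>n. lexle (compl_seq M (shift n c)) s"
  shows "unique_crit M q c"
proof (rule unique_critI[OF assms(1,2)])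
  show "val q (shift (Suc n) c) < 1" for n
    using val_shift_le(1)[OF assms(1-3) _ assms(5), of "Suc n"] assms(4) by linarith
  show "val q (compl_seq M (shift (Suc n) c)) < 1" for n
    using val_shift_le(1)[of q M "compl_seq M c" s "Suc n"] assms by (simp add: shift_compl del: shift_apply)
qed

text \<open>For a bound worth exactly 1, lexicographic strictness replaces the slack in the value.
  It is asked of proper tails only, so that \<open>c\<close> may be \<open>s\<close> itself.\<close>

lemma unique_crit_of_lexlt:
  assumes "1 < q" "digits_upto M c" "digits_upto M s" "val q s = 1" "\<And>k. \<exists>i. 0 < s (k + i)"
    and "\<And>n. lexle (shift n c) s" "\<And>n. lexle (compl_seq M (shift n c)) s"
    and "\<And>n. lexlt (shift (Suc n) c) s" "\<And>n. lexlt (compl_seq M (shift (Suc n) c)) s"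
  shows "unique_crit M q c"
proof (rule unique_critI[OF assms(1,2)])
  show "val q (shift (Suc n) c) < 1" for n
    using val_shift_le(2)[OF assms(1-3) _ assms(6) assms(8) assms(5)] assms(4) by simp
  show "val q (compl_seq M (shift (Suc n) c)) < 1" for n
    using val_shift_le(2)[of q M "compl_seq M c" s "Suc n"] assms by (simp add: shift_compl del: shift_apply)
qed

section \<open>Finite and periodic expansions of 1\<close>

lemma zero_extend_omega:
  "zero_extend (omega m (Suc k)) = (\<lambda>i. if i < 2 ^ k then dig m thue_morse i else 0)"
  by (auto simp: zero_extend_def omega_eq)

lemma shift_dig_period_seq_neq:
  assumes "0 < n" "n < 2 ^ k"
  shows "shift n (dig m (period_seq k)) \<noteq> dig m (period_seq k)"
proof (cases "period_seq k n")
  case True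
  have k: "0 < k" using assms by (cases k) auto
  have "dig m (period_seq k) (n + 0) \<noteq> dig m (period_seq k) 0"
    using True period_seq_snd[OF k] period_seq_hd[of k] by (simp add: dig_def)
  then show ?thesis by (metis shift_apply)
next
  case False
  have "ntail (period_seq k) n = shift n (period_seq k)" using False by (auto simp: ntail_def)
  then have "ntail (period_seq k) n \<noteq> period_seq k" using period_seq_shift_neq[OF assms] by simp
  then have "dig m (ntail (period_seq k) n) \<noteq> dig m (period_seq k)" by (subst dig_eq_iff) auto
  then show ?thesis using False by (simp add: shift_dig)
qed

text \<open>The finite sequence has its last digit raised by one and then zeros, where the periodic
  one starts its next period. The values differ by \<open>1 - val q s\<close> at that place, which
  vanishes exactly when the period is worth 1.\<close>

lemma val_zero_extend_omega:
  assumes "1 \<le> m" "1 < q"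
  shows "val q (zero_extend (omega m (Suc k))) = 1 \<longleftrightarrow> val q (dig m (period_seq k)) = 1"
    and "n < 2 ^ k \<Longrightarrow> val q (dig m (period_seq k)) = 1 \<Longrightarrow>
      val q (shift n (zero_extend (omega m (Suc k)))) = val q (shift n (dig m (period_seq k)))"
proof -
  define w where "w = zero_extend (omega m (Suc k))"
  define s where "s = dig m (period_seq k)"
  define L :: nat where "L = 2 ^ k"
  have wd: "digits_upto (2 * int m) w"
    using digits_upto_dig[OF assms(1), of thue_morse] by (auto simp: w_def zero_extend_omega digits_upto_def)
  have sd: "digits_upto (2 * int m) s" using digits_upto_dig[OF assms(1)] by (simp add: s_def)
  have ws: "w i = s i + of_bool (Suc i = L)" if "i < L" for i
    using that dig_period_seq_thue_morse[of i k m] by (simp add: w_def s_def zero_extend_omega L_def)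
  have "shift L w = (\<lambda>_. 0)" by (auto simp: w_def zero_extend_omega L_def)
  then have wL: "val q (shift L w) = 0" by (simp add: val_def)
  have sL: "shift L s = s" by (simp add: s_def L_def shift_dig_period_seq del: shift_apply)
  have diff: "val q (shift n w) - val q (shift n s) = (1 - val q s) / q ^ (L - n)" if "n < L" for n
  proof -
    define p where "p = L - Suc n"
    have p: "n + Suc p = L" using that by (simp add: p_def)
    have "val q (shift n w) - val q (shift n s) =
      (real_of_int (shift n w p - shift n s p) + val q (shift (Suc p) (shift n w)) - val q (shift (Suc p) (shift n s))) / q ^ Suc p"
      using p ws by (intro val_diff[OF assms(2) digits_upto_shift[OF wd] digits_upto_shift[OF sd]]) auto
    moreover have "shift n w p - shift n s p = 1" using ws[of "n + p"] p by simp
    moreover have "Suc p = L - n" using p by simp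
    ultimately show ?thesis using wL sL p by (simp del: shift_apply add: shift_shift)
  qed
  have "0 < L" by (simp add: L_def)
  have "val q w - val q s = (1 - val q s) / q ^ L" using diff[of 0] \<open>0 < L\<close> by simp
  then have "val q w - 1 = (val q s - 1) * (1 - 1 / q ^ L)"
    by (simp add: right_diff_distrib diff_divide_distrib left_diff_distrib)
  moreover have "1 < q ^ L" using assms(2) \<open>0 < L\<close> by (intro one_less_power) auto
  then have "1 - 1 / q ^ L \<noteq> 0" by simp
  ultimately show "val q (zero_extend (omega m (Suc k))) = 1 \<longleftrightarrow> val q (dig m (period_seq k)) = 1"
    unfolding w_def s_def by (metis eq_iff_diff_eq_0 mult_eq_0_iff)
  show "val q (shift n (zero_extend (omega m (Suc k)))) = val q (shift n (dig m (period_seq k)))"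
    if "n < 2 ^ k" "val q (dig m (period_seq k)) = 1"
    using diff[of n] that unfolding w_def s_def L_def by simp
qed

text \<open>An expansion is greedy once all its proper tails are worth less than 1. Within the word
  this follows from the periodic sequence, whose shifts by less than a period are strictly
  smaller.\<close>

lemma greedy_omega_iff:
  assumes "1 \<le> m" "1 < q"
  shows "is_greedy_expansion q {0..2 * int m} (zero_extend (omega m (Suc k))) 1 \<longleftrightarrow>
    val q (dig m (period_seq k)) = 1"
proof -
  define w where "w = zero_extend (omega m (Suc k))"
  define s where "s = dig m (period_seq k)"
  have wd: "digits_upto (2 * int m) w"
    using digits_upto_dig[OF assms(1), of thue_morse] by (auto simp: w_def zero_extend_omega digits_upto_def)
  have sd: "digits_upto (2 * int m) s" using digits_upto_dig[OF assms(1)] by (simp add: s_def)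
  have "is_greedy_expansion q {0..2 * int m} w 1" if 1: "val q s = 1"
  proof -
    have v: "val q (shift (Suc n) w) < 1" for n
    proof (cases "Suc n < 2 ^ k")
      case True
      have "lexle (shift (Suc n) s) s" unfolding s_def using period_seq_tails(1)[of k k] by simp
      then have "lexlt (shift (Suc n) s) s"
        using shift_dig_period_seq_neq[of "Suc n" k m] True by (simp add: lexle_def s_def)
      then have "val q (shift (Suc n) s) < 1"
        using val_shift_le(2)[OF assms(2) sd sd, of "Suc n"] 1 period_seq_tails(1)[of k k] dig_pos_infinitely[OF assms(1)]
        by (auto simp: s_def)
      then show ?thesis using val_zero_extend_omega(2)[OF assms True] 1 by (simp add: w_def s_def)
    next
      case False
      then have "shift (Suc n) w = (\<lambda>_. 0)" by (auto simp: w_def zero_extend_omega)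
      then show ?thesis by (simp add: val_def)
    qed
    have w1: "val q w = 1" using val_zero_extend_omega(1)[OF assms] 1 by (simp add: w_def s_def)
    have "d = w \<or> lexlt d w" if d: "digits_upto (2 * int m) d" "val q d = 1" for d
    proof (rule ccontr)
      assume "\<not> ?thesis"
      then obtain p where p: "\<And>i. i < p \<Longrightarrow> d i = w i" "w p < d p"
        using lexlt_linear[of d w] by (metis lexltE)
      have "real_of_int (d p - w p) \<ge> 1" using p(2) by linarith
      moreover have "0 \<le> val q (shift (Suc p) d)"
        using val_nonneg[OF assms(2) digits_upto_shift[OF d(1)]] .
      ultimately have "0 < (real_of_int (d p - w p) + val q (shift (Suc p) d) - val q (shift (Suc p) w)) / q ^ Suc p"
        using v[of p] assms(2) by (intro divide_pos_pos) auto
      moreover have "val q d - val q w = (real_of_int (d p - w p) + val q (shift (Suc p) d) - val q (shift (Suc p) w)) / q ^ Suc p"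
        using assms(2) d(1) wd p(1) by (rule val_diff)
      ultimately show False using d(2) w1 by linarith
    qed
    then show ?thesis
      unfolding is_greedy_expansion_def is_expansion_iff[OF assms(2)] lex_less_eq_lexlt using wd w1 by blast
  qed
  moreover have "val q s = 1" if "is_greedy_expansion q {0..2 * int m} w 1"
    using that val_zero_extend_omega(1)[OF assms]
    by (auto simp: is_greedy_expansion_def is_expansion_iff[OF assms(2)] w_def s_def)
  ultimately show ?thesis unfolding w_def s_def by blast
qed

lemma q_base_props:
  assumes "1 \<le> m"
  shows "1 < q_base m (Suc k)" "val (q_base m (Suc k)) (dig m (period_seq k)) = 1"
proof -
  define w where "w = zero_extend (omega m (Suc k))"
  have wd: "digits_upto (2 * int m) w" "w 0 = int m + 1"
    using digits_upto_dig[OF assms(1), of thue_morse]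
    by (auto simp: w_def zero_extend_omega digits_upto_def dig_thue_morse_values)
  obtain p where p: "1 < p" "val p w = 1" using val_eq_1_exists[OF assms wd] by metis
  have sp: "val p (dig m (period_seq k)) = 1"
    using val_zero_extend_omega(1)[OF assms p(1)] p(2) by (simp add: w_def)
  have "q_base m (Suc k) = p"
    unfolding q_base_def
  proof (rule the_equality)
    show "1 < p \<and> is_greedy_expansion p {0..2 * int m} (zero_extend (omega m (Suc k))) 1"
      using p(1) sp greedy_omega_iff[OF assms] by blast
    fix q assume "1 < q \<and> is_greedy_expansion q {0..2 * int m} (zero_extend (omega m (Suc k))) 1"
    then have q: "1 < q" "val q (dig m (period_seq k)) = 1" using greedy_omega_iff[OF assms] by blast+
    show "q = p"
      using val_base_less[OF p(1) _ digits_upto_dig[OF assms], of q "period_seq k"] val_base_less[OF q(1) _ digits_upto_dig[OF assms], of p "period_seq k"]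
        sp q(2) by (cases p q rule: linorder_cases) auto
  qed
  then show "1 < q_base m (Suc k)" "val (q_base m (Suc k)) (dig m (period_seq k)) = 1"
    using p sp by auto
qed

section \<open>The Komornik--Loreti constant\<close>

lemma dig_thue_morse_tails:
  shows "0 < n \<Longrightarrow> lexlt (shift n (dig m thue_morse)) (dig m thue_morse)"
    and "lexlt (compl_seq (2 * int m) (shift n (dig m thue_morse))) (dig m thue_morse)"
    and "lexle (shift n (dig m thue_morse)) (dig m thue_morse)"
proof -
  have adm: "lexlt (ntail thue_morse n) thue_morse" if "0 < n" "thue_morse n \<noteq> thue_morse (Suc n)"
    using admissibleD[OF admissible_thue_morse _ that(2)] that(1) by simp
  show 1: "lexlt (shift n (dig m thue_morse)) (dig m thue_morse)" if "0 < n"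
    using dig_tail_lexlt(1)[OF thue_morse_0 thue_morse_values(1) adm[OF that]] .
  show "lexlt (compl_seq (2 * int m) (shift n (dig m thue_morse))) (dig m thue_morse)"
  proof (cases "n = 0")
    case True
    then show ?thesis
      by (intro lexltI[where n = 0]) (simp_all add: dig_thue_morse_values)
  next
    case False
    then show ?thesis using dig_tail_lexlt(2)[OF thue_morse_0 thue_morse_values(1) adm] by simp
  qed
  show "lexle (shift n (dig m thue_morse)) (dig m thue_morse)"
    using 1 by (cases "n = 0") (auto intro: lexlt_imp_lexle)
qed

lemma unique_crit_thue_morse:
  assumes "1 \<le> m" "1 < q" "val q (dig m thue_morse) = 1"
  shows "unique_crit (2 * int m) q (dig m thue_morse)"
  by (rule unique_crit_of_lexlt[OF assms(2) digits_upto_dig digits_upto_dig assms(3)])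
     (use assms(1) in \<open>auto intro: dig_thue_morse_tails lexlt_imp_lexle dig_pos_infinitely simp del: shift_apply\<close>)

lemma unique_crit_period_seq:
  assumes "1 \<le> m" "1 < q" "val q (dig m thue_morse) = 1"
  shows "unique_crit (2 * int m) q (dig m (period_seq j))"
proof -
  have "lexlt (dig m (period_seq j)) (dig m thue_morse)"
    using period_seq_lexlt_thue_morse by (subst dig_lexlt_iff) auto
  then have "lexlt (shift n (dig m (period_seq j))) (dig m thue_morse)"
    "lexlt (compl_seq (2 * int m) (shift n (dig m (period_seq j)))) (dig m thue_morse)" for n
    using period_seq_tails[of j j] lexle_lexlt_trans by blast+
  then show ?thesis
    using assms
    by (intro unique_crit_of_lexlt[OF assms(2) digits_upto_dig digits_upto_dig assms(3)])
      (auto intro: lexlt_imp_lexle dig_pos_infinitely simp del: shift_apply)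
qed

text \<open>
  If \<open>1\<close> had a unique expansion \<open>d\<close> in a base \<open>y < q\<close>, then \<open>d\<close> would dominate all its shifts and
  their complements, while being smaller than the Thue--Morse expansion of \<open>1\<close> in base \<open>q\<close>.
\<close>

lemma no_smaller_univoque_base:
  assumes m: "1 \<le> m" and q: "q \<le> 2 * real m + 1" "val q (dig m thue_morse) = 1"
    and y: "1 < y" "y < q"
  shows "\<not> has_unique_expansion y {0..2 * int m} 1"
proof
  define M where "M = 2 * int m"
  define s where "s = dig m thue_morse"
  assume "has_unique_expansion y {0..2 * int m} 1"
  then obtain d where d: "unique_crit M y d" "val y d = 1"
    unfolding has_unique_expansion_iff[OF y(1)] M_def by blast
  note dd = unique_crit_digits[OF d(1)]
  have yM: "y < of_int M + 1" using y(2) q(1) by (simp add: M_def)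
  have q1: "1 < q" using y by simp
  have sd: "digits_upto M s" unfolding s_def M_def using m by (rule digits_upto_dig)
  \<comment> \<open>Behind a digit \<open>M\<close> the criterion is silent, but
    \<open>y < M + 1\<close> leaves less than 1 for the tail of something worth at most 1. This
    extends the bounds to all positions.\<close>
  have next_digit: "val y (shift (Suc n) c) < 1" if "digits_upto M c" "val y (shift n c) \<le> 1" "c n = M" for n c
  proof -
    have "val y (shift n c) = (M + val y (shift (Suc n) c)) / y"
      using val_step[OF y(1) digits_upto_shift[OF that(1)], of n] that(3) by (simp del: shift_apply add: shift_apply[of n c 0])
    then have "M + val y (shift (Suc n) c) \<le> y" using that(2) y(1) by (simp add: divide_le_eq)
    then show ?thesis using yM by linarith
  qed
  have v: "val y (shift (Suc n) d) < 1" for n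
  proof (induction n)
    case 0
    show ?case
      using next_digit[OF dd, of 0] d dd by (cases "d 0 < M") (auto simp: unique_crit_def digits_upto_def antisym_conv2 not_less order_antisym simp del: shift_apply)
  next
    case (Suc n)
    then show ?case
      using next_digit[OF dd, of "Suc n"] d dd by (cases "d (Suc n) < M") (auto simp: unique_crit_def digits_upto_def not_less order_antisym simp del: shift_apply)
  qed
  have d0: "0 < d 0"
  proof (rule ccontr)
    assume "\<not> 0 < d 0"
    with dd have "d 0 = 0" by (simp add: digits_upto_def order_antisym)
    then have "val y (shift (Suc 0) d) = y" using val_step[OF y(1) dd] d(2) y(1) by simp
    then show False using v[of 0] y(1) by simp
  qed
  have vc: "val y (shift (Suc n) (compl_seq M d)) < 1" for n
  proof (induction n)
    case 0
    show ?case using d(1) d0 unfolding unique_crit_def by blast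
  next
    case (Suc n)
    show ?case
    proof (cases "0 < d (Suc n)")
      case True
      then show ?thesis using d(1) unfolding unique_crit_def by blast
    next
      case False
      with dd have "compl_seq M d (Suc n) = M" by (simp add: digits_upto_def order_antisym not_less)
      then show ?thesis
        using next_digit[of "compl_seq M d" "Suc n"] dd Suc by (simp del: shift_apply compl_seq_apply)
    qed
  qed
  have s1: "val q (shift n s) \<le> 1" for n
    unfolding s_def using q sd dig_thue_morse_tails(3)
    by (intro val_shift_le_1[OF q1, of M]) (auto simp: s_def simp del: shift_apply)
  have ds: "lexlt d s"
  proof (rule val_less_imp_lexlt[OF q1 dd sd])
    show "val q d < val q s" using val_base_less[OF y dd] d(2) q(2) by (simp add: s_def)
  qed (rule s1)
  have dn: "lexlt (shift (Suc n) d) d" for n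
    using v d dd by (intro val_less_imp_lexlt[OF y(1)]) (auto intro: less_imp_le simp del: shift_apply)
  have dnc: "lexlt (compl_seq M (shift (Suc n) d)) d" for n
    using v vc[of n] d dd
    by (intro val_less_imp_lexlt[OF y(1)]) (auto intro: less_imp_le simp: shift_compl simp del: shift_apply)
  \<comment> \<open>A leading digit at most \<open>m\<close> would bound all later digits by
    \<open>m\<close> from both sides; then \<open>d\<close> is constant, against
    \<open>dn\<close>.\<close>
  have d0m: "d 0 = int m + 1"
  proof (rule ccontr)
    assume "d 0 \<noteq> int m + 1"
    then have le: "d 0 \<le> int m"
      using lexle_hd[OF lexlt_imp_lexle[OF ds]] by (simp add: s_def dig_thue_morse_values)
    have *: "d (Suc n) = int m \<and> d 0 = int m" for n
      using lexle_hd[OF lexlt_imp_lexle[OF dn[of n]]] lexle_hd[OF lexlt_imp_lexle[OF dnc[of n]]] le by (simp add: M_def)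
    have "d n = int m" for n using * by (cases n) auto
    then have "shift (Suc 0) d = d" by (auto simp: fun_eq_iff)
    then show False using dn[of 0] by simp
  qed
  have "lexle (shift n d) s" for n
    using ds dn lexlt_trans by (cases n) (auto intro!: lexlt_imp_lexle simp del: shift_apply)
  moreover have "lexle (compl_seq M (shift n d)) s" for n
  proof (cases n)
    case 0
    have "lexlt (compl_seq M d) s"
      by (rule lexltI[where n = 0]) (auto simp: d0m s_def M_def dig_thue_morse_values)
    then show ?thesis using 0 by (simp add: lexlt_imp_lexle)
  next
    case (Suc k)
    then show ?thesis using ds dnc[of k] lexlt_trans lexlt_imp_lexle by blast
  qed
  ultimately obtain \<tau> where \<tau>: "d = dig m \<tau>"
    using bounded_imp_dig[of d m] d0m by (auto simp: s_def M_def)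
  have t0: "\<not> \<tau> 0" "\<tau> (Suc 0)" using d0m by (auto simp: \<tau> dig_def of_bool_def split: if_splits)
  have "admissible lexlt {0<..} \<tau> \<tau>"
  proof (rule admissibleI)
    fix n assume n: "n \<in> {0<..}" "\<tau> n \<noteq> \<tau> (Suc n)"
    then obtain k where k: "n = Suc k" by (cases n) auto
    have "lexlt (dig m (ntail \<tau> n)) (dig m \<tau>)"
      using dn[of k] dnc[of k] shift_dig[of \<tau> n m] shift_dig_compl[of \<tau> n m]
      by (cases "\<tau> n") (auto simp: k \<tau> M_def simp del: shift_apply)
    then show "lexlt (ntail \<tau> n) \<tau>" using t0 by (subst (asm) dig_lexlt_iff) auto
  qed
  moreover have "lexlt \<tau> thue_morse"
    using ds t0 unfolding \<tau> s_def by (subst (asm) dig_lexlt_iff) auto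
  ultimately show False
    using self_admissible_eq_thue_morse[OF t0] lexlt_imp_lexle lexlt_irrefl by blast
qed

lemma q_KL_props:
  assumes "1 \<le> m"
  shows "1 < q_KL m" "val (q_KL m) (dig m thue_morse) = 1"
proof -
  obtain q where q: "1 < q" "q \<le> 2 * real m + 1" "val q (dig m thue_morse) = 1"
    using val_eq_1_exists[OF assms digits_upto_dig[OF assms]] dig_thue_morse_values(1) by metis
  have "q_KL m = q"
    unfolding q_KL_def
  proof (rule Least_equality)
    show "1 < q \<and> has_unique_expansion q {0..2 * int m} 1"
      using has_unique_expansion_iff[OF q(1)] unique_crit_thue_morse[OF assms q(1,3)] q by blast
    fix y assume "1 < y \<and> has_unique_expansion y {0..2 * int m} 1"
    then show "q \<le> y" using no_smaller_univoque_base[OF assms q(2,3), of y] by force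
  qed
  with q show "1 < q_KL m" "val (q_KL m) (dig m thue_morse) = 1" by auto
qed

section \<open>The dimensions up to the Komornik--Loreti constant\<close>

text \<open>The constant digit \<open>m\<close>, that is the translation 0, can be unique only if
  its tail value \<open>m / (q - 1)\<close> is below 1. All three cases of the theorem obtain
  \<open>q > m + 1\<close> this way.\<close>

lemma base_gt_of_unique_crit_zero:
  assumes "1 \<le> m" "1 < q" "unique_crit (2 * int m) q (dig m (period_seq 0))"
  shows "real m + 1 < q"
proof -
  have c: "dig m (period_seq 0) = (\<lambda>_. int m)" by (auto simp: dig_def period_seq_0)
  have "val q (shift (Suc 0) (\<lambda>_. int m)) < 1" using assms unfolding c unique_crit_def by simp
  moreover have "shift (Suc 0) (\<lambda>_. int m) = (\<lambda>_. int m)" by (simp add: shift_def)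
  ultimately have "real m / (q - 1) < 1" using val_const[OF assms(2), of "int m"] by simp
  then show ?thesis using assms(2) by (simp add: divide_less_eq)
qed

text \<open>Unless \<open>c\<close> is constantly 0 or \<open>2 m\<close>, it has a digit below
  \<open>2 m\<close> and a positive one; beyond both, the strict bounds hold for the tails and their
  reflections.\<close>

lemma unique_crit_structure:
  assumes m: "1 \<le> m" and q: "1 < q" "val q (dig m T) = 1"
    and T: "\<not> T 0" "T (Suc 0)" "admissible lexle UNIV T T" "lexle T thue_morse"
    and c: "unique_crit (2 * int m) q c"
  obtains N b where "b = 0 \<or> b = 2 * int m" "shift N c = (\<lambda>_. b)"
    | N \<tau> where "shift N c = dig m \<tau>" "admissible lexlt UNIV T \<tau>"
proof -
  define M where "M = 2 * int m"
  note cd = unique_crit_digits[OF c]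
  consider "\<forall>n. c n = M" | "\<forall>n. c n = 0" | k1 k2 where "c k1 < M" "0 < c k2"
    using cd unfolding digits_upto_def M_def by (metis order_le_less)
  then show thesis
  proof cases
    case 1
    then have "shift 0 c = (\<lambda>_. 2 * int m)" by (auto simp: M_def)
    then show thesis by (rule that(1)[rotated]) simp
  next
    case 2
    then have "shift 0 c = (\<lambda>_. 0)" by auto
    then show thesis by (rule that(1)[rotated]) simp
  next
    case 3
    let ?s = "dig m T"
    have sd: "digits_upto M ?s" unfolding M_def using m by (rule digits_upto_dig)
    have ss: "lexle (shift n ?s) ?s" for n
      using dig_tail_lexle(1)[OF T(1,2)] T(3) by (simp add: admissible_def del: shift_apply)
    have u: "lexlt (shift n c) ?s" if "k1 < n" for n
      using unique_crit_lexlt[OF q(1) c[folded M_def] sd q(2) ss 3(1) that] .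
    have l: "lexlt (compl_seq M (shift n c)) ?s" if "k2 < n" for n
      using unique_crit_lexlt[OF q(1) _ sd q(2) ss _ that, of "compl_seq M c"] 3(2) c
      by (simp add: unique_crit_compl M_def shift_compl del: shift_apply)
    define K where "K = Suc (max k1 k2)"
    \<comment> \<open>An eventual digit \<open>m\<close> is set apart because
      \<open>bounded_imp_dig\<close> must start at a digit different from \<open>m\<close>.\<close>
    show thesis
    proof (cases "\<forall>n. c (K + n) = int m")
      case True
      then have "shift K c = dig m (\<lambda>_. False)" by (auto simp: dig_def)
      moreover have "admissible lexlt UNIV T (\<lambda>_. False)" by (simp add: admissible_def)
      ultimately show thesis by (rule that(2))
    next
      case False
      then obtain i where i: "c (K + i) \<noteq> int m" by blast
      define N where "N = K + i"
      have sT: "lexle ?s (dig m thue_morse)"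
        using T(1,4) dig_lexlt_iff[of T thue_morse m] by (auto simp: lexle_def)
      have u': "lexlt (shift n (shift N c)) ?s" for n using u[of "N + n"] by (simp add: N_def K_def del: shift_apply)
      have l': "lexlt (compl_seq M (shift n (shift N c))) ?s" for n
        using l[of "N + n"] by (simp add: N_def K_def del: shift_apply)
      obtain \<tau> where \<tau>: "shift N c = dig m \<tau>"
      proof (rule bounded_imp_dig[of "shift N c" m])
        show "lexle (shift n (shift N c)) (dig m thue_morse)" for n
          using lexlt_lexle_trans[OF u' sT] by (rule lexlt_imp_lexle)
        show "lexle (compl_seq (2 * int m) (shift n (shift N c))) (dig m thue_morse)" for n
          using lexlt_lexle_trans[OF l' sT] unfolding M_def by (rule lexlt_imp_lexle)
        show "shift N c 0 \<noteq> int m" using i by (simp add: N_def)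
      qed
      have "admissible lexlt UNIV T \<tau>"
        using u' l' T(1) unfolding \<tau> M_def by (rule dig_bounded_imp_admissible)
      with \<tau> show thesis by (rule that(2))
    qed
  qed
qed

lemma dim_extreme:
  assumes "1 \<le> m" "real m + 1 < q"
  shows "unique_crit (2 * int m) q (\<lambda>_. 2 * int m)"
    and "dim_intersection m q (translation m q (\<lambda>_. 2 * int m)) = 0"
proof -
  have z: "val q (shift n (compl_seq (2 * int m) (\<lambda>_. 2 * int m))) = 0" for n
    by (simp add: val_def)
  show u: "unique_crit (2 * int m) q (\<lambda>_. 2 * int m)"
    unfolding unique_crit_def z by (simp add: digits_upto_def)
  show "dim_intersection m q (translation m q (\<lambda>_. 2 * int m)) = 0"
    using dim_eventually_extreme[OF assms u, of 0] by simp
qed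

lemma dim_iter:
  assumes "1 \<le> m" "real m + 1 < q" "unique_crit (2 * int m) q c" "shift N c = dig m \<tau>"
    and "shift N' \<tau> = (tm_subst ^^ j) (\<lambda>_. b)"
  shows "dim_intersection m q (translation m q c) = dim_of_freq m q ((swap_freq ^^ j) 1)"
proof (rule dim_eventually_dig[OF assms(1-4)])
  fix e :: real assume "0 < e"
  have "near_avg (shift N' (eq_next \<tau>)) ((swap_freq ^^ j) 1) 0"
    using near_avg_const_iter[of j b] by (simp only: shift_eq_next assms(5))
  then have "near_avg (eq_next \<tau>) ((swap_freq ^^ j) 1) 0" by (rule near_avg_shift) simp
  then show "near_avg (eq_next \<tau>) ((swap_freq ^^ j) 1) e"
    using \<open>0 < e\<close> by (elim near_avg_mono) simp
qed

lemma dim_period_seq: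
  assumes "1 \<le> m" "real m + 1 < q" "unique_crit (2 * int m) q c" "shift N c = dig m (period_seq j)"
  shows "dim_intersection m q (translation m q c) = dim_of_freq m q ((swap_freq ^^ j) 1)"
  by (rule dim_iter[OF assms, where N' = 0 and b = False]) (simp add: period_seq_def)

text \<open>Index 0 is separated since \<open>dim_value m q 0\<close> is an empty sum, like the
  value at 1, and not the dimension for frequency 1.\<close>

lemma dim_of_freq_iter_range:
  assumes "1 \<le> m"
  shows "{dim_of_freq m q ((swap_freq ^^ j) 1) | j. P j} =
    (if P 0 then {ln (real m + 1) / ln q} else {}) \<union> {dim_value m q j | j. 1 \<le> j \<and> P j}"
proof (intro equalityI subsetI)
  fix x assume "x \<in> {dim_of_freq m q ((swap_freq ^^ j) 1) | j. P j}"
  then obtain j where j: "P j" "x = dim_of_freq m q ((swap_freq ^^ j) 1)" by blast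
  show "x \<in> (if P 0 then {ln (real m + 1) / ln q} else {}) \<union> {dim_value m q j | j. 1 \<le> j \<and> P j}"
  proof (cases "j = 0")
    case True
    then show ?thesis using j dim_of_freq_1[of m q] by simp
  next
    case False
    then have "1 \<le> j" by simp
    then have "x = dim_value m q j" using j(2) dim_value_eq[OF assms, of j q] by simp
    then show ?thesis using j(1) \<open>1 \<le> j\<close> by blast
  qed
next
  fix x assume x: "x \<in> (if P 0 then {ln (real m + 1) / ln q} else {}) \<union> {dim_value m q j | j. 1 \<le> j \<and> P j}"
  then consider "P 0" "x = ln (real m + 1) / ln q" | j where "1 \<le> j" "P j" "x = dim_value m q j"
    by (auto split: if_splits)
  then show "x \<in> {dim_of_freq m q ((swap_freq ^^ j) 1) | j. P j}"
  proof cases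
    case 1
    then have "x = dim_of_freq m q ((swap_freq ^^ 0) 1)" using dim_of_freq_1[of m q] by simp
    with 1 show ?thesis by blast
  next
    case 2
    then show ?thesis using dim_value_eq[OF assms 2(1), of q] by auto
  qed
qed

text \<open>The extra value compared with smaller bases comes from sequences that can be
  desubstituted for ever; Thue-Morse itself realizes it.\<close>

lemma D_set_q_KL:
  assumes m: "1 \<le> m"
  shows "D_set m (q_KL m) = {0, dim_of_freq m (q_KL m) (1 / 3)} \<union>
    {dim_of_freq m (q_KL m) ((swap_freq ^^ j) 1) | j. True}"
proof -
  define q where "q = q_KL m"
  have q: "1 < q" "val q (dig m thue_morse) = 1" using q_KL_props[OF m] by (simp_all add: q_def)
  note per = unique_crit_period_seq[OF m q]
  have qm: "real m + 1 < q" using base_gt_of_unique_crit_zero[OF m q(1) per] .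
  have adm: "admissible lexle UNIV thue_morse thue_morse"
  proof (rule admissibleI)
    fix n assume "thue_morse n \<noteq> thue_morse (Suc n)"
    then show "lexle (ntail thue_morse n) thue_morse"
      using admissible_thue_morse by (cases "n = 0") (auto simp: ntail_eq_self dest!: admissibleD intro: lexlt_imp_lexle)
  qed
  have third: "dim_intersection m q (translation m q c) = dim_of_freq m q (1 / 3)"
    if "unique_crit (2 * int m) q c" "shift N c = dig m \<tau>" "\<And>k. \<exists>N \<tau>'. shift N \<tau> = (tm_subst ^^ k) \<tau>'" for c N \<tau>
    using dim_eventually_dig[OF m qm that(1,2)] near_avg_third[OF that(3)] by blast
  have "D_set m q \<subseteq> {0, dim_of_freq m q (1 / 3)} \<union> {dim_of_freq m q ((swap_freq ^^ j) 1) | j. True}"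
  proof
    fix x assume "x \<in> D_set m q"
    then obtain c where c: "unique_crit (2 * int m) q c" "x = dim_intersection m q (translation m q c)"
      unfolding D_set_altdef[OF q(1)] by blast
    from unique_crit_structure[OF m q thue_morse_0 thue_morse_values(1) adm lexle_refl c(1)]
    show "x \<in> {0, dim_of_freq m q (1 / 3)} \<union> {dim_of_freq m q ((swap_freq ^^ j) 1) | j. True}"
    proof cases
      case (1 N b)
      then show ?thesis using dim_eventually_extreme[OF m qm c(1)] c(2) by blast
    next
      case (2 N \<tau>)
      show ?thesis
      proof (cases "\<exists>N j b. shift N \<tau> = (tm_subst ^^ j) (\<lambda>_. b)")
        case True
        then show ?thesis using dim_iter[OF m qm c(1) 2(1)] c(2) by blast
      next
        case False
        then have "\<exists>N \<tau>'. shift N \<tau> = (tm_subst ^^ k) \<tau>'" for k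
          using admissible_thue_morse_imp[OF 2(2), of k] by blast
        then show ?thesis using third[OF c(1) 2(1)] c(2) by blast
      qed
    qed
  qed
  moreover have "0 \<in> D_set m q"
    unfolding D_set_altdef[OF q(1)] using dim_extreme[OF m qm] by (metis (mono_tags, lifting) mem_Collect_eq)
  moreover have "dim_of_freq m q (1 / 3) \<in> D_set m q"
  proof -
    have "(tm_subst ^^ k) thue_morse = thue_morse" for k by (induction k) (simp_all add: subst_thue_morse)
    then have "\<exists>N \<tau>'. shift N thue_morse = (tm_subst ^^ k) \<tau>'" for k by (metis shift_0)
    then have "dim_intersection m q (translation m q (dig m thue_morse)) = dim_of_freq m q (1 / 3)"
      using unique_crit_thue_morse[OF m q] by (intro third[of _ 0]) auto
    then show ?thesis unfolding D_set_altdef[OF q(1)] using unique_crit_thue_morse[OF m q] by force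
  qed
  moreover have "dim_of_freq m q ((swap_freq ^^ j) 1) \<in> D_set m q" for j
  proof -
    have "dim_intersection m q (translation m q (dig m (period_seq j))) = dim_of_freq m q ((swap_freq ^^ j) 1)"
      by (rule dim_period_seq[OF m qm per, where N = 0]) simp
    then show ?thesis unfolding D_set_altdef[OF q(1)] using per[of j] by force
  qed
  ultimately show ?thesis unfolding q_def by blast
qed

text \<open>In the base \<open>q_base m (Suc k)\<close> these tails are worth at most 1, so any
  larger base gives the strict bound.\<close>

lemma unique_crit_period_seq_base:
  assumes "1 \<le> m" "q_base m (Suc k) < q" "j \<le> k"
  shows "unique_crit (2 * int m) q (dig m (period_seq j))"
proof (rule unique_critI)
  let ?p = "q_base m (Suc k)" and ?M = "2 * int m"
  note p = q_base_props[OF assms(1), of k]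
  show "1 < q" using p(1) assms(2) by simp
  have d: "digits_upto ?M (dig m (period_seq i))" for i using assms(1) by (rule digits_upto_dig)
  show "digits_upto ?M (dig m (period_seq j))" by (rule d)
  note tails = period_seq_tails[OF assms(3), where m = m]
  fix n
  have "val ?p (shift (Suc n) (dig m (period_seq j))) \<le> 1"
    using val_shift_le_1[OF p(1) d d _ tails(1)] p(2) by simp
  then show "val q (shift (Suc n) (dig m (period_seq j))) < 1"
    by (rule val_base_less[OF p(1) assms(2) digits_upto_shift[OF d]])
  have "val ?p (shift (Suc n) (compl_seq ?M (dig m (period_seq j)))) \<le> 1"
    using val_shift_le_1[OF p(1) _ d, of "compl_seq ?M (dig m (period_seq j))" k "Suc n"] d tails(2) p(2)
    by (simp add: shift_compl del: shift_apply)
  then show "val q (compl_seq ?M (shift (Suc n) (dig m (period_seq j)))) < 1"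
    unfolding shift_compl using d
    by (intro val_base_less[OF p(1) assms(2), of ?M]) (auto simp del: shift_apply)
qed

text \<open>The two ends play different roles: the lower base makes the listed sequences unique, and
  the criterion carried up to the upper base excludes all other behaviour.\<close>

lemma D_set_between:
  assumes m: "1 \<le> m" and q: "q_base m (Suc k) < q" "q \<le> q_base m (Suc (Suc k))"
  shows "real m + 1 < q"
    and "D_set m q = {0} \<union> {dim_of_freq m q ((swap_freq ^^ j) 1) | j. j \<le> k}"
proof -
  have q1: "1 < q" using q_base_props(1)[OF m, of k] q(1) by simp
  note per = unique_crit_period_seq_base[OF m q(1)]
  show qm: "real m + 1 < q" using base_gt_of_unique_crit_zero[OF m q1 per] by simp
  let ?p = "q_base m (Suc (Suc k))" and ?T = "period_seq (Suc k)"
  note p = q_base_props[OF m, of "Suc k"]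
  have T1: "?T (Suc 0)" by (rule period_seq_snd) simp
  have "D_set m q \<subseteq> {0} \<union> {dim_of_freq m q ((swap_freq ^^ j) 1) | j. j \<le> k}"
  proof
    fix x assume "x \<in> D_set m q"
    then obtain c where c: "unique_crit (2 * int m) q c" "x = dim_intersection m q (translation m q c)"
      unfolding D_set_altdef[OF q1] by blast
    from unique_crit_structure[OF m p period_seq_hd T1 admissible_period_seq
        lexlt_imp_lexle[OF period_seq_lexlt_thue_morse] unique_crit_mono[OF c(1) q1 q(2)]]
    show "x \<in> {0} \<union> {dim_of_freq m q ((swap_freq ^^ j) 1) | j. j \<le> k}"
    proof cases
      case (1 N b)
      then show ?thesis using dim_eventually_extreme[OF m qm c(1)] c(2) by blast
    next
      case (2 N \<tau>)
      then show ?thesis using admissible_period_seq_imp[OF 2(2)] dim_iter[OF m qm c(1) 2(1)] c(2) by blast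
    qed
  qed
  moreover have "0 \<in> D_set m q"
    unfolding D_set_altdef[OF q1] using dim_extreme[OF m qm] by (metis (mono_tags, lifting) mem_Collect_eq)
  moreover have "dim_of_freq m q ((swap_freq ^^ j) 1) \<in> D_set m q" if "j \<le> k" for j
  proof -
    have "dim_intersection m q (translation m q (dig m (period_seq j))) = dim_of_freq m q ((swap_freq ^^ j) 1)"
      by (rule dim_period_seq[OF m qm per[OF that], where N = 0]) simp
    then show ?thesis unfolding D_set_altdef[OF q1] using per[OF that] by force
  qed
  ultimately show "D_set m q = {0} \<union> {dim_of_freq m q ((swap_freq ^^ j) 1) | j. j \<le> k}" by blast
qed

section \<open>Intervals of dimensions above the Komornik--Loreti constant\<close>

definition lexlt_or_prefix :: "nat \<Rightarrow> (nat \<Rightarrow> bool) \<Rightarrow> (nat \<Rightarrow> bool) \<Rightarrow> bool" where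
  "lexlt_or_prefix N x y \<longleftrightarrow> lexlt x y \<or> (\<forall>i<N. x i = y i)"

text \<open>
  Every binary sequence whatsoever satisfies the admissibility condition for the first two letters,
  and each substitution doubles the length of the prefix.
\<close>

lemma admissible_prefix_iter:
  "admissible (lexlt_or_prefix (2 ^ Suc j)) UNIV thue_morse ((tm_subst ^^ j) \<tau>)"
proof (induction j)
  case 0
  have "lexlt_or_prefix 2 (ntail \<tau> n) thue_morse" if "\<tau> n \<noteq> \<tau> (Suc n)" for n
    using that thue_morse_values(1) by (auto simp: lexlt_or_prefix_def less_2_cases_iff ntail_def)
  then show ?case by (simp add: admissible_def)
next
  case (Suc j)
  have "admissible (lexlt_or_prefix (2 ^ Suc (Suc j))) UNIV (tm_subst thue_morse) (tm_subst ((tm_subst ^^ j) \<tau>))"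
    using Suc thue_morse_0 thue_morse_values(1)
  proof (rule admissible_subst)
    show "lexlt_or_prefix (2 ^ Suc (Suc j)) (tm_subst x) (tm_subst y)" if "lexlt_or_prefix (2 ^ Suc j) x y" for x y
      using that by (auto simp: lexlt_or_prefix_def tm_subst_def intro: lexlt_subst)
  qed (auto simp: lexlt_or_prefix_def)
  then show ?case by (simp add: subst_thue_morse)
qed

text \<open>The lexicographically largest sequence with the first \<open>K\<close> digits of
  \<open>s\<close>. Comparison with it needs only \<open>K\<close> digits, at a cost in value that
  vanishes as \<open>K\<close> grows.\<close>

definition truncate :: "nat \<Rightarrow> int \<Rightarrow> (nat \<Rightarrow> int) \<Rightarrow> nat \<Rightarrow> int" where
  "truncate K M s i = (if i < K then s i else M)"

lemma lexle_truncate: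
  assumes "digits_upto M c" "lexle c s \<or> (\<forall>i<K. c i = s i)"
  shows "lexle c (truncate K M s)"
proof (cases "c = truncate K M s")
  case False
  then obtain p where p: "\<And>i. i < p \<Longrightarrow> c i = truncate K M s i" "c p \<noteq> truncate K M s p"
    using first_difference by blast
  have "c p < truncate K M s p"
  proof (cases "p < K")
    case True
    then have "\<forall>i<p. c i = s i" "c p \<noteq> s p" using p by (auto simp: truncate_def)
    then have "c p \<le> s p" using assms(2) True lexle_prefix[of c s p] by auto
    then show ?thesis using p(2) True by (simp add: truncate_def)
  next
    case False
    have "c p \<le> M" using assms(1) by (simp add: digits_upto_def)
    then show ?thesis using p(2) False by (simp add: truncate_def)
  qed
  with p(1) show ?thesis by (intro lexlt_imp_lexle lexltI) auto
qed simp

lemma unique_crit_substituted: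
  assumes m: "1 \<le> m" and q: "q_KL m < q"
  obtains j where "\<And>\<tau>. unique_crit (2 * int m) q (dig m ((tm_subst ^^ j) \<tau>))"
proof -
  define M where "M = 2 * int m"
  define s where "s = dig m thue_morse"
  have sd: "digits_upto M s" unfolding s_def M_def using m by (rule digits_upto_dig)
  have q1: "1 < q" using q q_KL_props(1)[OF m] by simp
  have vs: "val q s < 1"
    using val_base_less[OF q_KL_props(1)[OF m] q sd] q_KL_props(2)[OF m] by (simp add: s_def)
  define B where "B = of_int M / (q - 1)"
  have B: "0 \<le> B" using q1 by (simp add: B_def M_def)
  have "(\<lambda>n. val q s + B * (1 / q) ^ n) \<longlonglongrightarrow> val q s + B * 0"
    using q1 by (intro tendsto_intros LIMSEQ_realpow_zero) auto
  then have "\<forall>\<^sub>F n in sequentially. val q s + B * (1 / q) ^ n < 1"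
    using order_tendstoD(2)[of _ _ _ 1] vs by simp
  then obtain K0 where K0: "\<And>n. K0 \<le> n \<Longrightarrow> val q s + B * (1 / q) ^ n < 1"
    unfolding eventually_sequentially by blast
  \<comment> \<open>The successor keeps at least the first digit \<open>m + 1\<close> of
    \<open>s\<close> in the truncation.\<close>
  define K where "K = Suc K0"
  have tail: "val q s + B * (1 / q) ^ K < 1" using K0[of K] by (simp add: K_def)
  define u where "u = truncate K M s"
  have ud: "digits_upto M u" using sd by (auto simp: u_def truncate_def digits_upto_def M_def)
  have "val q u = (\<Sum>i<K. of_int (s i) / q ^ Suc i) + val q (shift K u) / q ^ K"
    using val_split_initial[OF q1 ud, of K] by (simp add: u_def truncate_def del: shift_apply)
  moreover have "val q s = (\<Sum>i<K. of_int (s i) / q ^ Suc i) + val q (shift K s) / q ^ K"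
    using val_split_initial[OF q1 sd] .
  moreover have "0 \<le> val q (shift K s) / q ^ K"
    using val_nonneg[OF q1 digits_upto_shift[OF sd]] q1 by simp
  moreover have "val q (shift K u) / q ^ K \<le> B / q ^ K"
    unfolding B_def using val_le[OF q1 digits_upto_shift[OF ud]] q1 by (intro divide_right_mono) auto
  ultimately have vu: "val q u < 1" using tail by (simp add: power_divide)
  have u0: "u 0 = int m + 1" by (simp add: u_def truncate_def K_def s_def dig_thue_morse_values)
  have "unique_crit M q (dig m ((tm_subst ^^ K) \<tau>))" for \<tau>
  proof -
    define \<sigma> where "\<sigma> = (tm_subst ^^ K) \<tau>"
    have sigd: "digits_upto M (dig m x)" for x unfolding M_def using m by (rule digits_upto_dig)
    have small: "lexle c u" if "c 0 < int m + 1" for c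
      using that u0 by (intro lexlt_imp_lexle lexltI[where n = 0]) auto
    have change: "lexle (dig m (ntail \<sigma> n)) u" if "\<sigma> n \<noteq> \<sigma> (Suc n)" for n
      unfolding u_def
    proof (rule lexle_truncate[OF sigd])
      have "lexlt_or_prefix (2 ^ Suc K) (ntail \<sigma> n) thue_morse"
        using admissibleD[OF admissible_prefix_iter UNIV_I] that unfolding \<sigma>_def by blast
      \<comment> \<open>Agreement of \<open>K\<close> digits amounts to agreement of
        \<open>Suc K\<close> binary terms, and \<open>2 ^ Suc K\<close> of them are under
        control.\<close>
      moreover have "Suc K \<le> 2 ^ Suc K" using less_exp[of "Suc K"] by simp
      moreover have "(\<forall>i<K. dig m (ntail \<sigma> n) i = s i) \<longleftrightarrow> (\<forall>i<Suc K. ntail \<sigma> n i = thue_morse i)"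
        unfolding s_def by (rule dig_agree) simp
      moreover have "lexlt (dig m (ntail \<sigma> n)) s \<longleftrightarrow> lexlt (ntail \<sigma> n) thue_morse"
        unfolding s_def by (rule dig_lexlt_iff) simp
      ultimately show "lexle (dig m (ntail \<sigma> n)) s \<or> (\<forall>i<K. dig m (ntail \<sigma> n) i = s i)"
        unfolding lexlt_or_prefix_def by (meson lexlt_imp_lexle order_less_le_trans)
    qed
    have "lexle (shift n (dig m \<sigma>)) u" for n
    proof (cases "\<not> \<sigma> n \<and> \<sigma> (Suc n)")
      case True
      then show ?thesis using change[of n] shift_dig[of \<sigma> n m] by simp
    next
      case False
      then show ?thesis by (intro small) (auto simp: dig_def)
    qed
    moreover have "lexle (compl_seq M (shift n (dig m \<sigma>))) u" for n
    proof (cases "\<sigma> n \<and> \<not> \<sigma> (Suc n)")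
      case True
      then show ?thesis using change[of n] shift_dig_compl[of \<sigma> n m] by (simp add: M_def)
    next
      case False
      then show ?thesis by (intro small) (auto simp: dig_def M_def)
    qed
    ultimately show ?thesis
      unfolding \<sigma>_def[symmetric] by (intro unique_crit_of_lexle[OF q1 sigd ud vu])
  qed
  then show thesis unfolding M_def by (rule that)
qed

lemma D_set_contains_interval:
  assumes m: "1 \<le> m" and q: "q_KL m < q"
  shows "\<exists>a b. a < b \<and> {a..b} \<subseteq> D_set m q"
proof -
  obtain j where j: "\<And>\<tau>. unique_crit (2 * int m) q (dig m ((tm_subst ^^ j) \<tau>))"
    using unique_crit_substituted[OF m q] by blast
  have q1: "1 < q" using q q_KL_props(1)[OF m] by simp
  have qm: "real m + 1 < q"
    using base_gt_of_unique_crit_zero[OF m q_KL_props(1)[OF m] unique_crit_period_seq[OF m q_KL_props[OF m]]] q by linarith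
  \<comment> \<open>The dimension is affine in the frequency \<open>\<theta>\<close> before
    substitution, and \<open>B\<close> is its slope: nonzero, with a sign depending on the parity of
    \<open>j\<close>, hence \<open>min\<close> and \<open>max\<close> below.\<close>
  define B where "B = (ln (real m + 1) - ln (real m)) * (- 1 / 2) ^ j / ln q"
  define A where "A = dim_of_freq m q ((swap_freq ^^ j) 0)"
  have B: "B \<noteq> 0" using m q1 by (simp add: B_def)
  have AB: "dim_of_freq m q ((swap_freq ^^ j) \<theta>) = A + B * \<theta>" for \<theta>
    unfolding A_def B_def dim_of_freq_def swap_freq_iter
    by (simp add: algebra_simps add_divide_distrib diff_divide_distrib)
  have mem: "A + B * \<theta> \<in> D_set m q" if t: "0 \<le> \<theta>" "\<theta> \<le> 1" for \<theta>
  proof -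
    obtain \<tau> where \<tau>: "near_avg (eq_next \<tau>) \<theta> 0" using exists_seq_with_freq[OF t] by blast
    have "near_avg (eq_next ((tm_subst ^^ j) \<tau>)) ((swap_freq ^^ j) \<theta>) 0"
      using near_avg_subst_iter[OF \<tau>, of j] by simp
    then have "near_avg (eq_next ((tm_subst ^^ j) \<tau>)) ((swap_freq ^^ j) \<theta>) e" if "0 < e" for e
      by (rule near_avg_mono) (use that in simp)
    then have "dim_intersection m q (translation m q (dig m ((tm_subst ^^ j) \<tau>))) = A + B * \<theta>"
      unfolding AB[symmetric] by (intro dim_eventually_dig[OF m qm j, where N = 0]) auto
    then show ?thesis unfolding D_set_altdef[OF q1] using j[of \<tau>] by force
  qed
  have "x \<in> D_set m q" if "x \<in> {min A (A + B)..max A (A + B)}" for x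
  proof -
    have "0 \<le> (x - A) / B" "(x - A) / B \<le> 1"
      using that B by (auto simp: min_def max_def divide_simps split: if_splits)
    then show ?thesis using mem[of "(x - A) / B"] B by simp
  qed
  moreover have "min A (A + B) < max A (A + B)" using B by (auto simp: min_def max_def)
  ultimately show ?thesis by blast
qed

theorem theorem1p2:
  fixes m :: nat
  assumes "m \<ge> 1"
  shows
    "(\<forall>q. q_KL m < q \<longrightarrow> (\<exists>a b. a < b \<and> {a..b} \<subseteq> D_set m q))
     \<and>
     D_set m (q_KL m) =
       {0, ln (real m + 1) / ln (q_KL m),
        ln ((real m)\<^sup>2 * (real m + 1)) / (3 * ln (q_KL m))}
       \<union> {dim_value m (q_KL m) j | j. 1 \<le> j}
     \<and>
     (\<forall>k q. 1 \<le> k \<and> q_base m k < q \<and> q \<le> q_base m (Suc k) \<longrightarrow>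
        D_set m q =
          {0, ln (real m + 1) / ln q} \<union> {dim_value m q j | j. 1 \<le> j \<and> j < k}
        \<and>
        (\<forall>t c j. t \<in> U_set m q \<and> is_expansion q {- int m..int m} c t \<and> 1 \<le> j \<and>
            ends_with (\<lambda>i. int m + c i)
              (periodic_seq (omega m j @ reflect_word m (omega m j))) \<longrightarrow>
          dim_intersection m q t = dim_value m q j))"
proof (intro conjI allI impI)
  fix q assume "q_KL m < q"
  then show "\<exists>a b. a < b \<and> {a..b} \<subseteq> D_set m q" by (rule D_set_contains_interval[OF assms])
next
  show "D_set m (q_KL m) =
      {0, ln (real m + 1) / ln (q_KL m), ln ((real m)\<^sup>2 * (real m + 1)) / (3 * ln (q_KL m))}
      \<union> {dim_value m (q_KL m) j | j. 1 \<le> j}"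
    using D_set_q_KL[OF assms] dim_of_freq_iter_range[OF assms, of "q_KL m" "\<lambda>_. True"]
      dim_of_freq_third[OF assms, of "q_KL m"] by auto
next
  fix k q assume kq: "1 \<le> k \<and> q_base m k < q \<and> q \<le> q_base m (Suc k)"
  then obtain k' where k': "k = Suc k'" by (cases k) auto
  have "{dim_value m q j | j. 1 \<le> j \<and> j < k} = {dim_value m q j | j. 1 \<le> j \<and> j \<le> k'}"
    using k' by (simp add: less_Suc_eq_le)
  then show "D_set m q = {0, ln (real m + 1) / ln q} \<union> {dim_value m q j | j. 1 \<le> j \<and> j < k}"
    using D_set_between(2)[OF assms, of k' q] kq k' dim_of_freq_iter_range[OF assms, of q "\<lambda>j. j \<le> k'"] by auto
next
  fix k q t c j
  assume kq: "1 \<le> k \<and> q_base m k < q \<and> q \<le> q_base m (Suc k)"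
    and a: "t \<in> U_set m q \<and> is_expansion q {- int m..int m} c t \<and> 1 \<le> j \<and>
      ends_with (\<lambda>i. int m + c i) (periodic_seq (omega m j @ reflect_word m (omega m j)))"
  obtain k' where k': "k = Suc k'" using kq by (cases k) auto
  obtain j' where j': "j = Suc j'" using a by (cases j) auto
  have qm: "real m + 1 < q" using D_set_between(1)[OF assms, of k' q] kq k' by simp
  then have q1: "1 < q" by linarith
  have u: "unique_crit (2 * int m) q (\<lambda>i. int m + c i)" "t = translation m q (\<lambda>i. int m + c i)"
    using U_set_expansion_iff[OF q1, of t m c] a by (auto simp: translation_def)
  obtain N where N: "shift N (\<lambda>i. int m + c i) = dig m (period_seq j)"
    using a unfolding j' periodic_seq_omega ends_with_def by (auto simp: fun_eq_iff)
  show "dim_intersection m q t = dim_value m q j"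
    unfolding u(2) using dim_period_seq[OF assms qm u(1) N] dim_value_eq[OF assms, of j q] a by simp
qed

end
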